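(* Let $\Gamma$ and $\Lambda$ be countable discrete groups, and let $m_\Gamma\in\ell^1(\Gamma)$, $m_\Lambda\in\ell^1(\Lambda)$ be finite complex measures such that the convolution operators $L_{m_\Gamma}$ on $\ell^2(\Gamma)$ and $L_{m_\Lambda}$ on $\ell^2(\Lambda)$ are self-adjoint. Let $M=L_{m_{\Lambda\wr\Gamma}}$ be the convolution operator on $\ell^2(\Lambda\wr\Gamma)$ with $m_{\Lambda\wr\Gamma}=\hat m_\Lambda+\hat m_\Gamma$. Assume that the spectral measure $\mu_{L_{m_\Lambda}}^{e_\Lambda}$ is absolutely continuous with respect to Lebesgue measure with bounded density, bounded by a constant $C$. Then the Plancherel measure $\mu_M^{e_{\Lambda\wr\Gamma}}$ is absolutely continuous with respect to Lebesgue measure with density bounded by the same constant $C$. In particular, $M$ is a purely absolutely continuous operator (i.e. all its spectral measures are absolutely continuous).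
   Context: For a countable discrete group $G$ with identity $e_G$, $\delta_x$ ($x\in G$) is the canonical basis of $\ell^2(G)$. The left regular representation is $(L_xf)(y)=f(x^{-1}y)$. For a finite complex measure $m\in\ell^1(G)$, the convolution operator is $L_m=\sum_{x\in G}m(x)L_x$; it is self-adjoint iff $m(g^{-1})=\overline{m(g)}$ for all $g$. For a bounded self-adjoint operator $L$ with spectral resolution $E_L$, $\mu_L^x(\cdot)=\langle\delta_x,E_L(\cdot)\delta_x\rangle$. For a self-adjoint convolution operator this measure does not depend on $x$ and is called the Plancherel measure. Wreath product: $\Lambda\wr\Gamma=(\bigoplus_\Gamma\Lambda)\rtimes\Gamma$ is the set of pairs $(f,g)$ with $g\in\Gamma$ and $f:\Gamma\to\Lambda$ finitely supported, with product $(f,g)(f',g')=(f\cdot(f'\circ g^{-1}),gg')$, where $(f'\circ g^{-1})(h)=f'(g^{-1}h)$. The groups embed by $g\mapsto\hat g=(e,g)$, with $e$ the constant function $e_\Lambda$, and $l\mapsto\hat l=(1_l,e_\Gamma)$, with $1_l(e_\Gamma)=l$ and $1_l(x)=e_\Lambda$ for $x\neq e_\Gamma$. For a measure $m$ on $\Gamma$ or $\Lambda$, $\hat m$ denotes its push-forward to $\Lambda\wr\Gamma$ under the corresponding embedding. *)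

theory Defs
  imports "HOL-Analysis.Analysis" "HOL-Algebra.Group"
begin

section \<open>The Hilbert space of square-summable functions on a set\<close>

text \<open>Elements are total functions vanishing outside \<open>X\<close>, so that equality of vectors is
  equality of functions.\<close>

definition ell2 :: "'a set \<Rightarrow> ('a \<Rightarrow> complex) set" where
  "ell2 X = {f. (\<forall>x. x \<notin> X \<longrightarrow> f x = 0) \<and> (\<lambda>x. (cmod (f x))\<^sup>2) summable_on X}"

definition ell2_inner :: "'a set \<Rightarrow> ('a \<Rightarrow> complex) \<Rightarrow> ('a \<Rightarrow> complex) \<Rightarrow> complex" where
  "ell2_inner X f g = (\<Sum>\<^sub>\<infinity>x\<in>X. cnj (f x) * g x)"

definition ell2_norm :: "'a set \<Rightarrow> ('a \<Rightarrow> complex) \<Rightarrow> real" where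
  "ell2_norm X f = sqrt (\<Sum>\<^sub>\<infinity>x\<in>X. (cmod (f x))\<^sup>2)"

definition delta :: "'a \<Rightarrow> 'a \<Rightarrow> complex" where
  "delta x = (\<lambda>y. if y = x then 1 else 0)"

type_synonym 'a operator = "('a \<Rightarrow> complex) \<Rightarrow> ('a \<Rightarrow> complex)"

text \<open>Only the values of an operator on \<open>ell2 X\<close> are relevant.\<close>

definition bounded_operator :: "'a set \<Rightarrow> 'a operator \<Rightarrow> bool" where
  "bounded_operator X T \<longleftrightarrow>
     (\<forall>f\<in>ell2 X. T f \<in> ell2 X) \<and>
     (\<forall>f\<in>ell2 X. \<forall>g\<in>ell2 X. T (\<lambda>x. f x + g x) = (\<lambda>x. T f x + T g x)) \<and>
     (\<forall>f\<in>ell2 X. \<forall>c. T (\<lambda>x. c * f x) = (\<lambda>x. c * T f x)) \<and>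
     (\<exists>K. \<forall>f\<in>ell2 X. ell2_norm X (T f) \<le> K * ell2_norm X f)"

definition selfadjoint_operator :: "'a set \<Rightarrow> 'a operator \<Rightarrow> bool" where
  "selfadjoint_operator X T \<longleftrightarrow>
     bounded_operator X T \<and>
     (\<forall>f\<in>ell2 X. \<forall>g\<in>ell2 X. ell2_inner X (T f) g = ell2_inner X f (T g))"

definition orthogonal_projector :: "'a set \<Rightarrow> 'a operator \<Rightarrow> bool" where
  "orthogonal_projector X P \<longleftrightarrow> selfadjoint_operator X P \<and> (\<forall>f\<in>ell2 X. P (P f) = P f)"


section \<open>Spectral resolutions and spectral measures\<close>

definition resolution_of_identity :: "'a set \<Rightarrow> (real set \<Rightarrow> 'a operator) \<Rightarrow> bool" where
  "resolution_of_identity X E \<longleftrightarrow>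
     (\<forall>A\<in>sets borel. orthogonal_projector X (E A)) \<and>
     (\<forall>f\<in>ell2 X. E UNIV f = f) \<and>
     (\<forall>A\<in>sets borel. \<forall>B\<in>sets borel. \<forall>f\<in>ell2 X. E (A \<inter> B) f = E A (E B f)) \<and>
     (\<forall>A :: nat \<Rightarrow> real set. range A \<subseteq> sets borel \<longrightarrow> disjoint_family A \<longrightarrow>
        (\<forall>f\<in>ell2 X. \<forall>g\<in>ell2 X.
           (\<lambda>n. ell2_inner X f (E (A n) g)) sums ell2_inner X f (E (\<Union>n. A n) g)))"

text \<open>The measure \<open>A \<mapsto> \<langle>f, E(A) f\<rangle>\<close>; since \<open>E A\<close> is an orthogonal projector, this number is
  real and nonnegative.\<close>

definition spectral_measure ::
    "'a set \<Rightarrow> (real set \<Rightarrow> 'a operator) \<Rightarrow> ('a \<Rightarrow> complex) \<Rightarrow> real measure" where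
  "spectral_measure X E f =
     measure_of UNIV (sets borel) (\<lambda>A. ennreal (Re (ell2_inner X f (E A f))))"

text \<open>\<open>E\<close> is the spectral resolution of the bounded self-adjoint operator \<open>L\<close>: a compactly
  supported resolution of the identity with \<open>L = \<integral>t dE(t)\<close> in the weak sense. The diagonal
  matrix elements suffice by polarization, the scalars being complex.\<close>

definition spectral_resolution ::
    "'a set \<Rightarrow> 'a operator \<Rightarrow> (real set \<Rightarrow> 'a operator) \<Rightarrow> bool" where
  "spectral_resolution X L E \<longleftrightarrow>
     resolution_of_identity X E \<and>
     (\<exists>R. \<forall>f\<in>ell2 X. E {-R..R} f = f) \<and>
     (\<forall>f\<in>ell2 X. ell2_inner X f (L f) = complex_of_real (\<integral>t. t \<partial>spectral_measure X E f))"

text \<open>Absolute continuity with respect to Lebesgue measure with a density bounded by \<open>C\<close>.\<close>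

definition has_density_bounded_by :: "real measure \<Rightarrow> real \<Rightarrow> bool" where
  "has_density_bounded_by \<mu> C \<longleftrightarrow>
     (\<exists>\<rho> :: real \<Rightarrow> real. \<rho> \<in> borel_measurable borel \<and> (\<forall>t. 0 \<le> \<rho> t \<and> \<rho> t \<le> C) \<and>
        \<mu> = density lborel (\<lambda>t. ennreal (\<rho> t)))"

definition purely_absolutely_continuous :: "'a set \<Rightarrow> (real set \<Rightarrow> 'a operator) \<Rightarrow> bool" where
  "purely_absolutely_continuous X E \<longleftrightarrow>
     (\<forall>f\<in>ell2 X. absolutely_continuous lborel (spectral_measure X E f))"


section \<open>Convolution operators\<close>

definition left_regular :: "('a, 'b) monoid_scheme \<Rightarrow> 'a \<Rightarrow> 'a operator" where
  "left_regular G x f = (\<lambda>y. if y \<in> carrier G then f (inv\<^bsub>G\<^esub> x \<otimes>\<^bsub>G\<^esub> y) else 0)"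

text \<open>Finite complex measures on the discrete group \<open>G\<close> are given by their point masses; values
  outside the carrier are ignored.\<close>

definition finite_complex_measure :: "('a, 'b) monoid_scheme \<Rightarrow> ('a \<Rightarrow> complex) \<Rightarrow> bool" where
  "finite_complex_measure G m \<longleftrightarrow> (\<lambda>x. cmod (m x)) summable_on carrier G"

definition convolution_operator ::
    "('a, 'b) monoid_scheme \<Rightarrow> ('a \<Rightarrow> complex) \<Rightarrow> 'a operator" where
  "convolution_operator G m f = (\<lambda>y. \<Sum>\<^sub>\<infinity>x\<in>carrier G. m x * left_regular G x f y)"

definition plancherel_measure ::
    "('a, 'b) monoid_scheme \<Rightarrow> (real set \<Rightarrow> 'a operator) \<Rightarrow> real measure" where
  "plancherel_measure G E = spectral_measure (carrier G) E (delta \<one>\<^bsub>G\<^esub>)"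

definition push_forward ::
    "('a, 'b) monoid_scheme \<Rightarrow> ('a \<Rightarrow> 'c) \<Rightarrow> ('a \<Rightarrow> complex) \<Rightarrow> ('c \<Rightarrow> complex)" where
  "push_forward G \<phi> m = (\<lambda>y. \<Sum>\<^sub>\<infinity>x\<in>{x \<in> carrier G. \<phi> x = y}. m x)"


section \<open>Wreath products\<close>

text \<open>\<open>wreath \<Lambda> \<Gamma>\<close> is the restricted wreath product \<open>\<Lambda> \<wr> \<Gamma>\<close>. Lamp configurations are extensional
  functions on the carrier of \<open>\<Gamma>\<close>.\<close>

definition wreath ::
    "('l, 'x) monoid_scheme \<Rightarrow> ('g, 'y) monoid_scheme \<Rightarrow> (('g \<Rightarrow> 'l) \<times> 'g) monoid" where
  "wreath \<Lambda> \<Gamma> =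
     \<lparr> carrier = {f \<in> carrier \<Gamma> \<rightarrow>\<^sub>E carrier \<Lambda>. finite {h \<in> carrier \<Gamma>. f h \<noteq> \<one>\<^bsub>\<Lambda>\<^esub>}} \<times> carrier \<Gamma>,
       monoid.mult = (\<lambda>(f, g) (f', g').
         (\<lambda>h\<in>carrier \<Gamma>. f h \<otimes>\<^bsub>\<Lambda>\<^esub> f' (inv\<^bsub>\<Gamma>\<^esub> g \<otimes>\<^bsub>\<Gamma>\<^esub> h), g \<otimes>\<^bsub>\<Gamma>\<^esub> g')),
       one = (\<lambda>h\<in>carrier \<Gamma>. \<one>\<^bsub>\<Lambda>\<^esub>, \<one>\<^bsub>\<Gamma>\<^esub>) \<rparr>"

definition embed_base ::
    "('l, 'x) monoid_scheme \<Rightarrow> ('g, 'y) monoid_scheme \<Rightarrow> 'g \<Rightarrow> ('g \<Rightarrow> 'l) \<times> 'g" where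
  "embed_base \<Lambda> \<Gamma> g = (\<lambda>h\<in>carrier \<Gamma>. \<one>\<^bsub>\<Lambda>\<^esub>, g)"

definition embed_lamp ::
    "('l, 'x) monoid_scheme \<Rightarrow> ('g, 'y) monoid_scheme \<Rightarrow> 'l \<Rightarrow> ('g \<Rightarrow> 'l) \<times> 'g" where
  "embed_lamp \<Lambda> \<Gamma> l = (\<lambda>h\<in>carrier \<Gamma>. if h = \<one>\<^bsub>\<Gamma>\<^esub> then l else \<one>\<^bsub>\<Lambda>\<^esub>, \<one>\<^bsub>\<Gamma>\<^esub>)"

definition wreath_measure ::
    "('l, 'x) monoid_scheme \<Rightarrow> ('g, 'y) monoid_scheme \<Rightarrow> ('l \<Rightarrow> complex) \<Rightarrow> ('g \<Rightarrow> complex) \<Rightarrow>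
     ('g \<Rightarrow> 'l) \<times> 'g \<Rightarrow> complex" where
  "wreath_measure \<Lambda> \<Gamma> m\<^sub>\<Lambda> m\<^sub>\<Gamma> =
     (\<lambda>w. push_forward \<Lambda> (embed_lamp \<Lambda> \<Gamma>) m\<^sub>\<Lambda> w + push_forward \<Gamma> (embed_base \<Lambda> \<Gamma>) m\<^sub>\<Gamma> w)"

lemma group_wreath:
  assumes "group \<Lambda>" "group \<Gamma>"
  shows "group (wreath \<Lambda> \<Gamma>)"
proof -
  interpret L: group \<Lambda> by fact
  interpret G: group \<Gamma> by fact
  have fin: "finite {h \<in> carrier \<Gamma>. f (x \<otimes>\<^bsub>\<Gamma>\<^esub> h) \<noteq> \<one>\<^bsub>\<Lambda>\<^esub>}"
    if "finite {h \<in> carrier \<Gamma>. f h \<noteq> \<one>\<^bsub>\<Lambda>\<^esub>}" "x \<in> carrier \<Gamma>" for f and x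
  proof (rule finite_imageD)
    show "finite ((\<otimes>\<^bsub>\<Gamma>\<^esub>) x ` {h \<in> carrier \<Gamma>. f (x \<otimes>\<^bsub>\<Gamma>\<^esub> h) \<noteq> \<one>\<^bsub>\<Lambda>\<^esub>})"
      by (rule finite_subset[OF _ that(1)]) (use that in auto)
    show "inj_on ((\<otimes>\<^bsub>\<Gamma>\<^esub>) x) {h \<in> carrier \<Gamma>. f (x \<otimes>\<^bsub>\<Gamma>\<^esub> h) \<noteq> \<one>\<^bsub>\<Lambda>\<^esub>}"
      using that by (auto intro!: inj_onI)
  qed
  show ?thesis
  proof (rule groupI, goal_cases)
    case (1 x y)
    obtain f g f' g' where xy: "x = (f, g)" "y = (f', g')" by (metis surj_pair)
    have "finite {h \<in> carrier \<Gamma>. f h \<otimes>\<^bsub>\<Lambda>\<^esub> f' (inv\<^bsub>\<Gamma>\<^esub> g \<otimes>\<^bsub>\<Gamma>\<^esub> h) \<noteq> \<one>\<^bsub>\<Lambda>\<^esub>}"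
      by (rule finite_subset[where B = "{h \<in> carrier \<Gamma>. f h \<noteq> \<one>\<^bsub>\<Lambda>\<^esub>} \<union>
            {h \<in> carrier \<Gamma>. f' (inv\<^bsub>\<Gamma>\<^esub> g \<otimes>\<^bsub>\<Gamma>\<^esub> h) \<noteq> \<one>\<^bsub>\<Lambda>\<^esub>}"])
        (use 1 fin[of f' "inv\<^bsub>\<Gamma>\<^esub> g"] in \<open>auto simp: wreath_def xy\<close>)
    then show ?case
      using 1 by (auto simp: wreath_def xy PiE_iff cong: conj_cong)
  next
    case 2
    then show ?case by (auto simp: wreath_def cong: conj_cong)
  next
    case (3 x y z)
    then show ?case
      by (auto simp: wreath_def PiE_iff L.m_assoc G.m_assoc G.inv_mult_group split: prod.splits
               intro!: restrict_ext)
  next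
    case (4 x)
    then show ?case
      by (auto simp: wreath_def PiE_iff extensional_def restrict_def fun_eq_iff
               split: prod.splits)
  next
    case (5 x)
    obtain f g where x: "x = (f, g)" by (metis surj_pair)
    let ?y = "(\<lambda>h\<in>carrier \<Gamma>. inv\<^bsub>\<Lambda>\<^esub> f (g \<otimes>\<^bsub>\<Gamma>\<^esub> h), inv\<^bsub>\<Gamma>\<^esub> g)"
    have "finite {h \<in> carrier \<Gamma>. inv\<^bsub>\<Lambda>\<^esub> f (g \<otimes>\<^bsub>\<Gamma>\<^esub> h) \<noteq> \<one>\<^bsub>\<Lambda>\<^esub>}"
      by (rule finite_subset[OF _ fin[of f g]]) (use 5 in \<open>auto simp: wreath_def x\<close>)
    then have "?y \<in> carrier (wreath \<Lambda> \<Gamma>)"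
      using 5 by (auto simp: wreath_def x PiE_iff cong: conj_cong)
    moreover have "?y \<otimes>\<^bsub>wreath \<Lambda> \<Gamma>\<^esub> x = \<one>\<^bsub>wreath \<Lambda> \<Gamma>\<^esub>"
      using 5 by (auto simp: wreath_def x PiE_iff intro!: restrict_ext)
    ultimately show ?case by blast
  qed
qed

lemma embed_base_hom:
  assumes "group \<Lambda>" "group \<Gamma>"
  shows "embed_base \<Lambda> \<Gamma> \<in> hom \<Gamma> (wreath \<Lambda> \<Gamma>)"
proof -
  interpret L: group \<Lambda> by fact
  interpret G: group \<Gamma> by fact
  show ?thesis
    by (auto simp: hom_def embed_base_def wreath_def intro!: restrict_ext cong: conj_cong)
qed

lemma embed_lamp_hom:
  assumes "group \<Lambda>" "group \<Gamma>"
  shows "embed_lamp \<Lambda> \<Gamma> \<in> hom \<Lambda> (wreath \<Lambda> \<Gamma>)"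
proof -
  interpret L: group \<Lambda> by fact
  interpret G: group \<Gamma> by fact
  have "finite {h \<in> carrier \<Gamma>. (if h = \<one>\<^bsub>\<Gamma>\<^esub> then l else \<one>\<^bsub>\<Lambda>\<^esub>) \<noteq> \<one>\<^bsub>\<Lambda>\<^esub>}" for l
    by (rule finite_subset[of _ "{\<one>\<^bsub>\<Gamma>\<^esub>}"]) auto
  then show ?thesis
    by (auto simp: hom_def embed_lamp_def wreath_def intro!: restrict_ext cong: conj_cong)
qed

end

theory Submission
  imports Defs "HOL-Computational_Algebra.Polynomial"
begin

text \<open>
  Write a point of \<open>\<Lambda> \<wr> \<Gamma>\<close> as \<open>(\<eta>, g)\<close>, where \<open>\<eta>\<close> is the lamp configuration and \<open>g\<close> the position
  of the lamplighter. Left multiplication by an element of \<open>\<Gamma>\<close> moves the lamplighter together with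
  the configuration, so it preserves the lamp \<open>\<eta> g\<close> under his feet. Left multiplication by an element
  of \<open>\<Lambda>\<close> changes \<open>\<eta> g\<close> exactly when \<open>g = \<one>\<close>, and then it acts on this lamp as on \<open>\<Lambda>\<close> itself. If
  \<open>P\<close> denotes the projection onto the functions supported on \<open>g = \<one>\<close>, then, with respect to the
  coordinate \<open>\<eta> g\<close>, the operator is \<open>M = 1 \<otimes> N + L \<otimes> P\<close>: here \<open>L\<close> is the convolution operator of
  \<open>\<Lambda>\<close>, and \<open>N\<close> is a self-adjoint operator that leaves the distinguished lamp alone
  (\<open>wreath_convolution_lamp_tensor\<close>). The lamp enters only through powers of \<open>L\<close> between point masses
  at the identity, and these are the moments of its Plancherel measure \<open>\<rho>(t) dt\<close>. Hence the moments
  of the Plancherel measure of \<open>M\<close> are averages of moments of a self-adjoint pencil,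
  \[ \langle\delta, M^n \delta\rangle
     = \int \rho(t)\, \langle\delta, (N + t P)^n \delta\rangle\, dt, \qquad P\delta = \delta \]
  (\<open>wreath_convolution_moment\<close>).

  This is the situation of spectral averaging, as in Wegner estimates for random Schroedinger
  operators. For \<open>Im z > 0\<close> the function
  \<open>F(\<zeta>) = \<langle>\<delta>, (N + \<zeta> P - z)\<inverse> \<delta>\<rangle>\<close> is analytic in the closed lower half plane, has nonnegative
  imaginary part there and behaves like \<open>1/\<zeta>\<close> at infinity. Deforming the real axis into a large
  lower semicircle shows that the integral of \<open>Im F\<close> over the real line is at most \<open>\<pi>\<close>, and so its
  integral against \<open>\<rho>\<close> is at most \<open>\<pi> C\<close>. The result is \<open>averaged_Poisson_bound\<close>: all Poisson integrals
  of the Plancherel measure \<open>\<mu>\<close> of \<open>M\<close> are at most \<open>\<pi> C\<close>. By Stieltjes inversion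
  \<open>\<mu>(U) \<le> C |U|\<close> for open sets \<open>U\<close>, which gives the bounded density.

  Moments are tied to resolvents by polynomials. The Richardson iteration for
  \<open>(T - z) u = d\<close> with a suitable imaginary step contracts at a geometric rate, both for operators with
  \<open>Im \<langle>f, T f\<rangle> \<le> 0\<close> and for real numbers in place of \<open>T\<close>; its iterates are polynomials in \<open>T\<close> applied
  to \<open>d\<close>. Thus \<open>F\<close> is replaced throughout by polynomials in \<open>\<zeta>\<close>, and the deformation of
  the contour becomes the fundamental theorem of calculus.

  Right translations commute with \<open>M\<close>, so the argument applies to the spectral measure of every point
  mass. For a Lebesgue null set the spectral projector therefore annihilates all point masses, hence
  vanishes, and every spectral measure is absolutely continuous.
\<close>

section \<open>Geometry of square-summable functions\<close>

lemma ell2_mult_abs_summable: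
  assumes "f \<in> ell2 X" "g \<in> ell2 X"
  shows "(\<lambda>x. norm (cnj (f x) * g x)) summable_on X"
proof (rule Infinite_Sum.abs_summable_on_comparison_test')
  show "(\<lambda>x. (cmod (f x))\<^sup>2 + (cmod (g x))\<^sup>2) summable_on X"
    using assms by (intro summable_on_add) (auto simp: ell2_def)
  fix x
  have "2 * (cmod (f x) * cmod (g x)) \<le> (cmod (f x))\<^sup>2 + (cmod (g x))\<^sup>2"
    using sum_squares_bound[of "cmod (f x)" "cmod (g x)"] by simp
  moreover have "0 \<le> cmod (f x) * cmod (g x)" by simp
  ultimately show "norm (cnj (f x) * g x) \<le> (cmod (f x))\<^sup>2 + (cmod (g x))\<^sup>2"
    unfolding norm_mult complex_mod_cnj by linarith
qed

lemma ell2_mult_summable: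
  assumes "f \<in> ell2 X" "g \<in> ell2 X"
  shows "(\<lambda>x. cnj (f x) * g x) summable_on X"
  using ell2_mult_abs_summable[OF assms] by (rule abs_summable_summable)

lemma ell2_outside: "f \<in> ell2 X \<Longrightarrow> x \<notin> X \<Longrightarrow> f x = 0"
  by (auto simp: ell2_def)

lemma ell2_zero [simp]: "(\<lambda>x. 0) \<in> ell2 X"
  by (simp add: ell2_def)

lemma ell2_scale [simp]: "f \<in> ell2 X \<Longrightarrow> (\<lambda>x. c * f x) \<in> ell2 X"
  by (auto simp: ell2_def norm_mult power_mult_distrib intro!: summable_on_cmult_right)

lemma ell2_add [simp]:
  assumes "f \<in> ell2 X" "g \<in> ell2 X"
  shows "(\<lambda>x. f x + g x) \<in> ell2 X"
proof -
  have "(\<lambda>x. norm ((cmod (f x + g x))\<^sup>2)) summable_on X"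
  proof (rule Infinite_Sum.abs_summable_on_comparison_test')
    show "(\<lambda>x. 2 * (cmod (f x))\<^sup>2 + 2 * (cmod (g x))\<^sup>2) summable_on X"
      using assms by (intro summable_on_add summable_on_cmult_right) (auto simp: ell2_def)
    fix x
    have "(cmod (f x + g x))\<^sup>2 \<le> (cmod (f x) + cmod (g x))\<^sup>2"
      by (simp add: norm_triangle_ineq power_mono)
    also have "\<dots> \<le> 2 * (cmod (f x))\<^sup>2 + 2 * (cmod (g x))\<^sup>2"
      using sum_squares_bound[of "cmod (f x)" "cmod (g x)"] by (simp add: power2_sum)
    finally show "norm ((cmod (f x + g x))\<^sup>2) \<le> 2 * (cmod (f x))\<^sup>2 + 2 * (cmod (g x))\<^sup>2"
      by simp
  qed
  then show ?thesis
    using assms by (simp add: ell2_def)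
qed

lemma ell2_uminus [simp]: "f \<in> ell2 X \<Longrightarrow> (\<lambda>x. - f x) \<in> ell2 X"
  using ell2_scale[of f X "-1"] by simp

lemma ell2_diff [simp]: "f \<in> ell2 X \<Longrightarrow> g \<in> ell2 X \<Longrightarrow> (\<lambda>x. f x - g x) \<in> ell2 X"
  using ell2_add[of f X "\<lambda>x. - g x"] by simp

lemma ell2_sum: "(\<And>i. i \<in> I \<Longrightarrow> f i \<in> ell2 X) \<Longrightarrow> (\<lambda>x. \<Sum>i\<in>I. f i x) \<in> ell2 X"
  by (induction I rule: infinite_finite_induct) auto

lemma ell2_delta [simp]: "x \<in> X \<Longrightarrow> delta x \<in> ell2 X"
proof -
  assume x: "x \<in> X"
  have "(\<lambda>y. (cmod (delta x y))\<^sup>2) summable_on X"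
    by (rule finite_nonzero_values_imp_summable_on, rule finite_subset[of _ "{x}"])
      (auto simp: delta_def)
  with x show ?thesis by (auto simp: ell2_def delta_def)
qed

lemma ell2_inner_delta_left [simp]: "x \<in> X \<Longrightarrow> ell2_inner X (delta x) f = f x"
proof -
  assume "x \<in> X"
  then have "(\<Sum>\<^sub>\<infinity>y\<in>X. cnj (delta x y) * f y) = (\<Sum>\<^sub>\<infinity>y\<in>{x}. f y)"
    by (intro infsum_cong_neutral) (auto simp: delta_def)
  then show ?thesis by (simp add: ell2_inner_def)
qed

lemma ell2_inner_commute: "ell2_inner X g f = cnj (ell2_inner X f g)"
  unfolding ell2_inner_def by (subst infsum_cnj[symmetric]) (simp add: mult.commute)

lemma ell2_inner_add_right:
  "f \<in> ell2 X \<Longrightarrow> g \<in> ell2 X \<Longrightarrow> h \<in> ell2 X \<Longrightarrow>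
    ell2_inner X f (\<lambda>x. g x + h x) = ell2_inner X f g + ell2_inner X f h"
  by (simp add: ell2_inner_def distrib_left infsum_add ell2_mult_summable)

lemma ell2_inner_scale_right: "ell2_inner X f (\<lambda>x. c * g x) = c * ell2_inner X f g"
  by (simp add: ell2_inner_def mult.left_commute infsum_cmult_right')

lemma ell2_inner_uminus_right: "ell2_inner X f (\<lambda>x. - g x) = - ell2_inner X f g"
  using ell2_inner_scale_right[of X f "-1" g] by simp

lemma ell2_inner_diff_right:
  "f \<in> ell2 X \<Longrightarrow> g \<in> ell2 X \<Longrightarrow> h \<in> ell2 X \<Longrightarrow>
    ell2_inner X f (\<lambda>x. g x - h x) = ell2_inner X f g - ell2_inner X f h"
  using ell2_inner_add_right[of f X g "\<lambda>x. - h x"] by (simp add: ell2_inner_uminus_right)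

lemma ell2_inner_add_left:
  "f \<in> ell2 X \<Longrightarrow> g \<in> ell2 X \<Longrightarrow> h \<in> ell2 X \<Longrightarrow>
    ell2_inner X (\<lambda>x. g x + h x) f = ell2_inner X g f + ell2_inner X h f"
  by (subst (1 2 3) ell2_inner_commute) (simp add: ell2_inner_add_right)

lemma ell2_inner_scale_left: "ell2_inner X (\<lambda>x. c * g x) f = cnj c * ell2_inner X g f"
  by (subst (1 2) ell2_inner_commute) (simp add: ell2_inner_scale_right)

lemma ell2_inner_diff_left:
  "f \<in> ell2 X \<Longrightarrow> g \<in> ell2 X \<Longrightarrow> h \<in> ell2 X \<Longrightarrow>
    ell2_inner X (\<lambda>x. g x - h x) f = ell2_inner X g f - ell2_inner X h f"
  by (subst (1 2 3) ell2_inner_commute) (simp add: ell2_inner_diff_right)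

lemma ell2_inner_sum_right:
  "f \<in> ell2 X \<Longrightarrow> (\<And>i. i \<in> I \<Longrightarrow> g i \<in> ell2 X) \<Longrightarrow>
    ell2_inner X f (\<lambda>x. \<Sum>i\<in>I. g i x) = (\<Sum>i\<in>I. ell2_inner X f (g i))"
proof (induction I rule: infinite_finite_induct)
  case (insert i I)
  then show ?case by (simp add: ell2_inner_add_right ell2_sum)
qed (simp_all add: ell2_inner_def)

lemmas ell2_inner_simps = ell2_inner_add_right ell2_inner_scale_right ell2_inner_diff_right
  ell2_inner_add_left ell2_inner_scale_left ell2_inner_diff_left

lemma ell2_norm_nonneg [simp]: "0 \<le> ell2_norm X f"
  by (simp add: ell2_norm_def infsum_nonneg)

lemma ell2_norm_square: "(ell2_norm X f)\<^sup>2 = (\<Sum>\<^sub>\<infinity>x\<in>X. (cmod (f x))\<^sup>2)"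
  by (simp add: ell2_norm_def infsum_nonneg)

lemma ell2_inner_self: "ell2_inner X f f = complex_of_real ((ell2_norm X f)\<^sup>2)"
proof -
  have "cnj (f x) * f x = complex_of_real ((cmod (f x))\<^sup>2)" for x
    by (metis complex_norm_square mult.commute)
  then show ?thesis
    unfolding ell2_inner_def ell2_norm_square
    by (simp only:) (intro infsum_bounded_linear_strong bounded_linear_of_real
      summable_on_bounded_linear_iff[where h' = Re] bounded_linear_Re Re_complex_of_real)
qed

lemma Re_ell2_inner_self: "Re (ell2_inner X f f) = (ell2_norm X f)\<^sup>2"
  by (simp add: ell2_inner_self)

lemma ell2_norm_scale: "ell2_norm X (\<lambda>x. c * f x) = cmod c * ell2_norm X f"
  by (simp add: ell2_norm_def norm_mult power_mult_distrib infsum_cmult_right' real_sqrt_mult)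

lemma ell2_norm_uminus: "ell2_norm X (\<lambda>x. - f x) = ell2_norm X f"
  by (simp add: ell2_norm_def)

lemma ell2_norm_delta [simp]: "x \<in> X \<Longrightarrow> ell2_norm X (delta x) = 1"
proof -
  assume "x \<in> X"
  then have "ell2_inner X (delta x) (delta x) = 1"
    by (simp only: ell2_inner_delta_left) (simp add: delta_def)
  then have "(ell2_norm X (delta x))\<^sup>2 = 1"
    using Re_ell2_inner_self[of X "delta x"] by simp
  then show ?thesis
    using ell2_norm_nonneg[of X "delta x"] by (simp add: power2_eq_1_iff)
qed

lemma ell2_norm_add_square:
  assumes "f \<in> ell2 X" "g \<in> ell2 X"
  shows "(ell2_norm X (\<lambda>x. f x + g x))\<^sup>2
    = (ell2_norm X f)\<^sup>2 + (ell2_norm X g)\<^sup>2 + 2 * Re (ell2_inner X f g)"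
proof -
  have "Re (ell2_inner X g f) = Re (ell2_inner X f g)"
    by (subst ell2_inner_commute) simp
  then show ?thesis
    using assms by (simp add: Re_ell2_inner_self[symmetric] ell2_inner_simps)
qed

text \<open>A quadratic polynomial in \<open>s\<close> without negative values has nonpositive discriminant. In the
  degenerate case \<open>A = 0\<close> it is affine, which forces \<open>W = 0\<close>.\<close>

lemma discriminant_bound:
  fixes A B W :: real
  assumes "0 \<le> A" "0 \<le> W" and quad: "\<And>s. 0 \<le> B + s\<^sup>2 * W * A - 2 * s * W"
  shows "W \<le> A * B"
proof -
  have B: "0 \<le> B" using quad[of 0] by simp
  consider "W = 0" | "0 < W" "A = 0" | "0 < A" using assms by linarith
  then show ?thesis
  proof cases
    case 1
    then show ?thesis using B \<open>0 \<le> A\<close> by simp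
  next
    case 2
    then show ?thesis using quad[of "(B + 1) / W"] B by simp
  next
    case 3
    have "(1 / A)\<^sup>2 * W * A = W / A" "2 * (1 / A) * W = 2 * (W / A)"
      using 3 by (simp_all add: power2_eq_square)
    with quad[of "1 / A"] have "W / A \<le> B" by linarith
    then show ?thesis using 3 by (simp add: pos_divide_le_eq mult.commute)
  qed
qed

lemma ell2_Cauchy_Schwarz:
  assumes f: "f \<in> ell2 X" and g: "g \<in> ell2 X"
  shows "cmod (ell2_inner X f g) \<le> ell2_norm X f * ell2_norm X g"
proof -
  define w where "w = ell2_inner X f g"
  \<comment> \<open>The square norm of \<open>g - s w f\<close> for real \<open>s\<close>; the factor \<open>w\<close> makes the cross term real.\<close>
  have quad: "0 \<le> (ell2_norm X g)\<^sup>2 + s\<^sup>2 * (cmod w)\<^sup>2 * (ell2_norm X f)\<^sup>2 - 2 * s * (cmod w)\<^sup>2"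
    for s :: real
  proof -
    have "0 \<le> (ell2_norm X (\<lambda>x. g x + (- of_real s * w) * f x))\<^sup>2" by simp
    also have "\<dots> = (ell2_norm X g)\<^sup>2 + (cmod (- of_real s * w) * ell2_norm X f)\<^sup>2
        + 2 * Re (- of_real s * w * cnj w)"
      by (simp only: ell2_norm_add_square[OF g ell2_scale[OF f]] ell2_norm_scale
        ell2_inner_scale_right ell2_inner_commute[of X g f] w_def)
    also have "Re (- of_real s * w * cnj w) = - s * (cmod w)\<^sup>2"
      unfolding cmod_power2 by (simp add: power2_eq_square algebra_simps)
    also have "(cmod (- of_real s * w) * ell2_norm X f)\<^sup>2 = s\<^sup>2 * (cmod w)\<^sup>2 * (ell2_norm X f)\<^sup>2"
      by (simp add: norm_mult power_mult_distrib)
    finally show ?thesis by linarith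
  qed
  have "(cmod w)\<^sup>2 \<le> (ell2_norm X f)\<^sup>2 * (ell2_norm X g)\<^sup>2"
    by (rule discriminant_bound[OF _ _ quad]) simp_all
  then have "(cmod w)\<^sup>2 \<le> (ell2_norm X f * ell2_norm X g)\<^sup>2"
    by (simp only: power_mult_distrib)
  then show ?thesis
    unfolding w_def by (rule power2_le_imp_le) simp
qed

lemma ell2_triangle:
  assumes "f \<in> ell2 X" "g \<in> ell2 X"
  shows "ell2_norm X (\<lambda>x. f x + g x) \<le> ell2_norm X f + ell2_norm X g"
proof (rule power2_le_imp_le)
  have "Re (ell2_inner X f g) \<le> ell2_norm X f * ell2_norm X g"
    using ell2_Cauchy_Schwarz[OF assms] complex_Re_le_cmod order_trans by blast
  then show "(ell2_norm X (\<lambda>x. f x + g x))\<^sup>2 \<le> (ell2_norm X f + ell2_norm X g)\<^sup>2"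
    by (simp add: ell2_norm_add_square[OF assms] power2_sum)
qed simp

lemma ell2_norm_eq_0D:
  assumes "f \<in> ell2 X" "ell2_norm X f = 0"
  shows "f x = 0"
proof (cases "x \<in> X")
  case True
  then show ?thesis
    using ell2_Cauchy_Schwarz[of "delta x" X f] assms by simp
next
  case False
  then show ?thesis using assms by (simp add: ell2_outside)
qed

lemma ell2_bounded: "f \<in> ell2 X \<Longrightarrow> cmod (f x) \<le> ell2_norm X f"
proof (cases "x \<in> X")
  case True
  assume "f \<in> ell2 X"
  then show ?thesis using ell2_Cauchy_Schwarz[of "delta x" X f] True by simp
qed (simp add: ell2_outside)

section \<open>Linear, self-adjoint and projection operators\<close>

definition linear_operator :: "'a set \<Rightarrow> 'a operator \<Rightarrow> bool" where
  "linear_operator X T \<longleftrightarrow>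
     (\<forall>f\<in>ell2 X. T f \<in> ell2 X) \<and>
     (\<forall>f\<in>ell2 X. \<forall>g\<in>ell2 X. T (\<lambda>x. f x + g x) = (\<lambda>x. T f x + T g x)) \<and>
     (\<forall>f\<in>ell2 X. \<forall>c. T (\<lambda>x. c * f x) = (\<lambda>x. c * T f x))"

lemma selfadjoint_imp_linear: "selfadjoint_operator X T \<Longrightarrow> linear_operator X T"
  by (auto simp: selfadjoint_operator_def bounded_operator_def linear_operator_def)

lemma projector_imp_selfadjoint: "orthogonal_projector X P \<Longrightarrow> selfadjoint_operator X P"
  by (simp add: orthogonal_projector_def)

lemma selfadjoint_symmetric:
  "selfadjoint_operator X T \<Longrightarrow> f \<in> ell2 X \<Longrightarrow> g \<in> ell2 X \<Longrightarrow>
    ell2_inner X (T f) g = ell2_inner X f (T g)"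
  by (simp add: selfadjoint_operator_def)

lemma linear_operator_mem [simp]: "linear_operator X T \<Longrightarrow> f \<in> ell2 X \<Longrightarrow> T f \<in> ell2 X"
  by (simp add: linear_operator_def)

lemma linear_operator_add:
  "linear_operator X T \<Longrightarrow> f \<in> ell2 X \<Longrightarrow> g \<in> ell2 X \<Longrightarrow>
    T (\<lambda>x. f x + g x) = (\<lambda>x. T f x + T g x)"
  by (simp add: linear_operator_def)

lemma linear_operator_scale:
  "linear_operator X T \<Longrightarrow> f \<in> ell2 X \<Longrightarrow> T (\<lambda>x. c * f x) = (\<lambda>x. c * T f x)"
  by (simp add: linear_operator_def)

lemma linear_operator_zero: "linear_operator X T \<Longrightarrow> T (\<lambda>x. 0) = (\<lambda>x. 0)"
  using linear_operator_scale[of X T "\<lambda>x. 0" 0] by simp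

lemma linear_operator_diff:
  assumes "linear_operator X T" "f \<in> ell2 X" "g \<in> ell2 X"
  shows "T (\<lambda>x. f x - g x) = (\<lambda>x. T f x - T g x)"
  using linear_operator_add[of X T f "\<lambda>x. (-1) * g x"] linear_operator_scale[of X T g "-1"]
    ell2_scale[of g X "-1"] assms by simp

lemma linear_operator_sum:
  assumes "linear_operator X T" "\<And>i. i \<in> I \<Longrightarrow> f i \<in> ell2 X"
  shows "T (\<lambda>x. \<Sum>i\<in>I. f i x) = (\<lambda>x. \<Sum>i\<in>I. T (f i) x)"
  using assms(2)
proof (induction I rule: infinite_finite_induct)
  case (insert i I)
  then show ?case
    using linear_operator_add[OF assms(1), of "f i" "\<lambda>x. \<Sum>i\<in>I. f i x"] ell2_sum[of I f X] by simp
qed (simp_all add: linear_operator_zero[OF assms(1)])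

lemma linear_operator_funpow [simp]:
  "linear_operator X T \<Longrightarrow> f \<in> ell2 X \<Longrightarrow> (T ^^ n) f \<in> ell2 X"
  by (induction n) auto

lemma Im_inner_symmetric:
  assumes "f \<in> ell2 X" "ell2_inner X (T f) f = ell2_inner X f (T f)"
  shows "Im (ell2_inner X f (T f)) = 0"
proof -
  have "cnj (ell2_inner X f (T f)) = ell2_inner X f (T f)"
    using assms(2) ell2_inner_commute by metis
  then show ?thesis by (simp add: complex_eq_iff)
qed

text \<open>\<open>\<parallel>P f\<parallel>\<^sup>2 = \<langle>f, P f\<rangle>\<close>, to which Cauchy--Schwarz applies.\<close>

lemma projector_norm_le:
  assumes P: "orthogonal_projector X P" and f: "f \<in> ell2 X"
  shows "ell2_norm X (P f) \<le> ell2_norm X f"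
proof -
  have Pf: "P f \<in> ell2 X"
    using P f by (simp add: projector_imp_selfadjoint selfadjoint_imp_linear)
  have "(ell2_norm X (P f))\<^sup>2 = Re (ell2_inner X f (P (P f)))"
    using P f Pf by (simp add: Re_ell2_inner_self[symmetric]
      selfadjoint_symmetric[OF projector_imp_selfadjoint[OF P]])
  also have "\<dots> = Re (ell2_inner X f (P f))"
    using P f by (simp add: orthogonal_projector_def)
  also have "\<dots> \<le> ell2_norm X f * ell2_norm X (P f)"
    using ell2_Cauchy_Schwarz[OF f Pf] complex_Re_le_cmod order_trans by blast
  finally have "ell2_norm X (P f) * ell2_norm X (P f) \<le> ell2_norm X f * ell2_norm X (P f)"
    by (simp only: power2_eq_square)
  then show ?thesis
    using ell2_norm_nonneg[of X "P f"] ell2_norm_nonneg[of X f]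
    by (cases "ell2_norm X (P f) = 0") (auto simp: mult_le_cancel_right)
qed

lemma orthogonal_projector_restrict:
  "orthogonal_projector X (\<lambda>f x. if x \<in> S then f x else 0)"
  unfolding orthogonal_projector_def selfadjoint_operator_def bounded_operator_def
proof (intro conjI ballI allI exI)
  fix f :: "'a \<Rightarrow> complex" assume f: "f \<in> ell2 X"
  then have sf: "(\<lambda>x. (cmod (f x))\<^sup>2) summable_on X" by (simp add: ell2_def)
  have s: "(\<lambda>x. (cmod (if x \<in> S then f x else 0))\<^sup>2) summable_on X"
    by (rule summable_on_comparison_test[OF sf]) auto
  then show "(\<lambda>x. if x \<in> S then f x else 0) \<in> ell2 X"
    using f by (auto simp: ell2_def)
  show "ell2_norm X (\<lambda>x. if x \<in> S then f x else 0) \<le> 1 * ell2_norm X f"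
    unfolding ell2_norm_def mult_1 by (intro real_sqrt_le_mono infsum_mono s sf) auto
  show "ell2_inner X (\<lambda>x. if x \<in> S then f x else 0) g = ell2_inner X f (\<lambda>x. if x \<in> S then g x else 0)" for g
    unfolding ell2_inner_def by (intro infsum_cong) auto
qed (auto simp: fun_eq_iff)

text \<open>The shape of the operator \<open>N\<close> of the introduction: the lamp operator \<open>A\<close> cut down to the range of
  \<open>1 - P\<close>, plus the base operator \<open>B\<close>. Commutation of \<open>A\<close> and \<open>P\<close> makes the cut symmetric.\<close>

lemma selfadjoint_compressed_sum:
  assumes A: "selfadjoint_operator X A" and B: "selfadjoint_operator X B"
    and P: "orthogonal_projector X P"
    and comm: "\<And>f. f \<in> ell2 X \<Longrightarrow> A (P f) = P (A f)"
  shows "selfadjoint_operator X (\<lambda>f x. A f x - P (A f) x + B f x)"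
  unfolding selfadjoint_operator_def bounded_operator_def
proof (intro conjI ballI allI)
  note P' = projector_imp_selfadjoint[OF P]
  note lin = selfadjoint_imp_linear[OF A] selfadjoint_imp_linear[OF B] selfadjoint_imp_linear[OF P']
  note mem = linear_operator_mem[OF lin(1)] linear_operator_mem[OF lin(2)] linear_operator_mem[OF lin(3)]
  fix f assume f: "f \<in> ell2 X"
  show "(\<lambda>x. A f x - P (A f) x + B f x) \<in> ell2 X"
    using f by (simp add: mem)
  show "(\<lambda>x. A (\<lambda>x. c * f x) x - P (A (\<lambda>x. c * f x)) x + B (\<lambda>x. c * f x) x)
      = (\<lambda>x. c * (A f x - P (A f) x + B f x))" for c
    using f by (simp add: linear_operator_scale[OF lin(1)] linear_operator_scale[OF lin(2)]
      linear_operator_scale[OF lin(3)] mem algebra_simps)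
  fix g assume g: "g \<in> ell2 X"
  show "(\<lambda>x. A (\<lambda>x. f x + g x) x - P (A (\<lambda>x. f x + g x)) x + B (\<lambda>x. f x + g x) x)
      = (\<lambda>x. A f x - P (A f) x + B f x + (A g x - P (A g) x + B g x))"
    using f g by (simp add: linear_operator_add[OF lin(1)] linear_operator_add[OF lin(2)]
      linear_operator_add[OF lin(3)] mem algebra_simps)
  have "ell2_inner X (P (A f)) g = ell2_inner X f (P (A g))"
    using f g by (simp add: selfadjoint_symmetric[OF P'] selfadjoint_symmetric[OF A] mem comm)
  then show "ell2_inner X (\<lambda>x. A f x - P (A f) x + B f x) g
      = ell2_inner X f (\<lambda>x. A g x - P (A g) x + B g x)"
    using f g by (simp add: ell2_inner_simps mem selfadjoint_symmetric[OF A] selfadjoint_symmetric[OF B])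
next
  note P' = projector_imp_selfadjoint[OF P]
  note lin = selfadjoint_imp_linear[OF A] selfadjoint_imp_linear[OF B] selfadjoint_imp_linear[OF P']
  note mem = linear_operator_mem[OF lin(1)] linear_operator_mem[OF lin(2)] linear_operator_mem[OF lin(3)]
  obtain a where a: "\<And>f. f \<in> ell2 X \<Longrightarrow> ell2_norm X (A f) \<le> a * ell2_norm X f"
    using A unfolding selfadjoint_operator_def bounded_operator_def by blast
  obtain b where b: "\<And>f. f \<in> ell2 X \<Longrightarrow> ell2_norm X (B f) \<le> b * ell2_norm X f"
    using B unfolding selfadjoint_operator_def bounded_operator_def by blast
  have "ell2_norm X (\<lambda>x. A f x - P (A f) x + B f x) \<le> (a + a + b) * ell2_norm X f"
    if f: "f \<in> ell2 X" for f
  proof -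
    have "ell2_norm X (\<lambda>x. (A f x + - P (A f) x) + B f x)
        \<le> ell2_norm X (\<lambda>x. A f x + - P (A f) x) + ell2_norm X (B f)"
      using f by (intro ell2_triangle) (simp_all add: mem)
    also have "ell2_norm X (\<lambda>x. A f x + - P (A f) x) \<le> ell2_norm X (A f) + ell2_norm X (\<lambda>x. - P (A f) x)"
      using f by (intro ell2_triangle) (simp_all add: mem)
    also have "\<dots> \<le> ell2_norm X (A f) + ell2_norm X (A f)"
      using projector_norm_le[OF P mem(1)[OF f]] by (simp add: ell2_norm_uminus)
    finally show ?thesis
      using a[OF f] b[OF f] by (simp add: algebra_simps)
  qed
  then show "\<exists>K. \<forall>f\<in>ell2 X. ell2_norm X (\<lambda>x. A f x - P (A f) x + B f x) \<le> K * ell2_norm X f"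
    by blast
qed

section \<open>Resolvents of dissipative operators by polynomial iteration\<close>

definition poly_operator :: "'a operator \<Rightarrow> complex poly \<Rightarrow> 'a operator" where
  "poly_operator T p f = (\<lambda>x. \<Sum>j\<le>degree p. coeff p j * (T ^^ j) f x)"

lemma poly_operator_altdef:
  assumes "degree p \<le> n"
  shows "poly_operator T p f = (\<lambda>x. \<Sum>j\<le>n. coeff p j * (T ^^ j) f x)"
  unfolding poly_operator_def
  by (intro ext sum.mono_neutral_left) (use assms in \<open>auto simp: coeff_eq_0\<close>)

lemma poly_operator_mem [simp]:
  "linear_operator X T \<Longrightarrow> f \<in> ell2 X \<Longrightarrow> poly_operator T p f \<in> ell2 X"
  unfolding poly_operator_def by (intro ell2_sum) simp

lemma poly_operator_add:
  "poly_operator T (p + q) f = (\<lambda>x. poly_operator T p f x + poly_operator T q f x)"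
proof -
  define n where "n = max (degree p) (degree q)"
  have "degree (p + q) \<le> n" "degree p \<le> n" "degree q \<le> n"
    by (auto simp: n_def degree_add_le)
  then show ?thesis
    by (simp add: poly_operator_altdef[where n = n] sum.distrib distrib_right)
qed

lemma poly_operator_smult: "poly_operator T (smult c p) f = (\<lambda>x. c * poly_operator T p f x)"
  using poly_operator_altdef[of "smult c p" "degree p" T f]
  by (simp add: degree_smult_le poly_operator_def sum_distrib_left mult.assoc)

lemma poly_operator_diff:
  "poly_operator T (p - q) f = (\<lambda>x. poly_operator T p f x - poly_operator T q f x)"
  using poly_operator_add[of T p "smult (-1) q" f]
  by (simp only: poly_operator_smult) simp

lemma poly_operator_1: "poly_operator T 1 f = f"
  by (simp add: poly_operator_def)

lemma poly_operator_shift: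
  assumes "linear_operator X T" "f \<in> ell2 X"
  shows "poly_operator T (pCons 0 p) f = T (poly_operator T p f)"
proof -
  have "poly_operator T (pCons 0 p) f
      = (\<lambda>x. \<Sum>j\<le>Suc (degree p). coeff (pCons 0 p) j * (T ^^ j) f x)"
    by (rule poly_operator_altdef) (rule degree_pCons_le)
  also have "\<dots> = (\<lambda>x. \<Sum>j\<le>degree p. coeff p j * T ((T ^^ j) f) x)"
    by (simp only: sum.atMost_Suc_shift coeff_pCons_0 coeff_pCons_Suc mult_zero_left add_0_left
      funpow.simps comp_def)
  also have "\<dots> = T (poly_operator T p f)"
    unfolding poly_operator_def using assms
    by (simp add: linear_operator_sum[OF assms(1), where f = "\<lambda>j x. coeff p j * (T ^^ j) f x"]
      linear_operator_scale)
  finally show ?thesis .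
qed

lemma poly_operator_linear_factor:
  assumes "linear_operator X T" "f \<in> ell2 X"
  shows "poly_operator T ([:- z, 1:] * p) f
    = (\<lambda>x. T (poly_operator T p f) x - z * poly_operator T p f x)"
proof -
  have "[:- z, 1:] * p = pCons 0 p - smult z p" by simp
  then show ?thesis
    by (simp only: poly_operator_diff poly_operator_smult poly_operator_shift[OF assms])
qed

lemma inner_poly_operator:
  assumes "linear_operator X T" "f \<in> ell2 X" "d \<in> ell2 X"
  shows "ell2_inner X d (poly_operator T p f)
    = (\<Sum>j\<le>degree p. coeff p j * ell2_inner X d ((T ^^ j) f))"
  unfolding poly_operator_def using assms
  by (subst ell2_inner_sum_right) (auto simp: ell2_inner_scale_right)

text \<open>As polynomials in \<open>T\<close>, the iterates of \<open>u \<leftarrow> u + c (d - (T - z) u)\<close> for the equation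
  \<open>(T - z) u = d\<close>, started at \<open>0\<close>. One step multiplies the residual \<open>d - (T - z) u\<close> by
  \<open>1 - c (T - z)\<close>.\<close>

primrec richardson :: "complex \<Rightarrow> complex \<Rightarrow> nat \<Rightarrow> complex poly" where
  "richardson c z 0 = 0"
| "richardson c z (Suc k) = richardson c z k + smult c (1 - [:- z, 1:] * richardson c z k)"

lemma richardson_residual_Suc:
  "1 - [:- z, 1:] * richardson c z (Suc k) =
    (1 - [:- z, 1:] * richardson c z k) - smult c ([:- z, 1:] * (1 - [:- z, 1:] * richardson c z k))"
  by (simp only: richardson.simps distrib_left mult_smult_right diff_diff_eq)

lemma poly_richardson_residual: "1 - (x - z) * poly (richardson c z k) x = (1 - c * (x - z)) ^ k"
proof (induction k)
  case (Suc k)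
  have "1 - (x - z) * poly (richardson c z (Suc k)) x
      = (1 - (x - z) * poly (richardson c z k) x) * (1 - c * (x - z))"
    by (simp add: algebra_simps)
  with Suc show ?case by simp
qed simp

text \<open>On numbers \<open>w = x - z\<close> with \<open>Im w = - Im z\<close> and \<open>\<bar>w\<bar> \<le> B\<close>, the step \<open>c = \<i> Im z / B\<^sup>2\<close> gives
  \<open>\<bar>1 - c w\<bar>\<^sup>2 \<le> 1 - (Im z / B)\<^sup>2\<close>, so that the residual decays geometrically and
  the iterates converge to \<open>1 / w\<close> uniformly in \<open>x\<close>.\<close>

lemma poly_richardson_approx:
  assumes y: "0 < Im z" and B: "0 < B" "cmod (of_real x - z) \<le> B"
  shows "cmod (poly (richardson (\<i> * of_real (Im z / B\<^sup>2)) z k) (of_real x) - 1 / (of_real x - z))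
    \<le> sqrt (1 - (Im z / B)\<^sup>2) ^ k / Im z"
proof -
  define c where "c = \<i> * complex_of_real (Im z / B\<^sup>2)"
  define w where "w = complex_of_real x - z"
  have Imw: "Im w = - Im z" and wB: "cmod w \<le> B" using B by (auto simp: w_def)
  have wz: "Im z \<le> cmod w" using abs_Im_le_cmod[of w] Imw y by simp
  then have w0: "w \<noteq> 0" using y by auto
  have "(cmod (1 - c * w))\<^sup>2 = 1 - 2 * (Im z / B)\<^sup>2 + (Im z / B\<^sup>2)\<^sup>2 * (cmod w)\<^sup>2"
    unfolding cmod_power2 c_def using B(1) Imw
    by (simp add: power2_eq_square field_simps)
  also have "\<dots> \<le> 1 - 2 * (Im z / B)\<^sup>2 + (Im z / B\<^sup>2)\<^sup>2 * B\<^sup>2"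
    using wB by (intro add_left_mono mult_left_mono power_mono) auto
  also have "(Im z / B\<^sup>2)\<^sup>2 * B\<^sup>2 = (Im z / B)\<^sup>2"
    using B by (simp add: power2_eq_square)
  finally have "(cmod (1 - c * w))\<^sup>2 \<le> 1 - (Im z / B)\<^sup>2" by simp
  then have q: "cmod (1 - c * w) \<le> sqrt (1 - (Im z / B)\<^sup>2)"
    by (rule real_le_rsqrt)
  have "poly (richardson c z k) (of_real x) - 1 / w = - ((1 - c * w) ^ k / w)"
    using poly_richardson_residual[of "of_real x" z c k] w0 by (simp add: w_def field_simps)
  then have "cmod (poly (richardson c z k) (of_real x) - 1 / w) = cmod (1 - c * w) ^ k / cmod w"
    by (simp add: norm_divide norm_power)
  also have "\<dots> \<le> sqrt (1 - (Im z / B)\<^sup>2) ^ k / Im z"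
    using q wz y order_trans[OF norm_ge_zero q] by (intro frac_le power_mono) auto
  finally show ?thesis by (simp add: c_def w_def)
qed

text \<open>The operator counterpart of the same estimate. The cross term in
  \<open>\<parallel>r - c (T - z) r\<parallel>\<^sup>2\<close> is \<open>2 Im z / B\<^sup>2\<close> times \<open>Im \<langle>r, (T - z) r\<rangle> \<le> - Im z \<parallel>r\<parallel>\<^sup>2\<close>, which
  outweighs the quadratic term by a factor of two.\<close>

lemma richardson_contraction:
  assumes r: "r \<in> ell2 X" and Tr: "T r \<in> ell2 X" and y: "0 < Im z" and B: "0 < B"
    and diss: "Im (ell2_inner X r (T r)) \<le> 0"
    and bound: "ell2_norm X (\<lambda>x. T r x - z * r x) \<le> B * ell2_norm X r"
  shows "ell2_norm X (\<lambda>x. r x - (\<i> * of_real (Im z / B\<^sup>2)) * (T r x - z * r x))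
    \<le> sqrt (1 - (Im z / B)\<^sup>2) * ell2_norm X r"
proof -
  define c where "c = \<i> * complex_of_real (Im z / B\<^sup>2)"
  define v where "v = (\<lambda>x. T r x - z * r x)"
  define n where "n = ell2_norm X r"
  have v: "v \<in> ell2 X" using r Tr by (simp add: v_def)
  have c: "cmod c = Im z / B\<^sup>2" using y B by (simp add: c_def norm_mult norm_divide norm_power)
  have "Im (ell2_inner X r v) = Im (ell2_inner X r (T r)) - Im z * n\<^sup>2"
    using r Tr by (simp add: v_def ell2_inner_simps ell2_inner_self n_def)
  then have Imv: "Im (ell2_inner X r v) \<le> - Im z * n\<^sup>2" using diss by simp
  have "(ell2_norm X (\<lambda>x. r x + (- c) * v x))\<^sup>2
      = n\<^sup>2 + (Im z / B\<^sup>2)\<^sup>2 * (ell2_norm X v)\<^sup>2 + 2 * (Im z / B\<^sup>2) * Im (ell2_inner X r v)"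
  proof -
    have "cmod (- c) = Im z / B\<^sup>2" using c by simp
    moreover have "Re (- c * ell2_inner X r v) = Im z / B\<^sup>2 * Im (ell2_inner X r v)"
      by (simp add: c_def)
    ultimately show ?thesis
      by (simp only: ell2_norm_add_square[OF r ell2_scale[OF v]] ell2_norm_scale
        ell2_inner_scale_right power_mult_distrib n_def)
  qed
  also have "\<dots> \<le> n\<^sup>2 + (Im z / B\<^sup>2)\<^sup>2 * (B * n)\<^sup>2 + 2 * (Im z / B\<^sup>2) * (- Im z * n\<^sup>2)"
    using bound Imv y B
    by (intro add_mono mult_left_mono power_mono order_refl) (auto simp: v_def n_def)
  also have "\<dots> = (1 - (Im z / B)\<^sup>2) * n\<^sup>2"
    using B by (simp add: power2_eq_square field_simps)
  finally have "ell2_norm X (\<lambda>x. r x - c * v x) \<le> sqrt ((1 - (Im z / B)\<^sup>2) * n\<^sup>2)"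
    by (intro real_le_rsqrt) simp
  also have "\<dots> = sqrt (1 - (Im z / B)\<^sup>2) * n"
    by (simp add: real_sqrt_mult n_def)
  finally show ?thesis by (simp add: c_def v_def n_def)
qed

text \<open>The iterate \<open>u\<close> satisfies \<open>(T - z) u = d - r\<close> with a small residual \<open>r\<close>. All estimates come from
  pairing this equation with \<open>u\<close> and taking imaginary parts: \<open>Im \<langle>u, T u\<rangle> \<le> 0\<close> leaves
  \<open>Im z \<parallel>u\<parallel>\<^sup>2 \<le> Im \<langle>d, u\<rangle> + \<parallel>u\<parallel> \<parallel>r\<parallel>\<close>. The exact resolvent would satisfy them without the terms in
  \<open>q ^ k\<close>.\<close>

lemma richardson_resolvent:
  fixes T :: "'a operator"
  assumes lin: "linear_operator X T" and d: "d \<in> ell2 X" "ell2_norm X d = 1"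
    and y: "0 < Im z" and B: "Im z \<le> B"
    and diss: "\<And>r. r \<in> ell2 X \<Longrightarrow> Im (ell2_inner X r (T r)) \<le> 0"
    and bound: "\<And>r. r \<in> ell2 X \<Longrightarrow> ell2_norm X (\<lambda>x. T r x - z * r x) \<le> B * ell2_norm X r"
  defines "u \<equiv> \<lambda>k. poly_operator T (richardson (\<i> * of_real (Im z / B\<^sup>2)) z k) d"
  defines "r \<equiv> \<lambda>k x. d x - (T (u k) x - z * u k x)"
    and "q \<equiv> sqrt (1 - (Im z / B)\<^sup>2)"
  shows "u k \<in> ell2 X" and "r k \<in> ell2 X" and "ell2_norm X (r k) \<le> q ^ k"
    and "ell2_norm X (u k) \<le> 2 / Im z"
    and "Im z * (ell2_norm X (u k))\<^sup>2 \<le> cmod (ell2_inner X d (u k)) + 2 / Im z * q ^ k"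
    and "- (2 / Im z * q ^ k) \<le> Im (ell2_inner X d (u k))"
proof -
  have B0: "0 < B" using y B by simp
  have q: "0 \<le> q" "q \<le> 1"
    using y B B0 by (auto simp: q_def abs_square_le_1)
  let ?c = "\<i> * complex_of_real (Im z / B\<^sup>2)"
  let ?res = "\<lambda>k. poly_operator T (1 - [:- z, 1:] * richardson ?c z k) d"
  have r_eq: "r k = ?res k" for k
    by (simp only: poly_operator_diff poly_operator_1 poly_operator_linear_factor[OF lin d(1)]
      r_def u_def)
  show u: "u k \<in> ell2 X" for k by (simp add: u_def lin d)
  then show r: "r k \<in> ell2 X" for k
    using lin d by (simp add: r_def)
  show rq: "ell2_norm X (r k) \<le> q ^ k" for k
  proof (induction k)
    case 0
    have "r 0 = d" by (simp add: r_eq poly_operator_1)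
    then show ?case using d by simp
  next
    case (Suc k)
    have "r (Suc k) = (\<lambda>x. r k x - ?c * (T (r k) x - z * r k x))"
      unfolding r_eq richardson_residual_Suc
      by (simp only: poly_operator_diff[of T "1 - [:- z, 1:] * richardson ?c z k"]
        poly_operator_smult poly_operator_linear_factor[OF lin d(1)])
    then have "ell2_norm X (r (Suc k)) \<le> q * ell2_norm X (r k)"
      using richardson_contraction[of "r k" X T, OF r[of k] _ y B0 diss[OF r[of k]] bound[OF r[of k]]] lin r[of k]
      by (simp add: q_def)
    also have "\<dots> \<le> q * q ^ k" using Suc q by (intro mult_left_mono) auto
    finally show ?case by simp
  qed
  have Tu: "T (u k) \<in> ell2 X" using lin u by simp
  define n where "n = ell2_norm X (u k)"
  have n0: "0 \<le> n" by (simp add: n_def)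
  have d_eq: "d = (\<lambda>x. (T (u k) x - z * u k x) + r k x)" by (simp add: r_def)
  have ud: "ell2_inner X (u k) d = ell2_inner X (u k) (T (u k)) - z * of_real (n\<^sup>2) + ell2_inner X (u k) (r k)"
    using u[of k] r[of k] Tu
    by (subst d_eq) (simp add: ell2_inner_simps ell2_inner_self n_def)
  have ur: "cmod (ell2_inner X (u k) (r k)) \<le> n * q ^ k"
    using ell2_Cauchy_Schwarz[OF u r] mult_left_mono[OF rq n0] order_trans unfolding n_def by blast
  have Imur: "\<bar>Im (ell2_inner X (u k) (r k))\<bar> \<le> n * q ^ k"
    using abs_Im_le_cmod ur order_trans by blast
  have Imud: "Im (ell2_inner X (u k) d) = - Im (ell2_inner X d (u k))"
    by (subst ell2_inner_commute) simp
  have main: "Im z * n\<^sup>2 \<le> Im (ell2_inner X d (u k)) + n * q ^ k"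
    using arg_cong[OF ud, of Im] diss[OF u, of k] Imur Imud by simp
  have du: "cmod (ell2_inner X d (u k)) \<le> n"
    using ell2_Cauchy_Schwarz[OF d(1) u] d(2) by (simp add: n_def)
  have "q ^ k \<le> 1" using q by (simp add: power_le_one)
  then have "n * q ^ k \<le> n" using n0 by (simp add: mult_left_le)
  then have "Im z * n\<^sup>2 \<le> 2 * n"
    using main du abs_Im_le_cmod[of "ell2_inner X d (u k)"] by simp
  then have nz: "n \<le> 2 / Im z"
    using y n0 by (cases "n = 0") (auto simp: power2_eq_square field_simps)
  then show "ell2_norm X (u k) \<le> 2 / Im z" by (simp add: n_def)
  have nq: "n * q ^ k \<le> 2 / Im z * q ^ k"
    using nz q by (intro mult_right_mono) auto
  show "Im z * (ell2_norm X (u k))\<^sup>2 \<le> cmod (ell2_inner X d (u k)) + 2 / Im z * q ^ k"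
    using main nq abs_Im_le_cmod[of "ell2_inner X d (u k)"] by (simp add: n_def)
  have "0 \<le> Im z * n\<^sup>2" using y by simp
  then show "- (2 / Im z * q ^ k) \<le> Im (ell2_inner X d (u k))"
    using main nq by simp
qed

section \<open>Spectral averaging along a pencil\<close>

text \<open>A primitive \<open>G\<close> of \<open>Q\<close> has the same increment from \<open>-T\<close> to \<open>T\<close> along the real axis and along the lower
  semicircle \<open>\<zeta> = T e\<^sup>i\<^sup>\<theta>\<close>, \<open>\<pi> \<le> \<theta> \<le> 2\<pi>\<close>. On the semicircle \<open>Im G\<close> has
  derivative \<open>Re (\<zeta> Q(\<zeta>))\<close> in \<open>\<theta>\<close>, which is close to \<open>1\<close> when \<open>Q\<close> is close to \<open>1/\<zeta>\<close>; the mean value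
  theorem bounds its increment.\<close>

lemma lower_semicircle_bound:
  assumes T: "0 < T"
    and e: "\<And>\<zeta>. cmod \<zeta> = T \<Longrightarrow> Im \<zeta> \<le> 0 \<Longrightarrow> cmod (\<zeta> * poly Q \<zeta> - 1) \<le> e"
  shows "integral {-T..T} (\<lambda>t. Im (poly Q (complex_of_real t))) \<le> pi * (1 + e)"
proof -
  define G where "G \<zeta> = (\<Sum>i\<le>degree Q. coeff Q i / of_nat (Suc i) * \<zeta> ^ Suc i)" for \<zeta> :: complex
  have G: "(G has_field_derivative poly Q \<zeta>) (at \<zeta> within S)" for \<zeta> S
  proof -
    have "((\<lambda>\<zeta>. coeff Q i / of_nat (Suc i) * \<zeta> ^ Suc i) has_field_derivative coeff Q i * \<zeta> ^ i)
        (at \<zeta> within S)" for i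
    proof -
      have "((\<lambda>\<zeta>. coeff Q i / of_nat (Suc i) * \<zeta> ^ Suc i) has_field_derivative
          coeff Q i / of_nat (Suc i) * (of_nat (Suc i) * \<zeta> ^ i)) (at \<zeta> within S)"
        using DERIV_power[OF DERIV_ident, where n = "Suc i" and s = S] by (intro DERIV_cmult) simp
      moreover have "coeff Q i / of_nat (Suc i) * (of_nat (Suc i) * \<zeta> ^ i) = coeff Q i * \<zeta> ^ i"
        by (simp del: of_nat_Suc)
      ultimately show ?thesis by simp
    qed
    then have "((\<lambda>\<zeta>. \<Sum>i\<le>degree Q. coeff Q i / of_nat (Suc i) * \<zeta> ^ Suc i) has_field_derivative
        (\<Sum>i\<le>degree Q. coeff Q i * \<zeta> ^ i)) (at \<zeta> within S)"
      by (rule DERIV_sum)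
    then show ?thesis by (simp only: G_def[abs_def] poly_altdef)
  qed
  have line: "((\<lambda>t. Im (G (of_real t))) has_real_derivative Im (poly Q (of_real t))) (at t within S)"
    for t S
  proof -
    have "(complex_of_real has_vector_derivative of_real 1) (at t within S)"
      by (rule bounded_linear.has_vector_derivative[OF bounded_linear_of_real has_vector_derivative_id])
    from field_vector_diff_chain_within[OF this G] show ?thesis
      by (auto simp: has_real_derivative_iff_has_vector_derivative comp_def
        intro!: bounded_linear.has_vector_derivative[OF bounded_linear_Im])
  qed
  have I: "((\<lambda>t. Im (poly Q (complex_of_real t))) has_integral Im (G T) - Im (G (- T))) {-T..T}"
    using fundamental_theorem_of_calculus[of "-T" T "\<lambda>t. Im (G (of_real t))"] T line
    by (auto simp: has_real_derivative_iff_has_vector_derivative)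
  define h where "h \<theta> = Im (G (of_real T * cis \<theta>))" for \<theta>
  have arc: "(h has_real_derivative Re (T * cis \<theta> * poly Q (T * cis \<theta>))) (at \<theta>)" for \<theta>
  proof -
    have "((\<lambda>\<theta>. of_real T * cis \<theta>) has_vector_derivative of_real T * (\<i> * cis \<theta>)) (at \<theta>)"
      by (auto intro!: derivative_eq_intros simp: has_vector_derivative_complex_iff)
    from bounded_linear.has_vector_derivative[OF bounded_linear_Im field_vector_diff_chain_at[OF this G]]
    have "((\<lambda>\<theta>. Im (G (of_real T * cis \<theta>))) has_vector_derivative
        Im (of_real T * (\<i> * cis \<theta>) * poly Q (T * cis \<theta>))) (at \<theta>)"
      by (simp only: comp_def)
    moreover have "Im (of_real T * (\<i> * cis \<theta>) * poly Q (T * cis \<theta>)) = Re (T * cis \<theta> * poly Q (T * cis \<theta>))"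
      by (simp add: algebra_simps)
    ultimately show ?thesis
      by (simp add: has_real_derivative_iff_has_vector_derivative h_def[abs_def])
  qed
  obtain \<theta> where \<theta>: "pi < \<theta>" "\<theta> < 2 * pi"
    and mvt: "h (2 * pi) - h pi = (2 * pi - pi) * Re (T * cis \<theta> * poly Q (T * cis \<theta>))"
    using MVT2[of pi "2 * pi" h, OF _ arc] by auto
  have "sin \<theta> \<le> 0"
    using sin_le_zero[of \<theta>] \<theta> by simp
  then have "cmod (T * cis \<theta> * poly Q (T * cis \<theta>) - 1) \<le> e"
    using T by (intro e) (auto simp: norm_mult mult_nonneg_nonpos)
  then have "Re (T * cis \<theta> * poly Q (T * cis \<theta>)) \<le> 1 + e"
    using complex_Re_le_cmod[of "T * cis \<theta> * poly Q (T * cis \<theta>) - 1"] by simp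
  then have "h (2 * pi) - h pi \<le> pi * (1 + e)"
    using mvt by simp
  moreover have "h (2 * pi) = Im (G T)" "h pi = Im (G (- T))"
    by (simp_all add: h_def)
  ultimately show "integral {-T..T} (\<lambda>t. Im (poly Q (complex_of_real t))) \<le> pi * (1 + e)"
    using I by (simp add: integral_unique)
qed

text \<open>\<open>pencil_coeff N P d j i\<close> is the coefficient of \<open>\<zeta>\<^sup>i\<close> in \<open>(N + \<zeta> P)\<^sup>j d\<close>, that is, the sum over all
  words of length \<open>j\<close> with \<open>i\<close> letters \<open>P\<close> and \<open>j - i\<close> letters \<open>N\<close>, applied to \<open>d\<close>.\<close>

primrec pencil_coeff :: "'a operator \<Rightarrow> 'a operator \<Rightarrow> ('a \<Rightarrow> complex) \<Rightarrow> nat \<Rightarrow> nat \<Rightarrow> 'a \<Rightarrow> complex" where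
  "pencil_coeff N P d 0 = (\<lambda>i. if i = 0 then d else (\<lambda>x. 0))"
| "pencil_coeff N P d (Suc j) = (\<lambda>i x. N (pencil_coeff N P d j i) x
      + (if i = 0 then 0 else P (pencil_coeff N P d j (i - 1)) x))"

definition pencil :: "'a operator \<Rightarrow> 'a operator \<Rightarrow> complex \<Rightarrow> 'a operator" where
  "pencil N P \<zeta> f = (\<lambda>x. N f x + \<zeta> * P f x)"

lemma pencil_coeff_mem:
  "linear_operator X N \<Longrightarrow> linear_operator X P \<Longrightarrow> d \<in> ell2 X \<Longrightarrow> pencil_coeff N P d j i \<in> ell2 X"
proof (induction j arbitrary: i)
  case (Suc j)
  then show ?case by (cases i) auto
qed simp

lemma pencil_coeff_eq_0:
  "linear_operator X N \<Longrightarrow> linear_operator X P \<Longrightarrow> j < i \<Longrightarrow> pencil_coeff N P d j i = (\<lambda>x. 0)"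
  by (induction j arbitrary: i) (auto simp: linear_operator_zero)

lemma linear_pencil:
  "linear_operator X N \<Longrightarrow> linear_operator X P \<Longrightarrow> linear_operator X (pencil N P \<zeta>)"
  by (auto simp: linear_operator_def pencil_def algebra_simps)

lemma pencil_funpow:
  assumes N: "linear_operator X N" and P: "linear_operator X P" and d: "d \<in> ell2 X"
  shows "(pencil N P \<zeta> ^^ j) d = (\<lambda>x. \<Sum>i\<le>j. \<zeta> ^ i * pencil_coeff N P d j i x)"
proof (induction j)
  case (Suc j)
  let ?w = "pencil_coeff N P d j"
  have w: "?w i \<in> ell2 X" for i by (rule pencil_coeff_mem[OF N P d])
  have *: "T (\<lambda>x. \<Sum>i\<le>j. \<zeta> ^ i * ?w i x) = (\<lambda>x. \<Sum>i\<le>j. \<zeta> ^ i * T (?w i) x)"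
    if "linear_operator X T" for T
    using w that by (simp add: linear_operator_sum[OF that, where f = "\<lambda>i x. \<zeta> ^ i * ?w i x"]
      linear_operator_scale)
  have N0: "N (?w (Suc j)) = (\<lambda>x. 0)"
    using linear_operator_zero[OF N] by (simp add: pencil_coeff_eq_0[OF N P])
  have "(pencil N P \<zeta> ^^ Suc j) d = (\<lambda>x. (\<Sum>i\<le>j. \<zeta> ^ i * N (?w i) x) + \<zeta> * (\<Sum>i\<le>j. \<zeta> ^ i * P (?w i) x))"
    by (simp add: Suc pencil_def *[OF N] *[OF P])
  also have "\<dots> = (\<lambda>x. (\<Sum>i\<le>Suc j. \<zeta> ^ i * N (?w i) x) + (\<Sum>i\<le>j. \<zeta> ^ Suc i * P (?w i) x))"
    by (simp add: N0 sum_distrib_left mult.assoc)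
  also have "\<dots> = (\<lambda>x. \<Sum>i\<le>Suc j. \<zeta> ^ i * pencil_coeff N P d (Suc j) i x)"
    by (simp add: distrib_left sum.distrib sum.atMost_Suc_shift[of _ j] fun_eq_iff del: sum.atMost_Suc)
  finally show ?case .
qed simp

lemma inner_pencil_funpow:
  assumes N: "linear_operator X N" and P: "linear_operator X P" and d: "d \<in> ell2 X" "e \<in> ell2 X"
  shows "ell2_inner X e ((pencil N P \<zeta> ^^ j) d)
    = (\<Sum>i\<le>j. \<zeta> ^ i * ell2_inner X e (pencil_coeff N P d j i))"
  using d by (simp add: pencil_funpow[OF N P d(1)] pencil_coeff_mem[OF N P] ell2_inner_sum_right
    ell2_inner_scale_right)

text \<open>The function \<open>\<zeta> \<mapsto> \<langle>d, p(N + \<zeta> P) d\<rangle>\<close> as a polynomial in \<open>\<zeta>\<close>.\<close>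

definition pencil_poly :: "'a set \<Rightarrow> 'a operator \<Rightarrow> 'a operator \<Rightarrow> ('a \<Rightarrow> complex) \<Rightarrow> complex poly \<Rightarrow> complex poly"
  where "pencil_poly X N P d p = (\<Sum>j\<le>degree p. smult (coeff p j)
    (\<Sum>i\<le>j. monom (ell2_inner X d (pencil_coeff N P d j i)) i))"

lemma poly_pencil_poly_eq_sum:
  "poly (pencil_poly X N P d p) \<zeta> =
    (\<Sum>j\<le>degree p. coeff p j * (\<Sum>i\<le>j. \<zeta> ^ i * ell2_inner X d (pencil_coeff N P d j i)))"
  by (simp add: pencil_poly_def poly_sum poly_monom mult.commute)

lemma poly_pencil_poly:
  assumes N: "linear_operator X N" and P: "linear_operator X P" and d: "d \<in> ell2 X"
  shows "poly (pencil_poly X N P d p) \<zeta> = ell2_inner X d (poly_operator (pencil N P \<zeta>) p d)"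
  using inner_poly_operator[OF linear_pencil[OF N P] d d] inner_pencil_funpow[OF N P d d]
  by (simp add: poly_pencil_poly_eq_sum)

lemma pencil_dissipative:
  assumes N: "selfadjoint_operator X N" and P: "orthogonal_projector X P"
    and r: "r \<in> ell2 X" and \<zeta>: "Im \<zeta> \<le> 0"
  shows "Im (ell2_inner X r (pencil N P \<zeta> r)) \<le> 0"
proof -
  note P' = projector_imp_selfadjoint[OF P]
  have Nr: "N r \<in> ell2 X" and Pr: "P r \<in> ell2 X"
    using N P' r by (simp_all add: selfadjoint_imp_linear)
  have "ell2_inner X r (P r) = ell2_inner X (P r) (P r)"
    using P r Pr by (simp add: selfadjoint_symmetric[OF P'] orthogonal_projector_def)
  then have "Im (ell2_inner X r (pencil N P \<zeta> r)) = Im \<zeta> * (ell2_norm X (P r))\<^sup>2"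
    using r Nr Pr Im_inner_symmetric[of r X N] selfadjoint_symmetric[OF N r r]
    by (simp add: pencil_def ell2_inner_simps ell2_inner_self)
  then show ?thesis using \<zeta> by (simp add: mult_nonpos_nonneg)
qed

lemma pencil_bound:
  assumes N: "selfadjoint_operator X N" and P: "orthogonal_projector X P"
    and K: "\<And>f. f \<in> ell2 X \<Longrightarrow> ell2_norm X (N f) \<le> K * ell2_norm X f"
    and r: "r \<in> ell2 X" and \<zeta>: "cmod \<zeta> \<le> T"
  shows "ell2_norm X (\<lambda>x. pencil N P \<zeta> r x - z * r x) \<le> (K + T + cmod z) * ell2_norm X r"
proof -
  note P' = projector_imp_selfadjoint[OF P]
  have Nr: "N r \<in> ell2 X" and Pr: "P r \<in> ell2 X"
    using N P' r by (simp_all add: selfadjoint_imp_linear)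
  have "ell2_norm X (\<lambda>x. pencil N P \<zeta> r x - z * r x)
      = ell2_norm X (\<lambda>x. (N r x + \<zeta> * P r x) + (- z) * r x)"
    by (simp add: pencil_def)
  also have "\<dots> \<le> ell2_norm X (\<lambda>x. N r x + \<zeta> * P r x) + ell2_norm X (\<lambda>x. (- z) * r x)"
    by (rule ell2_triangle) (use Nr Pr r ell2_scale[of r X "- z"] in simp_all)
  also have "\<dots> \<le> (ell2_norm X (N r) + ell2_norm X (\<lambda>x. \<zeta> * P r x)) + ell2_norm X (\<lambda>x. (- z) * r x)"
    by (intro add_right_mono ell2_triangle) (use Nr Pr in simp_all)
  also have "\<dots> = ell2_norm X (N r) + cmod \<zeta> * ell2_norm X (P r) + cmod z * ell2_norm X r"
    by (simp only: ell2_norm_scale norm_minus_cancel)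
  also have "\<dots> \<le> K * ell2_norm X r + T * ell2_norm X r + cmod z * ell2_norm X r"
    using projector_norm_le[OF P r] \<zeta>
    by (intro add_mono K[OF r] mult_mono order_refl) (auto intro: order_trans[OF norm_ge_zero])
  finally show ?thesis by (simp add: algebra_simps)
qed

text \<open>Here \<open>Q k\<close> is the approximation to \<open>F(\<zeta>) = \<langle>d, (N + \<zeta> P - z)\<inverse> d\<rangle>\<close> given by \<open>k\<close> iterations, with step
  size adapted to the disc of radius \<open>T\<close>. Its imaginary part is nearly nonnegative on the lower half of
  that disc. Pairing \<open>(N + \<zeta> P - z) u = d - r\<close> with \<open>d = P d\<close> gives
  \[ \zeta \langle d, u\rangle - 1 = z \langle d, u\rangle - \langle d, N u\rangle - \langle d, r\rangle . \]
  The right-hand side is bounded, so \<open>\<langle>d, u\<rangle>\<close> is of order \<open>1/T\<close> on the semicircle; the energy estimate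
  then makes \<open>\<parallel>u\<parallel>\<close> of order \<open>1/sqrt T\<close>, and the right-hand side becomes small.\<close>

lemma pencil_resolvent_semicircle:
  fixes N P :: "'a operator"
  assumes N: "selfadjoint_operator X N" and P: "orthogonal_projector X P"
    and d: "d \<in> ell2 X" "ell2_norm X d = 1" "P d = d"
    and K: "0 \<le> K" "\<And>f. f \<in> ell2 X \<Longrightarrow> ell2_norm X (N f) \<le> K * ell2_norm X f"
    and z: "0 < Im z" and T: "0 < T"
  defines "B \<equiv> K + T + cmod z"
  defines "Q \<equiv> \<lambda>k. pencil_poly X N P d (richardson (\<i> * of_real (Im z / B\<^sup>2)) z k)"
    and "q \<equiv> sqrt (1 - (Im z / B)\<^sup>2)"
    and "b \<equiv> 2 / Im z" and "D \<equiv> K + cmod z"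
  shows "0 \<le> q" and "q < 1"
    and "cmod \<zeta> \<le> T \<Longrightarrow> Im \<zeta> \<le> 0 \<Longrightarrow> - (b * q ^ k) \<le> Im (poly (Q k) \<zeta>)"
    and "cmod \<zeta> = T \<Longrightarrow> Im \<zeta> \<le> 0 \<Longrightarrow>
      cmod (\<zeta> * poly (Q k) \<zeta> - 1) \<le> q ^ k + D * sqrt (((2 + D * b) / T + b * q ^ k) / Im z)"
proof -
  have zB: "Im z < B"
    using abs_Im_le_cmod[of z] K(1) T by (simp add: B_def)
  have B0: "0 < B" using zB z by linarith
  have "(Im z / B)\<^sup>2 < 1" using zB z B0 by (simp add: power_less_one_iff abs_square_less_1)
  moreover have "0 < (Im z / B)\<^sup>2" using z B0 by simp
  ultimately show q: "0 \<le> q" "q < 1"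
    unfolding q_def by (simp_all add: real_sqrt_lt_1_iff)
  note lN = selfadjoint_imp_linear[OF N] and lP = selfadjoint_imp_linear[OF projector_imp_selfadjoint[OF P]]
  define p where "p = richardson (\<i> * complex_of_real (Im z / B\<^sup>2)) z k"
  have bounds:
      "poly (Q k) \<zeta> = ell2_inner X d (poly_operator (pencil N P \<zeta>) p d)"
      "poly_operator (pencil N P \<zeta>) p d \<in> ell2 X"
      "(\<lambda>x. d x - (pencil N P \<zeta> (poly_operator (pencil N P \<zeta>) p d) x
          - z * poly_operator (pencil N P \<zeta>) p d x)) \<in> ell2 X"
      "ell2_norm X (\<lambda>x. d x - (pencil N P \<zeta> (poly_operator (pencil N P \<zeta>) p d) x
          - z * poly_operator (pencil N P \<zeta>) p d x)) \<le> q ^ k"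
      "ell2_norm X (poly_operator (pencil N P \<zeta>) p d) \<le> b"
      "Im z * (ell2_norm X (poly_operator (pencil N P \<zeta>) p d))\<^sup>2 \<le> cmod (poly (Q k) \<zeta>) + b * q ^ k"
      "- (b * q ^ k) \<le> Im (poly (Q k) \<zeta>)"
    if "cmod \<zeta> \<le> T" "Im \<zeta> \<le> 0" for \<zeta>
  proof -
    show Qk: "poly (Q k) \<zeta> = ell2_inner X d (poly_operator (pencil N P \<zeta>) p d)"
      by (simp add: Q_def p_def poly_pencil_poly[OF lN lP d(1)])
    have diss: "Im (ell2_inner X r (pencil N P \<zeta> r)) \<le> 0" if "r \<in> ell2 X" for r
      by (rule pencil_dissipative[OF N P that \<open>Im \<zeta> \<le> 0\<close>])
    have bound: "ell2_norm X (\<lambda>x. pencil N P \<zeta> r x - z * r x) \<le> B * ell2_norm X r"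
      if "r \<in> ell2 X" for r
      unfolding B_def by (rule pencil_bound[OF N P K(2) that \<open>cmod \<zeta> \<le> T\<close>])
    note res = richardson_resolvent[OF linear_pencil[OF lN lP, of \<zeta>] d(1,2) z less_imp_le[OF zB]
      diss bound, of k, folded p_def q_def b_def]
    show "poly_operator (pencil N P \<zeta>) p d \<in> ell2 X" by (rule res(1))
    show "(\<lambda>x. d x - (pencil N P \<zeta> (poly_operator (pencil N P \<zeta>) p d) x
          - z * poly_operator (pencil N P \<zeta>) p d x)) \<in> ell2 X"
      by (rule res(2))
    show "ell2_norm X (\<lambda>x. d x - (pencil N P \<zeta> (poly_operator (pencil N P \<zeta>) p d) x
          - z * poly_operator (pencil N P \<zeta>) p d x)) \<le> q ^ k"
      by (rule res(3))
    show "ell2_norm X (poly_operator (pencil N P \<zeta>) p d) \<le> b" by (rule res(4))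
    show "Im z * (ell2_norm X (poly_operator (pencil N P \<zeta>) p d))\<^sup>2 \<le> cmod (poly (Q k) \<zeta>) + b * q ^ k"
      unfolding Qk by (rule res(5))
    show "- (b * q ^ k) \<le> Im (poly (Q k) \<zeta>)"
      unfolding Qk by (rule res(6))
  qed
  show "cmod \<zeta> \<le> T \<Longrightarrow> Im \<zeta> \<le> 0 \<Longrightarrow> - (b * q ^ k) \<le> Im (poly (Q k) \<zeta>)"
    by (rule bounds(7))
  assume \<zeta>: "cmod \<zeta> = T" "Im \<zeta> \<le> 0"
  define u where "u = poly_operator (pencil N P \<zeta>) p d"
  define r where "r = (\<lambda>x. d x - (pencil N P \<zeta> u x - z * u x))"
  define n where "n = ell2_norm X u"
  let ?f = "poly (Q k) \<zeta>"
  note bnd = bounds[OF order_eq_refl[OF \<zeta>(1)] \<zeta>(2), folded u_def, folded r_def]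
  have Nu: "N u \<in> ell2 X" and Pu: "P u \<in> ell2 X"
    using bnd(2) lN lP by simp_all
  have "ell2_inner X d (P u) = ?f"
    using selfadjoint_symmetric[OF projector_imp_selfadjoint[OF P] d(1) bnd(2)] d(3) bnd(1) by simp
  then have "ell2_inner X d r = 1 - (ell2_inner X d (N u) + \<zeta> * ?f - z * ?f)"
    using d Nu Pu bnd(1,2) unfolding r_def pencil_def
    by (simp add: ell2_inner_simps ell2_inner_self)
  then have eq: "\<zeta> * ?f - 1 = z * ?f - ell2_inner X d (N u) - ell2_inner X d r"
    by (simp add: algebra_simps)
  have f_le: "cmod ?f \<le> n"
    using ell2_Cauchy_Schwarz[OF d(1) bnd(2)] d(2) bnd(1) by (simp add: n_def)
  have N_le: "cmod (ell2_inner X d (N u)) \<le> K * n"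
    using ell2_Cauchy_Schwarz[OF d(1) Nu] d(2) K(2)[OF bnd(2)] by (simp add: n_def)
  have r_le: "cmod (ell2_inner X d r) \<le> q ^ k"
    using ell2_Cauchy_Schwarz[OF d(1) bnd(3)] d(2) bnd(4) by simp
  \<comment> \<open>A first use of \<open>err\<close> with the crude bound \<open>n \<le> b\<close> gives the decay of \<open>?f\<close>, which improves the bound on \<open>n\<close>.\<close>
  have "cmod (\<zeta> * ?f - 1) \<le> cmod (z * ?f) + cmod (ell2_inner X d (N u)) + cmod (ell2_inner X d r)"
    unfolding eq by (meson norm_triangle_ineq4 order_trans add_right_mono)
  also have "\<dots> \<le> cmod z * n + K * n + q ^ k"
    using f_le N_le r_le by (simp add: norm_mult add_mono mult_left_mono)
  finally have err: "cmod (\<zeta> * ?f - 1) \<le> q ^ k + D * n"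
    by (simp add: D_def algebra_simps)
  have D0: "0 \<le> D" using K by (simp add: D_def)
  have "q ^ k \<le> 1" using q by (simp add: power_le_one)
  moreover have "D * n \<le> D * b" using bnd(5) D0 by (intro mult_left_mono) (simp_all add: n_def)
  ultimately have "cmod (\<zeta> * ?f - 1) \<le> 1 + D * b" using err by linarith
  then have "cmod (\<zeta> * ?f) \<le> 2 + D * b"
    using norm_triangle_ineq2[of "\<zeta> * ?f" 1] by simp
  then have "cmod ?f \<le> (2 + D * b) / T"
    using T \<zeta>(1) by (simp add: norm_mult field_simps)
  then have "Im z * n\<^sup>2 \<le> (2 + D * b) / T + b * q ^ k"
    using bnd(6) by (simp add: n_def)
  then have "n\<^sup>2 \<le> ((2 + D * b) / T + b * q ^ k) / Im z"
    using z by (simp add: pos_le_divide_eq mult.commute)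
  then have "n \<le> sqrt (((2 + D * b) / T + b * q ^ k) / Im z)"
    by (rule real_le_rsqrt)
  then show "cmod (\<zeta> * ?f - 1) \<le> q ^ k + D * sqrt (((2 + D * b) / T + b * q ^ k) / Im z)"
    using err D0 by (meson add_left_mono mult_left_mono order_trans)
qed

text \<open>The Poisson kernel is \<open>Im (1 / (x - z))\<close> for \<open>z = s + \<i> y\<close>, hence the limit of \<open>Im p\<^sub>k(x)\<close> for the
  Richardson polynomials \<open>p\<^sub>k\<close>. The moment hypothesis turns the integral of \<open>Im p\<^sub>k\<close> over \<open>\<mu>\<close> into the
  integral of \<open>\<rho>(t) Im \<langle>d, p\<^sub>k(N + t P) d\<rangle>\<close>. Since the second factor is nearly nonnegative, \<open>\<rho>\<close> may be
  replaced by \<open>C\<close> and \<open>[-R, R]\<close> by \<open>[-T, T]\<close>, where the semicircle bound applies. First \<open>k\<close> and then \<open>T\<close>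
  tends to infinity.\<close>

lemma averaged_Poisson_bound:
  fixes N P :: "'a operator" and \<mu> :: "real measure" and \<rho> :: "real \<Rightarrow> real"
  assumes N: "selfadjoint_operator X N" and P: "orthogonal_projector X P"
    and d: "d \<in> ell2 X" "ell2_norm X d = 1" "P d = d"
    and \<mu>: "finite_measure \<mu>" "sets \<mu> = sets borel" "AE x in \<mu>. x \<in> {-r..r}"
    and \<rho>: "\<rho> \<in> borel_measurable borel" "\<And>t. 0 \<le> \<rho> t" "\<And>t. \<rho> t \<le> C"
    and moments: "\<And>n. complex_of_real (\<integral>x. x ^ n \<partial>\<mu>) =
      (\<Sum>i\<le>n. of_real (\<integral>t. indicator {-R..R} t * \<rho> t * t ^ i \<partial>lborel)
         * ell2_inner X d (pencil_coeff N P d n i))"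
    and y: "0 < y"
  shows "(\<integral>\<^sup>+x. ennreal (y / ((x - s)\<^sup>2 + y\<^sup>2)) \<partial>\<mu>) \<le> ennreal (pi * C)"
proof -
  interpret finite_measure \<mu> by fact
  note [measurable_cong] = \<mu>(2)
  have [measurable]: "\<rho> \<in> borel_measurable borel" by fact
  have C0: "0 \<le> C" using \<rho>(2,3) order_trans by blast
  have "\<exists>K\<^sub>0. \<forall>f\<in>ell2 X. ell2_norm X (N f) \<le> K\<^sub>0 * ell2_norm X f"
    using N by (simp add: selfadjoint_operator_def bounded_operator_def)
  then obtain K\<^sub>0 where K\<^sub>0: "\<And>f. f \<in> ell2 X \<Longrightarrow> ell2_norm X (N f) \<le> K\<^sub>0 * ell2_norm X f"
    by blast
  define K where "K = max K\<^sub>0 0"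
  have K0: "0 \<le> K" by (simp add: K_def)
  have K: "ell2_norm X (N f) \<le> K * ell2_norm X f" if "f \<in> ell2 X" for f
    using K\<^sub>0[OF that] mult_right_mono[of K\<^sub>0 K "ell2_norm X f"] by (simp add: K_def)
  define z where "z = Complex s y"
  have z: "0 < Im z" "Im z = y" "Re z = s" using y by (auto simp: z_def)
  define pois where "pois x = y / ((x - s)\<^sup>2 + y\<^sup>2)" for x
  have pois_eq: "pois x = Im (1 / (of_real x - z))" for x
    by (simp add: pois_def z Im_divide power2_commute)
  have den: "y\<^sup>2 \<le> (x - s)\<^sup>2 + y\<^sup>2" "0 < (x - s)\<^sup>2 + y\<^sup>2" for x
    using y by (auto intro: add_nonneg_pos)
  have pois0: "0 \<le> pois x" and pois1: "pois x \<le> y / y\<^sup>2" for x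
    using den y by (auto simp: pois_def intro!: divide_left_mono)
  have ipois: "integrable \<mu> pois"
  proof (rule integrable_const_bound[where B = "y / y\<^sup>2"])
    show "pois \<in> borel_measurable \<mu>" unfolding pois_def by measurable
  qed (simp add: pois0 pois1)
  have ipow: "integrable \<mu> (\<lambda>x. x ^ n)" for n
  proof (rule integrable_const_bound[where B = "\<bar>r\<bar> ^ n"])
    show "AE x in \<mu>. norm (x ^ n) \<le> \<bar>r\<bar> ^ n"
      using \<mu>(3) by eventually_elim (auto simp: power_abs intro!: power_mono)
  qed simp
  define w where "w t = indicator {-R..R} t * \<rho> t" for t :: real
  have [measurable]: "w \<in> borel_measurable borel" unfolding w_def by measurable
  have w0: "0 \<le> w t" and wC: "w t \<le> C" for t
    using \<rho> C0 by (auto simp: w_def split: split_indicator)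
  have iw: "integrable lborel (\<lambda>t. w t * t ^ i)" for i
  proof (rule Bochner_Integration.integrable_bound)
    show "integrable lborel (\<lambda>t. indicator {-R..R} t * (C * \<bar>R\<bar> ^ i))"
      by (intro integrable_mult_left integrable_real_indicator) (auto simp: emeasure_lborel_Icc_eq)
    have "\<bar>w t * t ^ i\<bar> \<le> indicator {-R..R} t * (C * \<bar>R\<bar> ^ i)" for t
    proof (cases "t \<in> {-R..R}")
      case True
      then have "\<bar>t\<bar> ^ i \<le> \<bar>R\<bar> ^ i" by (intro power_mono) auto
      then show ?thesis
        using True w0[of t] wC[of t] by (auto simp: abs_mult power_abs intro!: mult_mono)
    qed (simp add: w_def)
    then show "AE t in lborel. norm (w t * t ^ i) \<le> norm (indicator {-R..R} t * (C * \<bar>R\<bar> ^ i))"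
      using C0 by (auto intro!: AE_I2 simp: abs_mult)
  qed simp
  have transfer: "(\<integral>x. Im (poly p (of_real x)) \<partial>\<mu>)
      = (\<integral>t. w t * Im (poly (pencil_poly X N P d p) (of_real t)) \<partial>lborel)"
    and ipoly: "integrable \<mu> (\<lambda>x. Im (poly p (of_real x)))"
    and ipencil: "integrable lborel (\<lambda>t. w t * Im (poly (pencil_poly X N P d p) (of_real t)))" for p
  proof -
    have 1: "poly p (complex_of_real x) = (\<Sum>j\<le>degree p. coeff p j * complex_of_real (x ^ j))" for x
      by (simp add: poly_altdef)
    have i1: "integrable \<mu> (\<lambda>x. coeff p j * complex_of_real (x ^ j))" for j
      using ipow by (intro integrable_mult_right) (rule integrable_of_real)
    have I1: "integrable \<mu> (\<lambda>x. poly p (complex_of_real x))"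
      unfolding 1 by (intro Bochner_Integration.integrable_sum i1)
    have E1: "(\<integral>x. poly p (complex_of_real x) \<partial>\<mu>)
        = (\<Sum>j\<le>degree p. coeff p j * complex_of_real (\<integral>x. x ^ j \<partial>\<mu>))"
      unfolding 1 by (subst Bochner_Integration.integral_sum)
        (auto intro: i1 simp: integral_complex_of_real simp del: of_real_power)
    let ?b = "\<lambda>j i. ell2_inner X d (pencil_coeff N P d j i)"
    have 2: "complex_of_real (w t) * poly (pencil_poly X N P d p) (of_real t)
        = (\<Sum>j\<le>degree p. \<Sum>i\<le>j. (coeff p j * ?b j i) * complex_of_real (w t * t ^ i))" for t
      unfolding poly_pencil_poly_eq_sum by (simp add: sum_distrib_left mult_ac)
    have i2: "integrable lborel (\<lambda>t. (coeff p j * ?b j i) * complex_of_real (w t * t ^ i))" for i j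
      using iw by (intro integrable_mult_right) (rule integrable_of_real)
    have I2: "integrable lborel (\<lambda>t. complex_of_real (w t) * poly (pencil_poly X N P d p) (of_real t))"
      unfolding 2 by (intro Bochner_Integration.integrable_sum i2)
    have "(\<integral>t. complex_of_real (w t) * poly (pencil_poly X N P d p) (of_real t) \<partial>lborel)
        = (\<Sum>j\<le>degree p. \<Sum>i\<le>j. (coeff p j * ?b j i) * complex_of_real (\<integral>t. w t * t ^ i \<partial>lborel))"
      unfolding 2
      by (simp add: Bochner_Integration.integral_sum i2 Bochner_Integration.integrable_sum
        integral_complex_of_real del: of_real_power of_real_mult)
    also have "\<dots> = (\<Sum>j\<le>degree p. coeff p j * complex_of_real (\<integral>x. x ^ j \<partial>\<mu>))"
      unfolding moments by (simp add: w_def sum_distrib_left mult_ac)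
    finally have "(\<integral>x. poly p (complex_of_real x) \<partial>\<mu>)
        = (\<integral>t. complex_of_real (w t) * poly (pencil_poly X N P d p) (of_real t) \<partial>lborel)"
      by (simp only: E1)
    then have "Im (\<integral>x. poly p (complex_of_real x) \<partial>\<mu>)
        = Im (\<integral>t. complex_of_real (w t) * poly (pencil_poly X N P d p) (of_real t) \<partial>lborel)"
      by simp
    moreover have "Im (complex_of_real (w t) * poly (pencil_poly X N P d p) (of_real t))
        = w t * Im (poly (pencil_poly X N P d p) (of_real t))" for t
      by simp
    ultimately show "(\<integral>x. Im (poly p (of_real x)) \<partial>\<mu>)
        = (\<integral>t. w t * Im (poly (pencil_poly X N P d p) (of_real t)) \<partial>lborel)"
      using integral_Im[OF I1] integral_Im[OF I2] by simp
    show "integrable \<mu> (\<lambda>x. Im (poly p (of_real x)))"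
      using integrable_Im[OF I1] by simp
    show "integrable lborel (\<lambda>t. w t * Im (poly (pencil_poly X N P d p) (of_real t)))"
      using integrable_Im[OF I2] by simp
  qed
  define D b A where "D = K + cmod z" and "b = 2 / Im z" and "A = 2 + D * b"
  have b0: "0 \<le> b" using z by (simp add: b_def)
  \<comment> \<open>The limit \<open>k \<rightarrow> \<infinity>\<close> for a fixed radius: step size and rate \<open>q\<close> depend on \<open>T\<close>.\<close>
  have fixed_radius: "(\<integral>x. pois x \<partial>\<mu>) \<le> C * (pi * (1 + D * sqrt (A / T / Im z)))"
    if T: "0 < T" "r \<le> T" "R \<le> T" for T
  proof -
    define B where "B = K + T + cmod z"
    define p where "p = richardson (\<i> * complex_of_real (Im z / B\<^sup>2)) z"
    define q where "q = sqrt (1 - (Im z / B)\<^sup>2)"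
    let ?Q = "\<lambda>k. pencil_poly X N P d (p k)"
    define e where "e k = q ^ k + D * sqrt ((A / T + b * q ^ k) / Im z)" for k
    note semi = pencil_resolvent_semicircle[OF N P d K0 K z(1) T(1), folded B_def,
      folded p_def q_def b_def D_def, folded A_def, folded e_def]
    have B0: "0 < B" using K0 T z(1) abs_Im_le_cmod[of z] unfolding B_def by linarith
    have est: "(\<integral>x. pois x \<partial>\<mu>) \<le> q ^ k / Im z * measure \<mu> (space \<mu>)
        + C * (pi * (1 + e k) + 2 * T * (b * q ^ k))" for k
    proof -
      have "(\<integral>x. pois x \<partial>\<mu>) \<le> (\<integral>x. Im (poly (p k) (of_real x)) + q ^ k / Im z \<partial>\<mu>)"
      proof (rule integral_mono_AE[OF ipois])
        show "integrable \<mu> (\<lambda>x. Im (poly (p k) (of_real x)) + q ^ k / Im z)"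
          using ipoly by simp
        show "AE x in \<mu>. pois x \<le> Im (poly (p k) (of_real x)) + q ^ k / Im z"
          using \<mu>(3)
        proof eventually_elim
          case (elim x)
          have "cmod (of_real x - z) \<le> \<bar>x\<bar> + cmod z"
            using norm_triangle_ineq4[of "of_real x" z] by simp
          also have "\<dots> \<le> B" using elim T K0 by (auto simp: B_def)
          finally have "cmod (poly (p k) (of_real x) - 1 / (of_real x - z)) \<le> q ^ k / Im z"
            unfolding p_def q_def by (intro poly_richardson_approx z B0)
          then show ?case
            using abs_Im_le_cmod[of "poly (p k) (of_real x) - 1 / (of_real x - z)"]
            unfolding pois_eq minus_complex.sel by linarith
        qed
      qed
      also have "\<dots> = (\<integral>t. w t * Im (poly (?Q k) (of_real t)) \<partial>lborel) + q ^ k / Im z * measure \<mu> (space \<mu>)"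
        using ipoly[of "p k"] by (simp add: transfer)
      also have "(\<integral>t. w t * Im (poly (?Q k) (of_real t)) \<partial>lborel)
          \<le> (\<integral>t. C * (indicator {-T..T} t *\<^sub>R (Im (poly (?Q k) (of_real t)) + b * q ^ k)) \<partial>lborel)"
      proof (rule integral_mono[OF ipencil])
        have "continuous_on {-T..T} (\<lambda>t. Im (poly (?Q k) (of_real t)) + b * q ^ k)"
          by (intro continuous_intros)
        then show "integrable lborel (\<lambda>t. C * (indicator {-T..T} t *\<^sub>R (Im (poly (?Q k) (of_real t)) + b * q ^ k)))"
          using borel_integrable_atLeastAtMost' unfolding set_integrable_def by (intro integrable_mult_right)
        fix t :: real
        show "w t * Im (poly (?Q k) (of_real t))
            \<le> C * (indicator {-T..T} t *\<^sub>R (Im (poly (?Q k) (of_real t)) + b * q ^ k))"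
        proof (cases "t \<in> {-T..T}")
          case True
          then have "cmod (of_real t) \<le> T" by (auto simp: abs_le_iff)
          then have lower: "- (b * q ^ k) \<le> Im (poly (?Q k) (of_real t))"
            by (intro semi(3)) auto
          have "0 \<le> b * q ^ k" using b0 semi(1) by simp
          then have "w t * Im (poly (?Q k) (of_real t)) \<le> w t * (Im (poly (?Q k) (of_real t)) + b * q ^ k)"
            using w0 by (intro mult_left_mono) auto
          also have "\<dots> \<le> C * (Im (poly (?Q k) (of_real t)) + b * q ^ k)"
            using lower wC by (intro mult_right_mono) auto
          finally show ?thesis using True by simp
        next
          case False
          then have "t \<notin> {-R..R}" using T by auto
          then show ?thesis using False by (simp add: w_def)
        qed
      qed
      also have "\<dots> = C * integral {-T..T} (\<lambda>t. Im (poly (?Q k) (of_real t)) + b * q ^ k)"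
      proof -
        have "continuous_on {-T..T} (\<lambda>t. Im (poly (?Q k) (of_real t)) + b * q ^ k)"
          by (intro continuous_intros)
        from set_borel_integral_eq_integral(2)[OF borel_integrable_atLeastAtMost'[OF this]]
        show ?thesis by (simp add: set_lebesgue_integral_def)
      qed
      also have "integral {-T..T} (\<lambda>t. Im (poly (?Q k) (of_real t)) + b * q ^ k)
          = integral {-T..T} (\<lambda>t. Im (poly (?Q k) (of_real t))) + 2 * T * (b * q ^ k)"
        using T by (subst integral_add)
          (auto intro!: integrable_continuous_real continuous_intros)
      also have "integral {-T..T} (\<lambda>t. Im (poly (?Q k) (of_real t))) \<le> pi * (1 + e k)"
        by (rule lower_semicircle_bound[OF T(1) semi(4)])
      finally show ?thesis
        using C0 by (simp add: mult_left_mono)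
    qed
    have qk: "(\<lambda>k. q ^ k) \<longlonglongrightarrow> 0"
      using semi(1,2) by (intro LIMSEQ_power_zero) simp
    have "(\<lambda>k. q ^ k / Im z * measure \<mu> (space \<mu>) + C * (pi * (1 + e k) + 2 * T * (b * q ^ k)))
        \<longlonglongrightarrow> 0 / Im z * measure \<mu> (space \<mu>)
          + C * (pi * (1 + (0 + D * sqrt ((A / T + b * 0) / Im z))) + 2 * T * (b * 0))"
      unfolding e_def using z(1) by (intro tendsto_intros qk) auto
    then have "(\<integral>x. pois x \<partial>\<mu>) \<le> 0 / Im z * measure \<mu> (space \<mu>)
          + C * (pi * (1 + (0 + D * sqrt ((A / T + b * 0) / Im z))) + 2 * T * (b * 0))"
      by (rule LIMSEQ_le_const) (use est in auto)
    then show ?thesis by simp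
  qed
  have "((\<lambda>T. C * (pi * (1 + D * sqrt (A / T / Im z)))) \<longlongrightarrow> C * (pi * (1 + D * sqrt (0 / Im z)))) at_top"
    using z(1) by (intro tendsto_intros tendsto_divide_0[OF tendsto_const] filterlim_ident
      filterlim_at_top_imp_at_infinity) auto
  then have "(\<integral>x. pois x \<partial>\<mu>) \<le> C * (pi * (1 + D * sqrt (0 / Im z)))"
  proof (rule tendsto_lowerbound)
    show "\<forall>\<^sub>F T in at_top. (\<integral>x. pois x \<partial>\<mu>) \<le> C * (pi * (1 + D * sqrt (A / T / Im z)))"
      using eventually_ge_at_top[of "max 1 (max r R)"]
      by eventually_elim (rule fixed_radius, auto)
  qed simp
  then have "(\<integral>x. pois x \<partial>\<mu>) \<le> pi * C" by (simp add: mult.commute)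
  moreover have "(\<integral>\<^sup>+x. ennreal (pois x) \<partial>\<mu>) = ennreal (\<integral>x. pois x \<partial>\<mu>)"
    using ipois pois0 by (intro nn_integral_eq_integral) auto
  ultimately show ?thesis
    unfolding pois_def by (simp add: ennreal_leI)
qed

section \<open>Stieltjes inversion: from Poisson integrals to densities\<close>

text \<open>The kernel has the primitive \<open>arctan ((s - x) / y)\<close> in \<open>s\<close>.\<close>

lemma nn_integral_Poisson_kernel_interval:
  assumes "0 < y" "0 \<le> \<delta>"
  shows "(\<integral>\<^sup>+s. ennreal (y / ((x - s)\<^sup>2 + y\<^sup>2)) * indicator {x - \<delta>..x + \<delta>} s \<partial>lborel)
    = ennreal (2 * arctan (\<delta> / y))"
proof -
  have "((\<lambda>s. arctan ((s - x) / y)) has_real_derivative y / ((x - s)\<^sup>2 + y\<^sup>2)) (at s)" for s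
  proof -
    have "y\<^sup>2 + (s - x)\<^sup>2 > 0" using assms by (intro add_pos_nonneg) auto
    then have "1 / y / (1 + ((s - x) / y)\<^sup>2) = y / ((x - s)\<^sup>2 + y\<^sup>2)"
      using assms by (simp add: field_simps power2_eq_square)
    moreover have "((\<lambda>s. arctan ((s - x) / y)) has_real_derivative
        1 / y / (1 + ((s - x) / y)\<^sup>2)) (at s)"
      using assms by (auto intro!: derivative_eq_intros simp: divide_simps)
    ultimately show ?thesis by simp
  qed
  then have "(\<integral>\<^sup>+s. ennreal (y / ((x - s)\<^sup>2 + y\<^sup>2)) * indicator {x - \<delta>..x + \<delta>} s \<partial>lborel)
    = arctan ((x + \<delta> - x) / y) - arctan ((x - \<delta> - x) / y)"
    using assms by (intro nn_integral_FTC_Icc) auto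
  then show ?thesis by (simp add: arctan_minus)
qed

text \<open>Stieltjes inversion. Integrate the bound over \<open>s \<in> U\<close> and exchange the integrals: the inner integral
  over \<open>U\<close> tends to at least \<open>\<pi>\<close> as \<open>y \<rightarrow> 0\<close> whenever \<open>x \<in> U\<close>, because \<open>U\<close> contains an interval around
  \<open>x\<close>. Fatou's lemma bounds \<open>\<pi> \<mu>(U)\<close> by the limit.\<close>

lemma open_measure_le_if_Poisson_bounded:
  fixes \<mu> :: "real measure"
  assumes \<mu>: "finite_measure \<mu>" "sets \<mu> = sets borel" and C: "0 \<le> C"
    and P: "\<And>s y. 0 < y \<Longrightarrow> (\<integral>\<^sup>+x. ennreal (y / ((x - s)\<^sup>2 + y\<^sup>2)) \<partial>\<mu>) \<le> ennreal (pi * C)"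
    and U: "open U"
  shows "emeasure \<mu> U \<le> ennreal C * emeasure lborel U"
proof -
  interpret finite_measure \<mu> by fact
  interpret P: pair_sigma_finite \<mu> lborel ..
  note [measurable_cong] = \<mu>(2)
  have [measurable]: "U \<in> sets borel" using U by simp
  define g where "g n x = (\<integral>\<^sup>+s. ennreal ((1 / real (Suc n)) / ((x - s)\<^sup>2 + (1 / real (Suc n))\<^sup>2))
      * indicator U s \<partial>lborel)" for n :: nat and x :: real
  have [measurable]: "g n \<in> borel_measurable \<mu>" for n
    unfolding g_def by measurable
  have upper: "(\<integral>\<^sup>+x. g n x \<partial>\<mu>) \<le> ennreal (pi * C) * emeasure lborel U" for n
  proof -
    have "(\<integral>\<^sup>+x. g n x \<partial>\<mu>) = (\<integral>\<^sup>+s. (\<integral>\<^sup>+x. ennreal ((1 / real (Suc n)) / ((x - s)\<^sup>2 + (1 / real (Suc n))\<^sup>2))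
        * indicator U s \<partial>\<mu>) \<partial>lborel)"
      unfolding g_def
    proof (rule P.Fubini'[symmetric])
      have "(\<lambda>(x, s). ennreal (1 / real (Suc n) / ((x - s)\<^sup>2 + (1 / real (Suc n))\<^sup>2)) * indicator U s)
          \<in> borel_measurable (borel \<Otimes>\<^sub>M lborel)"
        by measurable
      also have "borel_measurable (borel \<Otimes>\<^sub>M lborel) = borel_measurable (\<mu> \<Otimes>\<^sub>M lborel)"
        using \<mu>(2) by (intro measurable_cong_sets sets_pair_measure_cong) auto
      finally show "(\<lambda>(x, s). ennreal (1 / real (Suc n) / ((x - s)\<^sup>2 + (1 / real (Suc n))\<^sup>2)) * indicator U s)
          \<in> borel_measurable (\<mu> \<Otimes>\<^sub>M lborel)" .
    qed
    also have "\<dots> \<le> (\<integral>\<^sup>+s. ennreal (pi * C) * indicator U s \<partial>lborel)"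
    proof (intro nn_integral_mono)
      fix s
      show "(\<integral>\<^sup>+x. ennreal ((1 / real (Suc n)) / ((x - s)\<^sup>2 + (1 / real (Suc n))\<^sup>2)) * indicator U s \<partial>\<mu>)
          \<le> ennreal (pi * C) * indicator U s"
        using P[of "1 / real (Suc n)" s] by (subst nn_integral_multc) (auto intro!: mult_right_mono)
    qed
    also have "\<dots> = ennreal (pi * C) * emeasure lborel U"
      by (simp add: nn_integral_cmult)
    finally show ?thesis .
  qed
  have lower: "ennreal pi * indicator U x \<le> liminf (\<lambda>n. g n x)" for x
  proof (cases "x \<in> U")
    case True
    then obtain \<delta> where \<delta>: "0 < \<delta>" "cball x \<delta> \<subseteq> U"
      using U open_contains_cball by blast
    have sub: "{x - \<delta>..x + \<delta>} \<subseteq> U"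
      using \<delta>(2) by (simp add: cball_eq_atLeastAtMost)
    have le: "ennreal (2 * arctan (\<delta> / (1 / real (Suc n)))) \<le> g n x" for n
      unfolding g_def
      by (subst nn_integral_Poisson_kernel_interval[symmetric, where x = x])
        (use \<delta> sub in \<open>auto intro!: nn_integral_mono mult_left_mono split: split_indicator\<close>)
    have "filterlim (\<lambda>n. \<delta> / (1 / real (Suc n))) at_top sequentially"
      using filterlim_tendsto_pos_mult_at_top[OF tendsto_const \<delta>(1)
        filterlim_compose[OF filterlim_real_sequentially filterlim_Suc]] by simp
    then have "(\<lambda>n. 2 * arctan (\<delta> / (1 / real (Suc n)))) \<longlonglongrightarrow> 2 * (pi / 2)"
      by (intro tendsto_mult tendsto_const filterlim_compose[OF tendsto_arctan_at_top])
    then have "(\<lambda>n. ennreal (2 * arctan (\<delta> / (1 / real (Suc n))))) \<longlonglongrightarrow> ennreal (2 * (pi / 2))"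
      by (rule tendsto_ennrealI)
    then have "ennreal (2 * (pi / 2)) = liminf (\<lambda>n. ennreal (2 * arctan (\<delta> / (1 / real (Suc n)))))"
      by (simp add: lim_imp_Liminf)
    also have "\<dots> \<le> liminf (\<lambda>n. g n x)"
      using le by (intro Liminf_mono) auto
    finally show ?thesis using True by simp
  qed simp
  have "ennreal pi * emeasure \<mu> U = (\<integral>\<^sup>+x. ennreal pi * indicator U x \<partial>\<mu>)"
    by (simp add: nn_integral_cmult)
  also have "\<dots> \<le> (\<integral>\<^sup>+x. liminf (\<lambda>n. g n x) \<partial>\<mu>)"
    by (intro nn_integral_mono lower)
  also have "\<dots> \<le> liminf (\<lambda>n. \<integral>\<^sup>+x. g n x \<partial>\<mu>)"
    by (intro nn_integral_liminf) measurable
  also have "\<dots> \<le> ennreal (pi * C) * emeasure lborel U"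
    using upper by (intro Liminf_le) auto
  finally have "ennreal pi * emeasure \<mu> U \<le> ennreal pi * (ennreal C * emeasure lborel U)"
    using C by (simp add: ennreal_mult mult.assoc)
  then show ?thesis
    by (subst (asm) ennreal_mult_le_mult_iff) auto
qed

text \<open>By outer regularity of Lebesgue measure.\<close>

lemma borel_measure_le_if_open_measure_le:
  fixes \<mu> :: "real measure"
  assumes sets: "sets \<mu> = sets borel" and C: "0 \<le> C"
    and le: "\<And>U. open U \<Longrightarrow> emeasure \<mu> U \<le> ennreal C * emeasure lborel U"
    and A: "A \<in> sets borel"
  shows "emeasure \<mu> A \<le> ennreal C * emeasure lborel A"
proof (cases "C = 0")
  case True
  have "emeasure \<mu> A \<le> emeasure \<mu> UNIV"
    using sets A by (intro emeasure_mono) auto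
  also have "\<dots> \<le> 0" using le[of UNIV] True by simp
  finally show ?thesis by simp
next
  case False
  with C have C: "0 < C" by simp
  show ?thesis
  proof (rule ennreal_le_epsilon)
    fix e :: real assume "0 < e"
    then have "0 < e / C" using C by simp
    from outer_regular_lborel_le[OF A this] obtain U
      where U: "open U" "A \<subseteq> U" "emeasure lborel (U - A) \<le> ennreal (e / C)" by metis
    have "emeasure \<mu> A \<le> emeasure \<mu> U"
      using U sets by (intro emeasure_mono) auto
    also have "\<dots> \<le> ennreal C * emeasure lborel U" by (rule le[OF U(1)])
    also have "emeasure lborel U = emeasure lborel A + emeasure lborel (U - A)"
      using U A by (subst plus_emeasure) (auto simp: Un_absorb1)
    also have "ennreal C * (emeasure lborel A + emeasure lborel (U - A))
        \<le> ennreal C * emeasure lborel A + ennreal C * ennreal (e / C)"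
      unfolding distrib_left by (intro add_left_mono mult_left_mono U(3)) simp
    also have "ennreal C * ennreal (e / C) = ennreal e"
      using C \<open>0 < e\<close> by (simp add: ennreal_mult[symmetric])
    finally show "emeasure \<mu> A \<le> ennreal C * emeasure lborel A + ennreal e" .
  qed
qed

text \<open>The Radon--Nikodym density exceeds \<open>C\<close> only on a null set: on a bounded piece of \<open>{f > C}\<close> the
  integral of \<open>f - C\<close> is at most zero. Truncating it at \<open>C\<close> gives a density bounded everywhere.\<close>

lemma has_density_bounded_byI:
  fixes \<mu> :: "real measure"
  assumes sets: "sets \<mu> = sets borel" and C: "0 \<le> C"
    and le: "\<And>A. A \<in> sets borel \<Longrightarrow> emeasure \<mu> A \<le> ennreal C * emeasure lborel A"
  shows "has_density_bounded_by \<mu> C"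
proof -
  have "absolutely_continuous lborel \<mu>"
    unfolding absolutely_continuous_def
  proof
    fix N :: "real set" assume N: "N \<in> null_sets lborel"
    then have "N \<in> sets borel" "emeasure lborel N = 0" by auto
    then have "emeasure \<mu> N = 0" using le[of N] by simp
    then show "N \<in> null_sets \<mu>" using N sets by (auto simp: null_sets_def)
  qed
  then obtain f :: "real \<Rightarrow> ennreal" where f [measurable]: "f \<in> borel_measurable borel"
    and \<mu>: "\<mu> = density lborel f"
    using sigma_finite_measure.Radon_Nikodym[OF sigma_finite_lborel, of \<mu>] sets by auto
  have *: "AE x in lborel. x \<in> {-real n..real n} \<longrightarrow> f x \<le> ennreal C" for n :: nat
  proof -
    define A where "A = {x. ennreal C < f x} \<inter> {-real n..real n}"
    have A [measurable]: "A \<in> sets borel" unfolding A_def by measurable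
    have fin: "emeasure lborel A < \<infinity>"
    proof (rule le_less_trans)
      show "emeasure lborel A \<le> emeasure lborel {-real n..real n}"
        by (intro emeasure_mono) (auto simp: A_def)
    qed simp
    have "(\<integral>\<^sup>+x. (f x - ennreal C) * indicator A x \<partial>lborel)
        = (\<integral>\<^sup>+x. (f x * indicator A x - ennreal C * indicator A x) \<partial>lborel)"
      by (intro nn_integral_cong) (auto split: split_indicator)
    also have "\<dots> = (\<integral>\<^sup>+x. f x * indicator A x \<partial>lborel) - (\<integral>\<^sup>+x. ennreal C * indicator A x \<partial>lborel)"
    proof (intro nn_integral_diff AE_I2)
      have "ennreal C * emeasure lborel A \<noteq> \<infinity>"
        using fin by (auto simp: ennreal_mult_eq_top_iff)
      then show "(\<integral>\<^sup>+x. ennreal C * indicator A x \<partial>lborel) \<noteq> \<infinity>"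
        by (simp add: nn_integral_cmult)
    qed (auto simp: A_def split: split_indicator)
    also have "\<dots> = emeasure \<mu> A - ennreal C * emeasure lborel A"
      by (simp add: \<mu> emeasure_density nn_integral_cmult)
    also have "\<dots> = 0"
    proof -
      have "ennreal C * emeasure lborel A < \<infinity>"
        using fin by (auto simp: ennreal_mult_less_top)
      with le[OF A] show ?thesis
        by (auto simp: diff_eq_0_iff_ennreal intro: le_less_trans)
    qed
    finally have "AE x in lborel. (f x - ennreal C) * indicator A x = 0"
      by (subst (asm) nn_integral_0_iff_AE) auto
    then show ?thesis
      by eventually_elim
        (auto simp: A_def not_less diff_eq_0_iff_ennreal split: split_indicator_asm)
  qed
  have "AE x in lborel. \<forall>n. x \<in> {-real n..real n} \<longrightarrow> f x \<le> ennreal C"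
    using * unfolding AE_all_countable by blast
  then have fC: "AE x in lborel. f x \<le> ennreal C"
  proof eventually_elim
    case (elim x)
    obtain n :: nat where "\<bar>x\<bar> \<le> real n" using real_arch_simple by blast
    with elim show ?case by (auto simp: abs_le_iff dest: spec[of _ n])
  qed
  define \<rho> where "\<rho> x = enn2real (min (f x) (ennreal C))" for x
  have \<rho>: "ennreal (\<rho> x) = min (f x) (ennreal C)" for x
    by (simp add: \<rho>_def ennreal_enn2real_if min_def top_unique)
  have "\<mu> = density lborel (\<lambda>x. ennreal (\<rho> x))"
    unfolding \<mu> by (intro density_cong) (use fC in \<open>auto simp: \<rho> min_def\<close>)
  moreover have "\<rho> \<in> borel_measurable borel" unfolding \<rho>_def by measurable
  moreover have "0 \<le> \<rho> t \<and> \<rho> t \<le> C" for t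
    using C \<rho>[of t] by (auto simp: \<rho>_def intro: enn2real_leI)
  ultimately show ?thesis unfolding has_density_bounded_by_def by blast
qed

section \<open>Moments of spectral measures\<close>

text \<open>An equality between sums of two measures, tested on measurable sets only, extends to nonnegative
  functions. It serves to handle the signed measures arising from polarization.\<close>

lemma nn_integral_cong_add_measures:
  fixes h :: "'a \<Rightarrow> ennreal"
  assumes sets: "sets N\<^sub>1 = sets M\<^sub>1" "sets M\<^sub>2 = sets M\<^sub>1" "sets N\<^sub>2 = sets M\<^sub>1"
    and eq: "\<And>B. B \<in> sets M\<^sub>1 \<Longrightarrow>
      emeasure M\<^sub>1 B + emeasure N\<^sub>1 B = emeasure M\<^sub>2 B + emeasure N\<^sub>2 B"
    and h: "h \<in> borel_measurable M\<^sub>1"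
  shows "(\<integral>\<^sup>+x. h x \<partial>M\<^sub>1) + (\<integral>\<^sup>+x. h x \<partial>N\<^sub>1) = (\<integral>\<^sup>+x. h x \<partial>M\<^sub>2) + (\<integral>\<^sup>+x. h x \<partial>N\<^sub>2)"
proof -
  have meas: "u \<in> borel_measurable N\<^sub>1" "u \<in> borel_measurable M\<^sub>2" "u \<in> borel_measurable N\<^sub>2"
    if "u \<in> borel_measurable M\<^sub>1" for u :: "'a \<Rightarrow> ennreal"
    using that by (simp_all only: measurable_cong_sets[OF sets(1) refl]
      measurable_cong_sets[OF sets(2) refl] measurable_cong_sets[OF sets(3) refl])
  have space: "space N\<^sub>1 = space M\<^sub>1" "space M\<^sub>2 = space M\<^sub>1" "space N\<^sub>2 = space M\<^sub>1"
    using sets[THEN sets_eq_imp_space_eq] by simp_all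
  show ?thesis
    using h
  proof (induct rule: borel_measurable_induct)
    case (cong f g)
    have "(\<integral>\<^sup>+x. f x \<partial>M) = (\<integral>\<^sup>+x. g x \<partial>M)" if "space M = space M\<^sub>1" for M
      using cong(3) that by (intro nn_integral_cong) simp
    with cong(4) space show ?case by simp
  next
    case (set A)
    with sets eq show ?case by simp
  next
    case (mult u c)
    note m = mult(2) meas[OF mult(2)]
    show ?case
      using mult(4) by (simp only: nn_integral_cmult[OF m(1)] nn_integral_cmult[OF m(2)]
        nn_integral_cmult[OF m(3)] nn_integral_cmult[OF m(4)] distrib_left[symmetric])
  next
    case (add u v)
    note m = add(1) meas[OF add(1)]
    note n = add(4) meas[OF add(4)]
    show ?case
      using arg_cong2[where f = "(+)", OF add(7) add(3)]
      unfolding nn_integral_add[OF n(1) m(1)] nn_integral_add[OF n(2) m(2)]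
        nn_integral_add[OF n(3) m(3)] nn_integral_add[OF n(4) m(4)]
      by (simp only: ac_simps)
  next
    case (seq U)
    have *: "(\<integral>\<^sup>+x. (SUP i. U i) x \<partial>M) + (\<integral>\<^sup>+x. (SUP i. U i) x \<partial>N)
        = (SUP i. (\<integral>\<^sup>+x. U i x \<partial>M) + (\<integral>\<^sup>+x. U i x \<partial>N))"
      if "\<And>i. U i \<in> borel_measurable M" "\<And>i. U i \<in> borel_measurable N" for M N
    proof -
      have "(\<integral>\<^sup>+x. (SUP i. U i) x \<partial>K) = (SUP i. \<integral>\<^sup>+x. U i x \<partial>K)"
        if "\<And>i. U i \<in> borel_measurable K" for K
        unfolding SUP_apply by (rule nn_integral_monotone_convergence_SUP[OF seq(4) that])
      then show ?thesis
        using that by (simp add: ennreal_SUP_add incseq_nn_integral[OF seq(4)])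
    qed
    show ?case
      using seq(3) by (simp only: *[OF seq(1) meas(1)[OF seq(1)]]
        *[OF meas(2)[OF seq(1)] meas(3)[OF seq(1)]])
  qed
qed

text \<open>Splitting \<open>k\<close> into positive and negative part turns the signed identity
  \<open>M\<^sub>1 = M\<^sub>2 + k M\<^sub>0\<close> into an equality between sums of two positive measures.\<close>

lemma integral_diff_measures:
  fixes h k :: "real \<Rightarrow> real"
  assumes "finite_measure M\<^sub>1" "finite_measure M\<^sub>2"
    and sets: "sets M\<^sub>1 = sets borel" "sets M\<^sub>2 = sets borel" "sets M\<^sub>0 = sets borel"
    and k: "integrable M\<^sub>0 k"
    and eq: "\<And>B. B \<in> sets borel \<Longrightarrow>
      measure M\<^sub>1 B = measure M\<^sub>2 B + (\<integral>t. indicator B t * k t \<partial>M\<^sub>0)"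
    and h: "h \<in> borel_measurable borel" "\<And>t. 0 \<le> h t" "\<And>t. h t \<le> H"
  shows "(\<integral>t. h t \<partial>M\<^sub>1) = (\<integral>t. h t \<partial>M\<^sub>2) + (\<integral>t. h t * k t \<partial>M\<^sub>0)"
proof -
  interpret M1: finite_measure M\<^sub>1 by fact
  interpret M2: finite_measure M\<^sub>2 by fact
  have [measurable]: "h \<in> borel_measurable borel" "k \<in> borel_measurable M\<^sub>0"
    using h(1) k by auto
  note [measurable_cong] = sets
  \<comment> \<open>\<open>M\<^sub>1 + k\<^sup>- M\<^sub>0 = M\<^sub>2 + k\<^sup>+ M\<^sub>0\<close> holds between positive measures.\<close>
  define kp kn where "kp t = max 0 (k t)" and "kn t = max 0 (- k t)" for t
  have kpn: "k t = kp t - kn t" "0 \<le> kp t" "0 \<le> kn t" for t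
    by (auto simp: kp_def kn_def)
  have [measurable]: "kp \<in> borel_measurable M\<^sub>0" "kn \<in> borel_measurable M\<^sub>0"
    unfolding kp_def kn_def by measurable
  have ikp: "integrable M\<^sub>0 kp" and ikn: "integrable M\<^sub>0 kn"
    using k unfolding kp_def kn_def by auto
  have bnd: "integrable M\<^sub>0 (\<lambda>t. g t * f t)"
    if "integrable M\<^sub>0 f" "g \<in> borel_measurable borel" "\<And>t. 0 \<le> g t" "\<And>t. g t \<le> G" for f g :: "real \<Rightarrow> real" and G
  proof (rule Bochner_Integration.integrable_bound[of _ "\<lambda>t. G * f t"])
    show "AE t in M\<^sub>0. norm (g t * f t) \<le> norm (G * f t)"
      using that(3,4) order_trans[OF that(3,4)] by (auto simp: abs_mult intro!: AE_I2 mult_right_mono)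
  qed (use that in auto)
  have int: "integrable M\<^sub>1 h" "integrable M\<^sub>2 h"
    using h by (auto intro!: M1.integrable_const_bound[of _ H] M2.integrable_const_bound[of _ H])
  have dens: "(\<integral>\<^sup>+t. ennreal (g t) \<partial>density M\<^sub>0 (\<lambda>t. ennreal (f t))) = ennreal (\<integral>t. g t * f t \<partial>M\<^sub>0)"
    if "integrable M\<^sub>0 f" "\<And>t. 0 \<le> f t" "g \<in> borel_measurable borel" "\<And>t. 0 \<le> g t" "\<And>t. g t \<le> G"
    for f g :: "real \<Rightarrow> real" and G
  proof -
    have [measurable]: "f \<in> borel_measurable M\<^sub>0" "g \<in> borel_measurable borel" using that by auto
    show ?thesis
      using that bnd[of f g G]
      by (subst nn_integral_density) (auto simp: ennreal_mult[symmetric] mult.commute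
        intro!: nn_integral_eq_integral)
  qed
  have ind: "emeasure (density M\<^sub>0 (\<lambda>t. ennreal (f t))) B = ennreal (\<integral>t. indicator B t * f t \<partial>M\<^sub>0)"
    if "integrable M\<^sub>0 f" "\<And>t. 0 \<le> f t" "B \<in> sets borel" for f :: "real \<Rightarrow> real" and B
    using that sets dens[of f "indicator B" 1] by (simp add: ennreal_indicator indicator_le_1)
  have "(\<integral>\<^sup>+t. ennreal (h t) \<partial>M\<^sub>1) + (\<integral>\<^sup>+t. ennreal (h t) \<partial>density M\<^sub>0 (\<lambda>t. ennreal (kn t)))
      = (\<integral>\<^sup>+t. ennreal (h t) \<partial>M\<^sub>2) + (\<integral>\<^sup>+t. ennreal (h t) \<partial>density M\<^sub>0 (\<lambda>t. ennreal (kp t)))"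
  proof (rule nn_integral_cong_add_measures)
    fix B assume "B \<in> sets M\<^sub>1"
    then have [measurable]: "B \<in> sets borel" using sets by simp
    have i: "integrable M\<^sub>0 (\<lambda>t. indicator B t * kp t)" "integrable M\<^sub>0 (\<lambda>t. indicator B t * kn t)"
      using ikp ikn by (auto intro!: bnd[where G = 1] simp: indicator_le_1)
    have "measure M\<^sub>1 B + (\<integral>t. indicator B t * kn t \<partial>M\<^sub>0)
        = measure M\<^sub>2 B + (\<integral>t. indicator B t * kp t \<partial>M\<^sub>0)"
      using i by (simp add: eq kpn(1) right_diff_distrib)
    moreover have "0 \<le> (\<integral>t. indicator B t * kn t \<partial>M\<^sub>0)" "0 \<le> (\<integral>t. indicator B t * kp t \<partial>M\<^sub>0)"
      using kpn by (auto intro!: integral_nonneg_AE)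
    ultimately show "emeasure M\<^sub>1 B + emeasure (density M\<^sub>0 (\<lambda>t. ennreal (kn t))) B
        = emeasure M\<^sub>2 B + emeasure (density M\<^sub>0 (\<lambda>t. ennreal (kp t))) B"
      by (simp add: ind ikp ikn kpn M1.emeasure_eq_measure M2.emeasure_eq_measure
        flip: ennreal_plus)
  qed (use sets in auto)
  then have "ennreal (\<integral>t. h t \<partial>M\<^sub>1) + ennreal (\<integral>t. h t * kn t \<partial>M\<^sub>0)
      = ennreal (\<integral>t. h t \<partial>M\<^sub>2) + ennreal (\<integral>t. h t * kp t \<partial>M\<^sub>0)"
    using h int ikp ikn kpn by (simp add: dens[of _ h H] nn_integral_eq_integral)
  then have "(\<integral>t. h t \<partial>M\<^sub>1) + (\<integral>t. h t * kn t \<partial>M\<^sub>0) = (\<integral>t. h t \<partial>M\<^sub>2) + (\<integral>t. h t * kp t \<partial>M\<^sub>0)"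
    using h(2) kpn by (simp add: integral_nonneg_AE flip: ennreal_plus)
  moreover have "(\<integral>t. h t * k t \<partial>M\<^sub>0) = (\<integral>t. h t * kp t \<partial>M\<^sub>0) - (\<integral>t. h t * kn t \<partial>M\<^sub>0)"
    unfolding kpn(1) right_diff_distrib
    using bnd[OF ikp h] bnd[OF ikn h] by simp
  ultimately show ?thesis by simp
qed

text \<open>On \<open>[-R, R]\<close> the identity function is the bounded nonnegative function \<open>t + R\<close> minus a constant.\<close>

lemma integral_identity_diff_measures:
  fixes k :: "real \<Rightarrow> real"
  assumes fin: "finite_measure M\<^sub>1" "finite_measure M\<^sub>2"
    and sets: "sets M\<^sub>1 = sets borel" "sets M\<^sub>2 = sets borel" "sets M\<^sub>0 = sets borel"
    and k: "integrable M\<^sub>0 k"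
    and eq: "\<And>B. B \<in> sets borel \<Longrightarrow>
      measure M\<^sub>1 B = measure M\<^sub>2 B + (\<integral>t. indicator B t * k t \<partial>M\<^sub>0)"
    and supp: "AE t in M\<^sub>1. t \<in> {-R..R}" "AE t in M\<^sub>2. t \<in> {-R..R}" "AE t in M\<^sub>0. t \<in> {-R..R}"
  shows "(\<integral>t. t \<partial>M\<^sub>1) = (\<integral>t. t \<partial>M\<^sub>2) + (\<integral>t. t * k t \<partial>M\<^sub>0)"
proof -
  interpret M1: finite_measure M\<^sub>1 by fact
  interpret M2: finite_measure M\<^sub>2 by fact
  note [measurable_cong] = sets
  have [measurable]: "k \<in> borel_measurable M\<^sub>0" using k by auto
  define h where "h t = indicator {-R..R} t * (t + R)" for t :: real
  have [measurable]: "h \<in> borel_measurable borel" unfolding h_def by measurable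
  have h: "0 \<le> h t" "h t \<le> 2 * \<bar>R\<bar>" for t
    by (auto simp: h_def split: split_indicator)
  have intM1: "integrable M\<^sub>1 h" and intM2: "integrable M\<^sub>2 h"
    using h by (auto intro!: M1.integrable_const_bound[of _ "2 * \<bar>R\<bar>"]
      M2.integrable_const_bound[of _ "2 * \<bar>R\<bar>"])
  have "integrable M\<^sub>0 (\<lambda>t. h t * k t)"
  proof (rule Bochner_Integration.integrable_bound[of _ "\<lambda>t. 2 * \<bar>R\<bar> * k t"])
    show "AE t in M\<^sub>0. norm (h t * k t) \<le> norm (2 * \<bar>R\<bar> * k t)"
      using h by (auto simp: abs_mult intro!: AE_I2 mult_right_mono)
  qed (use k in auto)
  note int = intM1 intM2 this
  have 1: "(\<integral>t. t \<partial>M\<^sub>1) = (\<integral>t. h t - R \<partial>M\<^sub>1)"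
    by (intro integral_cong_AE) (use supp(1) in \<open>auto simp: h_def\<close>)
  have 2: "(\<integral>t. t \<partial>M\<^sub>2) = (\<integral>t. h t - R \<partial>M\<^sub>2)"
    by (intro integral_cong_AE) (use supp(2) in \<open>auto simp: h_def\<close>)
  have 0: "(\<integral>t. t * k t \<partial>M\<^sub>0) = (\<integral>t. h t * k t - R * k t \<partial>M\<^sub>0)"
    by (intro integral_cong_AE) (use supp(3) in \<open>auto simp: h_def algebra_simps\<close>)
  have "(\<integral>t. h t \<partial>M\<^sub>1) = (\<integral>t. h t \<partial>M\<^sub>2) + (\<integral>t. h t * k t \<partial>M\<^sub>0)"
    by (rule integral_diff_measures[OF fin sets k eq _ h]) auto
  moreover have "measure M\<^sub>1 UNIV = measure M\<^sub>2 UNIV + (\<integral>t. k t \<partial>M\<^sub>0)"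
    using eq[of UNIV] by simp
  moreover have "space M\<^sub>1 = UNIV" "space M\<^sub>2 = UNIV"
    using sets by (auto dest: sets_eq_imp_space_eq)
  ultimately show ?thesis
    using int k by (simp add: 0 1 2 algebra_simps)
qed

lemma resolution_projector:
  "resolution_of_identity X E \<Longrightarrow> A \<in> sets borel \<Longrightarrow> orthogonal_projector X (E A)"
  by (simp add: resolution_of_identity_def)

lemma resolution_linear:
  "resolution_of_identity X E \<Longrightarrow> A \<in> sets borel \<Longrightarrow> linear_operator X (E A)"
  by (simp add: resolution_projector projector_imp_selfadjoint selfadjoint_imp_linear)

lemma resolution_symmetric:
  "resolution_of_identity X E \<Longrightarrow> A \<in> sets borel \<Longrightarrow> f \<in> ell2 X \<Longrightarrow> g \<in> ell2 X \<Longrightarrow>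
    ell2_inner X (E A f) g = ell2_inner X f (E A g)"
  by (simp add: resolution_projector projector_imp_selfadjoint selfadjoint_symmetric)

lemma resolution_Int:
  "resolution_of_identity X E \<Longrightarrow> A \<in> sets borel \<Longrightarrow> B \<in> sets borel \<Longrightarrow> f \<in> ell2 X \<Longrightarrow>
    E A (E B f) = E (A \<inter> B) f"
  by (simp add: resolution_of_identity_def)

lemma resolution_UNIV: "resolution_of_identity X E \<Longrightarrow> f \<in> ell2 X \<Longrightarrow> E UNIV f = f"
  by (simp add: resolution_of_identity_def)

lemma resolution_mem [simp]:
  "resolution_of_identity X E \<Longrightarrow> A \<in> sets borel \<Longrightarrow> f \<in> ell2 X \<Longrightarrow> E A f \<in> ell2 X"
  by (simp add: resolution_linear)

lemma resolution_sums:
  "resolution_of_identity X E \<Longrightarrow> range A \<subseteq> sets borel \<Longrightarrow> disjoint_family A \<Longrightarrow>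
    f \<in> ell2 X \<Longrightarrow> g \<in> ell2 X \<Longrightarrow>
    (\<lambda>n. ell2_inner X f (E (A n) g)) sums ell2_inner X f (E (\<Union>n. A n) g)"
  by (simp add: resolution_of_identity_def)

lemma resolution_empty:
  assumes E: "resolution_of_identity X E" and "f \<in> ell2 X" "g \<in> ell2 X"
  shows "ell2_inner X f (E {} g) = 0"
proof -
  have "(\<lambda>n::nat. ell2_inner X f (E {} g)) sums ell2_inner X f (E {} g)"
    using resolution_sums[OF E, of "\<lambda>_. {}" f g] assms by (simp add: disjoint_family_on_def)
  then show ?thesis using sums_summable summable_const_iff by blast
qed

lemma resolution_inner_self:
  assumes E: "resolution_of_identity X E" and A: "A \<in> sets borel" and f: "f \<in> ell2 X"
  shows "Re (ell2_inner X f (E A f)) = (ell2_norm X (E A f))\<^sup>2"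
proof -
  have "ell2_inner X (E A f) (E A f) = ell2_inner X f (E A f)"
    using assms by (simp add: resolution_symmetric resolution_Int)
  then show ?thesis by (simp add: Re_ell2_inner_self[symmetric])
qed

lemma space_spectral_measure [simp]: "space (spectral_measure X E f) = UNIV"
  by (simp add: spectral_measure_def space_measure_of_conv)

lemma sets_spectral_measure [simp]: "sets (spectral_measure X E f) = sets borel"
  by (metis sets.sigma_sets_eq sets_measure_of space_borel spectral_measure_def subset_UNIV Pow_UNIV)

lemma emeasure_spectral_measure:
  assumes E: "resolution_of_identity X E" and f: "f \<in> ell2 X" and A: "A \<in> sets borel"
  shows "emeasure (spectral_measure X E f) A = ennreal (Re (ell2_inner X f (E A f)))"
proof -
  have "countably_additive (sets (spectral_measure X E f)) (\<lambda>A. ennreal (Re (ell2_inner X f (E A f))))"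
  proof (rule countably_additiveI)
    fix A :: "nat \<Rightarrow> real set"
    assume A: "range A \<subseteq> sets (spectral_measure X E f)" "disjoint_family A"
    then have "(\<lambda>n. ell2_inner X f (E (A n) f)) sums ell2_inner X f (E (\<Union>n. A n) f)"
      using E f by (intro resolution_sums) auto
    then have s: "(\<lambda>n. Re (ell2_inner X f (E (A n) f))) sums Re (ell2_inner X f (E (\<Union>n. A n) f))"
      by (rule sums_Re)
    have pos: "0 \<le> Re (ell2_inner X f (E (A n) f))" for n
      using E f A(1) by (subst resolution_inner_self) auto
    show "(\<Sum>n. ennreal (Re (ell2_inner X f (E (A n) f)))) = ennreal (Re (ell2_inner X f (E (\<Union>n. A n) f)))"
      using suminf_ennreal2[OF pos sums_summable[OF s]] sums_unique[OF s] by simp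
  qed
  then show ?thesis
    using A E f resolution_empty[OF E f f]
    by (intro emeasure_measure_of[OF spectral_measure_def]) (auto simp: positive_def)
qed

lemma measure_spectral_measure:
  assumes E: "resolution_of_identity X E" and f: "f \<in> ell2 X" and A: "A \<in> sets borel"
  shows "measure (spectral_measure X E f) A = Re (ell2_inner X f (E A f))"
  using emeasure_spectral_measure[OF assms] resolution_inner_self[OF E A f]
  by (simp add: measure_def)

lemma finite_spectral_measure:
  assumes "resolution_of_identity X E" and "f \<in> ell2 X"
  shows "finite_measure (spectral_measure X E f)"
  by (rule finite_measureI) (simp add: emeasure_spectral_measure[OF assms])

lemma AE_spectral_measure_support:
  assumes E: "resolution_of_identity X E" and f: "f \<in> ell2 X" and R: "E {-R..R} f = f"
  shows "AE t in spectral_measure X E f. t \<in> {-R..R}"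
proof (rule AE_I')
  have "E (- {-R..R}) f = E (- {-R..R}) (E {-R..R} f)" using R by simp
  also have "\<dots> = E {} f" using resolution_Int[OF E, of "- {-R..R}" "{-R..R}" f] f by simp
  finally show "- {-R..R} \<in> null_sets (spectral_measure X E f)"
    by (simp add: null_sets_def emeasure_spectral_measure[OF E f] resolution_empty[OF E f f])
qed auto

lemma measure_spectral_polarization:
  assumes E: "resolution_of_identity X E" and a: "a \<in> ell2 X" and b: "b \<in> ell2 X"
    and B: "B \<in> sets borel"
  shows "measure (spectral_measure X E (\<lambda>x. a x + b x)) B
    = measure (spectral_measure X E (\<lambda>x. a x - b x)) B + 4 * Re (ell2_inner X a (E B b))"
proof -
  have "Re (ell2_inner X b (E B a)) = Re (ell2_inner X a (E B b))"
    using assms by (simp add: resolution_symmetric[symmetric] ell2_inner_commute[of X _ b])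
  then show ?thesis
    using assms by (simp add: measure_spectral_measure linear_operator_add[OF resolution_linear[OF E B]]
      linear_operator_diff[OF resolution_linear[OF E B]] ell2_inner_simps)
qed

lemma spectral_resolution_symmetric_polarization:
  assumes L: "spectral_resolution X L E" and lin: "linear_operator X L"
    and sym: "\<And>f g. f \<in> ell2 X \<Longrightarrow> g \<in> ell2 X \<Longrightarrow> ell2_inner X (L f) g = ell2_inner X f (L g)"
    and a: "a \<in> ell2 X" and b: "b \<in> ell2 X"
  shows "4 * Re (ell2_inner X a (L b)) = (\<integral>t. t \<partial>spectral_measure X E (\<lambda>x. a x + b x))
    - (\<integral>t. t \<partial>spectral_measure X E (\<lambda>x. a x - b x))"
proof -
  have form: "(\<integral>t. t \<partial>spectral_measure X E f) = Re (ell2_inner X f (L f))" if "f \<in> ell2 X" for f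
    using L that by (simp add: spectral_resolution_def)
  have "Re (ell2_inner X b (L a)) = Re (ell2_inner X a (L b))"
    using sym[OF a b] ell2_inner_commute[of X b "L a"] by (simp add: complex_eq_iff)
  then show ?thesis
    using a b lin
    by (simp add: form linear_operator_add linear_operator_diff ell2_inner_simps)
qed

lemma resolution_split:
  assumes E: "resolution_of_identity X E" and A: "A \<in> sets borel"
    and h: "h \<in> ell2 X" and g: "g \<in> ell2 X"
  shows "ell2_inner X h g = ell2_inner X h (E A g) + ell2_inner X h (E (- A) g)"
proof -
  define D where "D n = (if n = 0 then A else if n = 1 then - A else {})" for n :: nat
  have "(\<lambda>n. ell2_inner X h (E (D n) g)) sums ell2_inner X h (E (\<Union>n. D n) g)"
    using A by (intro resolution_sums[OF E _ _ h g]) (auto simp: disjoint_family_on_def D_def)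
  moreover have "(\<lambda>n. ell2_inner X h (E (D n) g)) sums (\<Sum>n\<in>{0, 1}. ell2_inner X h (E (D n) g))"
    by (intro sums_finite) (auto simp: resolution_empty[OF E h g] D_def)
  moreover have "(\<Union>n. D n) = UNIV"
    using UNIV_I by (auto simp: D_def)
  ultimately show ?thesis
    using sums_unique2 resolution_UNIV[OF E g] by (fastforce simp: D_def)
qed

text \<open>The quadratic form of \<open>L\<close> at a vector depends only on its spectral measure. For \<open>a\<close> in the range of
  \<open>E A\<close> and \<open>c\<close> in the range of \<open>E (- A)\<close> the vectors \<open>a + c\<close> and \<open>a - c\<close> have the same spectral measure,
  since all cross terms \<open>\<langle>a, E B c\<rangle>\<close> vanish; polarization yields \<open>Re \<langle>a, L c\<rangle> = 0\<close>.\<close>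

lemma spectral_resolution_off_diagonal:
  assumes L: "spectral_resolution X L E" and lin: "linear_operator X L"
    and sym: "\<And>f g. f \<in> ell2 X \<Longrightarrow> g \<in> ell2 X \<Longrightarrow> ell2_inner X (L f) g = ell2_inner X f (L g)"
    and f: "f \<in> ell2 X" and g: "g \<in> ell2 X" and A: "A \<in> sets borel"
  shows "Re (ell2_inner X (E A f) (L (E (- A) g))) = 0"
proof -
  have E: "resolution_of_identity X E" using L by (simp add: spectral_resolution_def)
  define a c where "a = E A f" and "c = E (- A) g"
  have a: "a \<in> ell2 X" and c: "c \<in> ell2 X"
    using E A f g by (auto simp: a_def c_def)
  interpret P: finite_measure "spectral_measure X E (\<lambda>x. a x + c x)"
    by (rule finite_spectral_measure[OF E]) (simp add: a c)
  interpret M: finite_measure "spectral_measure X E (\<lambda>x. a x - c x)"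
    by (rule finite_spectral_measure[OF E]) (simp add: a c)
  have "measure (spectral_measure X E (\<lambda>x. a x + c x)) B
      = measure (spectral_measure X E (\<lambda>x. a x - c x)) B" if B: "B \<in> sets borel" for B
  proof -
    have "ell2_inner X a (E B c) = ell2_inner X f (E A (E B (E (- A) g)))"
      using E A B f g unfolding a_def c_def by (simp add: resolution_symmetric)
    also have "\<dots> = ell2_inner X f (E (A \<inter> (B \<inter> - A)) g)"
      using E A B g by (simp add: resolution_Int)
    also have "A \<inter> (B \<inter> - A) = {}" by auto
    finally show ?thesis
      using measure_spectral_polarization[OF E a c B] resolution_empty[OF E f g] by simp
  qed
  then have "spectral_measure X E (\<lambda>x. a x + c x) = spectral_measure X E (\<lambda>x. a x - c x)"
    by (intro measure_eqI) (simp_all add: P.emeasure_eq_measure M.emeasure_eq_measure)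
  then show ?thesis
    using spectral_resolution_symmetric_polarization[OF L lin sym a c] by (simp add: a_def c_def)
qed

text \<open>The step from \<open>g\<close> to \<open>L g\<close> multiplies the density of \<open>\<langle>f, E(dt) g\<rangle>\<close> by \<open>t\<close>. Because the off-diagonal part
  vanishes, \<open>\<langle>f, E A L g\<rangle>\<close> has the real part of \<open>\<langle>a, L b\<rangle>\<close> with \<open>a = E A f\<close> and \<open>b = E A g\<close>. By polarization
  this is a quarter of the difference of the integrals of \<open>t\<close> over the spectral measures of \<open>a + b\<close> and
  \<open>a - b\<close>, and that difference of measures is \<open>4 t\<^sup>n\<close> times the spectral measure of \<open>f\<close>, restricted to \<open>A\<close>.\<close>

lemma spectral_moment_step:
  assumes L: "spectral_resolution X L E" and lin: "linear_operator X L"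
    and sym: "\<And>f g. f \<in> ell2 X \<Longrightarrow> g \<in> ell2 X \<Longrightarrow> ell2_inner X (L f) g = ell2_inner X f (L g)"
    and f: "f \<in> ell2 X" and g: "g \<in> ell2 X"
    and IH: "\<And>B. B \<in> sets borel \<Longrightarrow>
      Re (ell2_inner X f (E B g)) = (\<integral>t. indicator B t * t ^ n \<partial>spectral_measure X E f)"
    and A: "A \<in> sets borel"
  shows "Re (ell2_inner X f (E A (L g))) = (\<integral>t. indicator A t * t ^ Suc n \<partial>spectral_measure X E f)"
proof -
  from L obtain R where E: "resolution_of_identity X E"
    and R: "\<And>f. f \<in> ell2 X \<Longrightarrow> E {-R..R} f = f"
    by (auto simp: spectral_resolution_def)
  note fin = finite_spectral_measure[OF E]
  have supp: "AE t in spectral_measure X E h. t \<in> {-R..R}" if "h \<in> ell2 X" for h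
    using AE_spectral_measure_support[OF E that R[OF that]] .
  interpret F: finite_measure "spectral_measure X E f" by (rule fin[OF f])
  define a b c where "a = E A f" and "b = E A g" and "c = E (- A) g"
  have a: "a \<in> ell2 X" and b: "b \<in> ell2 X" and c: "c \<in> ell2 X"
    using E A f g by (auto simp: a_def b_def c_def)
  have La: "L a \<in> ell2 X" using lin a by simp
  have "ell2_inner X a (L g) = ell2_inner X a (L b) + ell2_inner X a (L c)"
    using resolution_split[OF E A La g] sym[OF a g] sym[OF a b] sym[OF a c]
    by (simp only: b_def c_def)
  moreover have "Re (ell2_inner X a (L c)) = 0"
    unfolding a_def c_def by (rule spectral_resolution_off_diagonal[OF L lin sym f g A])
  moreover have "4 * Re (ell2_inner X a (L b))
      = (\<integral>t. t * (4 * (indicator A t * t ^ n)) \<partial>spectral_measure X E f)"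
  proof -
    have int: "integrable (spectral_measure X E f) (\<lambda>t. 4 * (indicator A t * t ^ n))"
    proof (rule F.integrable_const_bound[where B = "4 * \<bar>R\<bar> ^ n"])
      show "AE t in spectral_measure X E f. norm (4 * (indicator A t * t ^ n)) \<le> 4 * \<bar>R\<bar> ^ n"
        using supp[OF f]
      proof eventually_elim
        case (elim t)
        then have "\<bar>t\<bar> ^ n \<le> \<bar>R\<bar> ^ n" by (intro power_mono) auto
        then show ?case by (auto simp: abs_mult power_abs split: split_indicator)
      qed
      show "(\<lambda>t. 4 * (indicator A t * t ^ n)) \<in> borel_measurable (spectral_measure X E f)"
        using A by (simp add: measurable_cong_sets[OF sets_spectral_measure refl])
    qed
    have "(\<integral>t. t \<partial>spectral_measure X E (\<lambda>x. a x + b x)) = (\<integral>t. t \<partial>spectral_measure X E (\<lambda>x. a x - b x))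
        + (\<integral>t. t * (4 * (indicator A t * t ^ n)) \<partial>spectral_measure X E f)"
    proof (rule integral_identity_diff_measures[OF fin fin _ _ _ int])
      show "AE t in spectral_measure X E (\<lambda>x. a x + b x). t \<in> {-R..R}"
        "AE t in spectral_measure X E (\<lambda>x. a x - b x). t \<in> {-R..R}"
        "AE t in spectral_measure X E f. t \<in> {-R..R}"
        by (rule supp; simp add: a b f)+
      show "(\<lambda>x. a x + b x) \<in> ell2 X" "(\<lambda>x. a x - b x) \<in> ell2 X"
        using a b by simp_all
      fix B :: "real set" assume B: "B \<in> sets borel"
      have "ell2_inner X a (E B b) = ell2_inner X f (E A (E B (E A g)))"
        unfolding a_def b_def using E A B f g by (intro resolution_symmetric) auto
      also have "\<dots> = ell2_inner X f (E (A \<inter> (B \<inter> A)) g)"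
        using resolution_Int[OF E B A g] resolution_Int[OF E A _ g, of "B \<inter> A"] A B by simp
      also have "A \<inter> (B \<inter> A) = B \<inter> A" by auto
      finally have "Re (ell2_inner X a (E B b))
          = (\<integral>t. indicator (B \<inter> A) t * t ^ n \<partial>spectral_measure X E f)"
        using IH[of "B \<inter> A"] A B by simp
      moreover have "(\<integral>t. indicator B t * (4 * (indicator A t * t ^ n)) \<partial>spectral_measure X E f)
          = 4 * (\<integral>t. indicator (B \<inter> A) t * t ^ n \<partial>spectral_measure X E f)"
        by (subst integral_mult_right_zero[symmetric], rule Bochner_Integration.integral_cong)
          (auto split: split_indicator)
      ultimately have "4 * Re (ell2_inner X a (E B b))
          = (\<integral>t. indicator B t * (4 * (indicator A t * t ^ n)) \<partial>spectral_measure X E f)"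
        by simp
      then show "measure (spectral_measure X E (\<lambda>x. a x + b x)) B
          = measure (spectral_measure X E (\<lambda>x. a x - b x)) B
            + (\<integral>t. indicator B t * (4 * (indicator A t * t ^ n)) \<partial>spectral_measure X E f)"
        using measure_spectral_polarization[OF E a b B] by linarith
    qed (rule sets_spectral_measure)+
    then show ?thesis using spectral_resolution_symmetric_polarization[OF L lin sym a b] by simp
  qed
  moreover have "ell2_inner X f (E A (L g)) = ell2_inner X a (L g)"
    unfolding a_def using E A f g lin by (intro resolution_symmetric[symmetric]) auto
  moreover have "(\<integral>t. t * (4 * (indicator A t * t ^ n)) \<partial>spectral_measure X E f)
      = 4 * (\<integral>t. indicator A t * t ^ Suc n \<partial>spectral_measure X E f)"
    by (subst integral_mult_right_zero[symmetric], rule Bochner_Integration.integral_cong)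
      (auto split: split_indicator)
  ultimately show ?thesis by (simp only: plus_complex.sel)
qed

text \<open>The definition of a spectral resolution fixes only the first moments of the spectral measures; the
  higher ones follow by multiplicativity of the projectors.\<close>

lemma spectral_moments:
  assumes L: "spectral_resolution X L E" and lin: "linear_operator X L"
    and sym: "\<And>f g. f \<in> ell2 X \<Longrightarrow> g \<in> ell2 X \<Longrightarrow> ell2_inner X (L f) g = ell2_inner X f (L g)"
    and f: "f \<in> ell2 X"
  shows "ell2_inner X f ((L ^^ n) f) = complex_of_real (\<integral>t. t ^ n \<partial>spectral_measure X E f)"
proof -
  have E: "resolution_of_identity X E" using L by (simp add: spectral_resolution_def)
  have Ln: "(L ^^ n) f \<in> ell2 X" for n using lin f by simp
  have "Re (ell2_inner X f (E A ((L ^^ n) f))) = (\<integral>t. indicator A t * t ^ n \<partial>spectral_measure X E f)"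
    if "A \<in> sets borel" for A
    using that
  proof (induction n arbitrary: A)
    case 0
    then show ?case using measure_spectral_measure[OF E f 0] by simp
  next
    case (Suc n)
    then show ?case
      using spectral_moment_step[OF L lin sym f Ln Suc.IH Suc.prems] by simp
  qed
  from this[of UNIV] have Re: "Re (ell2_inner X f ((L ^^ n) f)) = (\<integral>t. t ^ n \<partial>spectral_measure X E f)"
    using resolution_UNIV[OF E Ln] by simp
  have pow: "ell2_inner X ((L ^^ n) u) v = ell2_inner X u ((L ^^ n) v)"
    if "u \<in> ell2 X" "v \<in> ell2 X" for u v
    using that
  proof (induction n arbitrary: v)
    case (Suc n)
    have "ell2_inner X ((L ^^ Suc n) u) v = ell2_inner X ((L ^^ n) u) (L v)"
      using Suc.prems lin by (simp add: sym)
    also have "\<dots> = ell2_inner X u ((L ^^ n) (L v))"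
      using Suc lin by simp
    finally show ?case by (simp only: funpow_Suc_right comp_def)
  qed simp
  have "Im (ell2_inner X f ((L ^^ n) f)) = 0"
    by (rule Im_inner_symmetric[of f X "L ^^ n", OF f pow[OF f f]])
  with Re show ?thesis by (simp add: complex_eq_iff)
qed

section \<open>Convolution along a homomorphism\<close>

text \<open>Convolution on \<open>W\<close> with the image under \<open>\<phi>\<close> of a measure on \<open>K\<close>, written as a sum over \<open>K\<close>. For
  injective \<open>\<phi>\<close> it is convolution with the push-forward (\<open>push_forward_convolution_has_sum\<close>).\<close>

definition hom_convolution ::
    "('k, 'x) monoid_scheme \<Rightarrow> ('w, 'y) monoid_scheme \<Rightarrow> ('k \<Rightarrow> 'w) \<Rightarrow> ('k \<Rightarrow> complex) \<Rightarrow> 'w operator" where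
  "hom_convolution K W \<phi> m f = (\<lambda>y. if y \<in> carrier W
     then \<Sum>\<^sub>\<infinity>x\<in>carrier K. m x * f (inv\<^bsub>W\<^esub> (\<phi> x) \<otimes>\<^bsub>W\<^esub> y) else 0)"

lemma hom_convolution_abs_summable:
  assumes m: "finite_complex_measure K m" and f: "\<And>w. cmod (f w) \<le> b"
  shows "(\<lambda>x. norm (m x * f (\<sigma> x))) summable_on carrier K"
proof (rule Infinite_Sum.abs_summable_on_comparison_test')
  show "(\<lambda>x. cmod (m x) * b) summable_on carrier K"
    using m unfolding finite_complex_measure_def by (rule summable_on_cmult_left)
  show "norm (m x * f (\<sigma> x)) \<le> cmod (m x) * b" for x
    using f by (simp add: norm_mult mult_left_mono)
qed

lemma hom_convolution_summable:
  assumes "finite_complex_measure K m" "\<And>w. cmod (f w) \<le> b"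
  shows "(\<lambda>x. m x * f (\<sigma> x)) summable_on carrier K"
  using hom_convolution_abs_summable[OF assms] by (rule abs_summable_summable)

lemma hom_convolution_add:
  assumes m: "finite_complex_measure K m" and f: "\<And>w. cmod (f w) \<le> b" and g: "\<And>w. cmod (g w) \<le> c"
  shows "hom_convolution K W \<phi> m (\<lambda>x. f x + g x)
    = (\<lambda>x. hom_convolution K W \<phi> m f x + hom_convolution K W \<phi> m g x)"
  using hom_convolution_summable[OF m, of f b, OF f] hom_convolution_summable[OF m, of g c, OF g]
  by (simp add: hom_convolution_def distrib_left infsum_add fun_eq_iff)

lemma hom_convolution_scale:
  "hom_convolution K W \<phi> m (\<lambda>x. c * f x) = (\<lambda>x. c * hom_convolution K W \<phi> m f x)"
  by (simp add: hom_convolution_def mult.left_commute[of _ c] infsum_cmult_right' fun_eq_iff)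

context
  fixes K :: "('k, 'x) monoid_scheme" and W :: "('w, 'y) monoid_scheme"
    and \<phi> :: "'k \<Rightarrow> 'w" and m :: "'k \<Rightarrow> complex"
  assumes K: "group K" and W: "group W" and \<phi>: "\<phi> \<in> hom K W"
    and m: "finite_complex_measure K m"
begin

interpretation K: group K by (rule K)
interpretation W: group W by (rule W)
interpretation \<phi>: group_hom K W \<phi> by unfold_locales (rule \<phi>)

private abbreviation (input) translate :: "'k \<Rightarrow> ('w \<Rightarrow> complex) \<Rightarrow> 'w \<Rightarrow> complex" where
  "translate x f \<equiv> \<lambda>y. if y \<in> carrier W then f (inv\<^bsub>W\<^esub> (\<phi> x) \<otimes>\<^bsub>W\<^esub> y) else 0"

lemma translate_bij:
  "x \<in> carrier K \<Longrightarrow> bij_betw (\<lambda>y. inv\<^bsub>W\<^esub> (\<phi> x) \<otimes>\<^bsub>W\<^esub> y) (carrier W) (carrier W)"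
  by (intro bij_betw_byWitness[where f' = "\<lambda>y. \<phi> x \<otimes>\<^bsub>W\<^esub> y"])
    (auto simp: W.m_assoc[symmetric])

lemma translate_mem: "x \<in> carrier K \<Longrightarrow> f \<in> ell2 (carrier W) \<Longrightarrow> translate x f \<in> ell2 (carrier W)"
  using summable_on_reindex_bij_betw[OF translate_bij, of x "\<lambda>y. (cmod (f y))\<^sup>2"]
  by (auto simp: ell2_def cong: summable_on_cong)

lemma translate_norm: "x \<in> carrier K \<Longrightarrow> ell2_norm (carrier W) (translate x f) = ell2_norm (carrier W) f"
  using infsum_reindex_bij_betw[OF translate_bij, of x "\<lambda>y. (cmod (f y))\<^sup>2"]
  by (auto simp: ell2_norm_def cong: infsum_cong)

lemma translate_inner:
  assumes x: "x \<in> carrier K"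
  shows "ell2_inner (carrier W) g (translate x f)
    = cnj (ell2_inner (carrier W) f (translate (inv\<^bsub>K\<^esub> x) g))"
proof -
  have "ell2_inner (carrier W) f (translate (inv\<^bsub>K\<^esub> x) g)
      = (\<Sum>\<^sub>\<infinity>y\<in>carrier W. cnj (f y) * g (\<phi> x \<otimes>\<^bsub>W\<^esub> y))"
    unfolding ell2_inner_def using x by (intro infsum_cong) simp
  also have "\<dots> = (\<Sum>\<^sub>\<infinity>y\<in>carrier W. cnj (f (inv\<^bsub>W\<^esub> (\<phi> x) \<otimes>\<^bsub>W\<^esub> y)) * g (\<phi> x \<otimes>\<^bsub>W\<^esub> (inv\<^bsub>W\<^esub> (\<phi> x) \<otimes>\<^bsub>W\<^esub> y)))"
    by (rule infsum_reindex_bij_betw[OF translate_bij[OF x], symmetric])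
  also have "\<dots> = (\<Sum>\<^sub>\<infinity>y\<in>carrier W. cnj (f (inv\<^bsub>W\<^esub> (\<phi> x) \<otimes>\<^bsub>W\<^esub> y)) * g y)"
    using x by (intro infsum_cong) (simp add: W.m_assoc[symmetric])
  also have "\<dots> = ell2_inner (carrier W) (translate x f) g"
    unfolding ell2_inner_def by (intro infsum_cong) simp
  finally show ?thesis
    by (subst ell2_inner_commute) simp
qed

lemma weighted_square_summable:
  assumes f: "f \<in> ell2 (carrier W)"
  shows "(\<lambda>(x, y). cmod (m x) * (cmod (translate x f y))\<^sup>2) summable_on carrier K \<times> carrier W"
    and "(\<Sum>\<^sub>\<infinity>x\<in>carrier K. \<Sum>\<^sub>\<infinity>y\<in>carrier W. cmod (m x) * (cmod (translate x f y))\<^sup>2)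
      = (\<Sum>\<^sub>\<infinity>x\<in>carrier K. cmod (m x)) * (ell2_norm (carrier W) f)\<^sup>2"
proof -
  have s: "((\<lambda>y. cmod (m x) * (cmod (translate x f y))\<^sup>2) has_sum cmod (m x) * (ell2_norm (carrier W) f)\<^sup>2) (carrier W)"
    if "x \<in> carrier K" for x
    using translate_mem[OF that f] translate_norm[OF that, of f]
    by (intro has_sum_cmult_right) (auto simp: ell2_def ell2_norm_square[symmetric] has_sum_iff)
  have "(\<lambda>x. cmod (m x) * (ell2_norm (carrier W) f)\<^sup>2) summable_on carrier K"
    using m unfolding finite_complex_measure_def by (rule summable_on_cmult_left)
  then show "(\<lambda>(x, y). cmod (m x) * (cmod (translate x f y))\<^sup>2) summable_on carrier K \<times> carrier W"
    by (intro summable_on_SigmaI[where g = "\<lambda>x. cmod (m x) * (ell2_norm (carrier W) f)\<^sup>2"])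
      (use s in auto)
  have "(\<Sum>\<^sub>\<infinity>x\<in>carrier K. \<Sum>\<^sub>\<infinity>y\<in>carrier W. cmod (m x) * (cmod (translate x f y))\<^sup>2)
      = (\<Sum>\<^sub>\<infinity>x\<in>carrier K. cmod (m x) * (ell2_norm (carrier W) f)\<^sup>2)"
    using s by (intro infsum_cong) (simp add: has_sum_iff)
  then show "(\<Sum>\<^sub>\<infinity>x\<in>carrier K. \<Sum>\<^sub>\<infinity>y\<in>carrier W. cmod (m x) * (cmod (translate x f y))\<^sup>2)
      = (\<Sum>\<^sub>\<infinity>x\<in>carrier K. cmod (m x)) * (ell2_norm (carrier W) f)\<^sup>2"
    by (simp add: infsum_cmult_left')
qed

text \<open>Cauchy--Schwarz on \<open>K\<close> with the weights \<open>cmod (m x)\<close> split evenly between the two factors. Summed over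
  \<open>y\<close>, the right-hand side is \<open>\<parallel>m\<parallel>\<^sub>1\<^sup>2 \<parallel>f\<parallel>\<^sup>2\<close>, as translations are isometries.\<close>

lemma hom_convolution_pointwise_bound:
  assumes f: "f \<in> ell2 (carrier W)" and y: "y \<in> carrier W"
  shows "(cmod (hom_convolution K W \<phi> m f y))\<^sup>2
    \<le> (\<Sum>\<^sub>\<infinity>x\<in>carrier K. cmod (m x)) * (\<Sum>\<^sub>\<infinity>x\<in>carrier K. cmod (m x) * (cmod (translate x f y))\<^sup>2)"
proof -
  have fb: "cmod (f w) \<le> ell2_norm (carrier W) f" for w by (rule ell2_bounded[OF f])
  define a where "a = (\<lambda>x. if x \<in> carrier K then complex_of_real (sqrt (cmod (m x))) else 0)"
  define b where "b = (\<lambda>x. if x \<in> carrier K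
    then complex_of_real (sqrt (cmod (m x)) * cmod (translate x f y)) else 0)"
  have a2: "(cmod (a x))\<^sup>2 = cmod (m x)" and b2: "(cmod (b x))\<^sup>2 = cmod (m x) * (cmod (translate x f y))\<^sup>2"
    if "x \<in> carrier K" for x
    using that by (simp_all add: a_def b_def norm_mult power_mult_distrib)
  have sm: "(\<lambda>x. cmod (m x)) summable_on carrier K"
    using m by (simp add: finite_complex_measure_def)
  have a: "a \<in> ell2 (carrier K)"
    using sm a2 by (auto simp: ell2_def a_def cong: summable_on_cong)
  have "(\<lambda>x. cmod (m x) * (cmod (translate x f y))\<^sup>2) summable_on carrier K"
  proof (rule summable_on_comparison_test)
    show "(\<lambda>x. cmod (m x) * (ell2_norm (carrier W) f)\<^sup>2) summable_on carrier K"
      using sm by (rule summable_on_cmult_left)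
  qed (auto intro!: mult_left_mono power_mono fb)
  then have b: "b \<in> ell2 (carrier K)"
    using b2 by (auto simp: ell2_def b_def cong: summable_on_cong)
  have na: "(ell2_norm (carrier K) a)\<^sup>2 = (\<Sum>\<^sub>\<infinity>x\<in>carrier K. cmod (m x))"
    using a2 by (simp add: ell2_norm_square cong: infsum_cong)
  have nb: "(ell2_norm (carrier K) b)\<^sup>2 = (\<Sum>\<^sub>\<infinity>x\<in>carrier K. cmod (m x) * (cmod (translate x f y))\<^sup>2)"
    using b2 by (simp add: ell2_norm_square cong: infsum_cong)
  have "ell2_inner (carrier K) a b = (\<Sum>\<^sub>\<infinity>x\<in>carrier K. complex_of_real (cmod (m x * f (inv\<^bsub>W\<^esub> (\<phi> x) \<otimes>\<^bsub>W\<^esub> y))))"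
    unfolding ell2_inner_def using y
    by (intro infsum_cong) (simp add: a_def b_def norm_mult mult.assoc[symmetric] flip: of_real_mult)
  also have "\<dots> = complex_of_real (\<Sum>\<^sub>\<infinity>x\<in>carrier K. cmod (m x * f (inv\<^bsub>W\<^esub> (\<phi> x) \<otimes>\<^bsub>W\<^esub> y)))"
    by (intro infsumI has_sum_of_real has_sum_infsum hom_convolution_abs_summable[OF m, of f, OF fb])
  finally have inner: "cmod (ell2_inner (carrier K) a b)
      = (\<Sum>\<^sub>\<infinity>x\<in>carrier K. cmod (m x * f (inv\<^bsub>W\<^esub> (\<phi> x) \<otimes>\<^bsub>W\<^esub> y)))"
    by (simp add: infsum_nonneg)
  have "cmod (hom_convolution K W \<phi> m f y) \<le> (\<Sum>\<^sub>\<infinity>x\<in>carrier K. cmod (m x * f (inv\<^bsub>W\<^esub> (\<phi> x) \<otimes>\<^bsub>W\<^esub> y)))"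
    unfolding hom_convolution_def using y
    by (simp del: norm_mult) (intro norm_infsum_bound hom_convolution_abs_summable[OF m, of f, OF fb])
  also have "\<dots> \<le> ell2_norm (carrier K) a * ell2_norm (carrier K) b"
    using ell2_Cauchy_Schwarz[OF a b] inner by simp
  finally have "(cmod (hom_convolution K W \<phi> m f y))\<^sup>2 \<le> (ell2_norm (carrier K) a * ell2_norm (carrier K) b)\<^sup>2"
    by (intro power_mono) auto
  then show ?thesis by (simp add: power_mult_distrib na nb)
qed

lemma hom_convolution_mem_norm:
  assumes f: "f \<in> ell2 (carrier W)"
  shows "hom_convolution K W \<phi> m f \<in> ell2 (carrier W)"
    and "ell2_norm (carrier W) (hom_convolution K W \<phi> m f)
      \<le> (\<Sum>\<^sub>\<infinity>x\<in>carrier K. cmod (m x)) * ell2_norm (carrier W) f"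
proof -
  let ?M = "\<Sum>\<^sub>\<infinity>x\<in>carrier K. cmod (m x)"
  let ?h = "\<lambda>x y. cmod (m x) * (cmod (translate x f y))\<^sup>2"
  have M0: "0 \<le> ?M" by (simp add: infsum_nonneg)
  have s: "(\<lambda>(y, x). ?h x y) summable_on carrier W \<times> carrier K"
    using weighted_square_summable(1)[OF f] summable_on_swap[of "\<lambda>(x, y). ?h x y" "carrier K" "carrier W"]
    by simp
  have sy: "(\<lambda>y. \<Sum>\<^sub>\<infinity>x\<in>carrier K. ?h x y) summable_on carrier W"
    using summable_on_Sigma_banach[OF s] by simp
  have eq: "(\<Sum>\<^sub>\<infinity>y\<in>carrier W. \<Sum>\<^sub>\<infinity>x\<in>carrier K. ?h x y) = ?M * (ell2_norm (carrier W) f)\<^sup>2"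
    using infsum_swap_banach[OF s] weighted_square_summable(2)[OF f] by simp
  have bound: "(cmod (hom_convolution K W \<phi> m f y))\<^sup>2 \<le> ?M * (\<Sum>\<^sub>\<infinity>x\<in>carrier K. ?h x y)"
    if "y \<in> carrier W" for y
    by (rule hom_convolution_pointwise_bound[OF f that])
  have s2: "(\<lambda>y. (cmod (hom_convolution K W \<phi> m f y))\<^sup>2) summable_on carrier W"
    by (rule summable_on_comparison_test[OF summable_on_cmult_right[OF sy, of ?M]]) (rule bound, assumption, simp)
  then show "hom_convolution K W \<phi> m f \<in> ell2 (carrier W)"
    by (auto simp: ell2_def hom_convolution_def)
  have "(ell2_norm (carrier W) (hom_convolution K W \<phi> m f))\<^sup>2 \<le> (\<Sum>\<^sub>\<infinity>y\<in>carrier W. ?M * (\<Sum>\<^sub>\<infinity>x\<in>carrier K. ?h x y))"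
    unfolding ell2_norm_square by (intro infsum_mono s2 summable_on_cmult_right sy bound)
  also have "\<dots> = (?M * ell2_norm (carrier W) f)\<^sup>2"
    by (simp only: infsum_cmult_right' eq) (simp add: power2_eq_square)
  finally show "ell2_norm (carrier W) (hom_convolution K W \<phi> m f) \<le> ?M * ell2_norm (carrier W) f"
    by (rule power2_le_imp_le) (simp add: M0)
qed

text \<open>The double sum may be exchanged, as \<open>\<bar>g y\<bar> \<bar>translate x f y\<bar>\<close> is dominated by the sum of the two squares,
  which is summable against the weights \<open>cmod (m x)\<close>.\<close>

lemma inner_hom_convolution:
  assumes f: "f \<in> ell2 (carrier W)" and g: "g \<in> ell2 (carrier W)"
  shows "ell2_inner (carrier W) g (hom_convolution K W \<phi> m f)
    = (\<Sum>\<^sub>\<infinity>x\<in>carrier K. m x * ell2_inner (carrier W) g (translate x f))"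
proof -
  let ?h = "\<lambda>x y. m x * (cnj (g y) * translate x f y)"
  have "(\<lambda>p. norm (case p of (x, y) \<Rightarrow> ?h x y)) summable_on carrier K \<times> carrier W"
  proof (rule Infinite_Sum.abs_summable_on_comparison_test')
    have "(\<lambda>(x, y). cmod (m x) * (cmod (g y))\<^sup>2) summable_on carrier K \<times> carrier W"
    proof (rule summable_on_SigmaI)
      show "((\<lambda>y. case (x, y) of (x, y) \<Rightarrow> cmod (m x) * (cmod (g y))\<^sup>2) has_sum
          cmod (m x) * (ell2_norm (carrier W) g)\<^sup>2) (carrier W)" for x
        using g by (simp add: has_sum_cmult_right ell2_def ell2_norm_square)
      show "(\<lambda>x. cmod (m x) * (ell2_norm (carrier W) g)\<^sup>2) summable_on carrier K"
        using m unfolding finite_complex_measure_def by (rule summable_on_cmult_left)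
    qed auto
    from summable_on_add[OF this weighted_square_summable(1)[OF f]]
    show "(\<lambda>(x, y). cmod (m x) * (cmod (g y))\<^sup>2 + cmod (m x) * (cmod (translate x f y))\<^sup>2)
        summable_on carrier K \<times> carrier W"
      by (simp add: case_prod_unfold)
    fix p :: "'k \<times> 'w"
    obtain x y where p: "p = (x, y)" by (cases p)
    have "cmod (g y) * cmod (translate x f y) \<le> (cmod (g y))\<^sup>2 + (cmod (translate x f y))\<^sup>2"
      using sum_squares_bound[of "cmod (g y)" "cmod (translate x f y)"]
        mult_nonneg_nonneg[OF norm_ge_zero norm_ge_zero, of "g y" "translate x f y"] by linarith
    from mult_left_mono[OF this norm_ge_zero, of "m x"]
    show "norm (case p of (x, y) \<Rightarrow> ?h x y) \<le> (case p of (x, y) \<Rightarrow>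
        cmod (m x) * (cmod (g y))\<^sup>2 + cmod (m x) * (cmod (translate x f y))\<^sup>2)"
      by (simp add: p norm_mult distrib_left)
  qed
  then have s: "(\<lambda>(x, y). ?h x y) summable_on carrier K \<times> carrier W"
    by (rule abs_summable_summable)
  have "ell2_inner (carrier W) g (hom_convolution K W \<phi> m f)
      = (\<Sum>\<^sub>\<infinity>y\<in>carrier W. \<Sum>\<^sub>\<infinity>x\<in>carrier K. ?h x y)"
    unfolding ell2_inner_def hom_convolution_def
    by (intro infsum_cong) (simp add: infsum_cmult_right'[symmetric] mult.left_commute)
  also have "\<dots> = (\<Sum>\<^sub>\<infinity>x\<in>carrier K. \<Sum>\<^sub>\<infinity>y\<in>carrier W. ?h x y)"
    by (rule infsum_swap_banach[OF s, symmetric])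
  also have "\<dots> = (\<Sum>\<^sub>\<infinity>x\<in>carrier K. m x * ell2_inner (carrier W) g (translate x f))"
    unfolding ell2_inner_def by (simp only: infsum_cmult_right')
  finally show ?thesis .
qed

text \<open>The adjoint of translation by \<open>\<phi> x\<close> is translation by its inverse, so the symmetry of \<open>m\<close> and the
  substitution \<open>x \<mapsto> inv x\<close> exchange the two sides.\<close>

lemma hom_convolution_selfadjoint:
  assumes herm: "\<And>x. x \<in> carrier K \<Longrightarrow> m (inv\<^bsub>K\<^esub> x) = cnj (m x)"
  shows "selfadjoint_operator (carrier W) (hom_convolution K W \<phi> m)"
  unfolding selfadjoint_operator_def bounded_operator_def
proof (intro conjI ballI allI exI)
  fix f g assume f: "f \<in> ell2 (carrier W)" and g: "g \<in> ell2 (carrier W)"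
  show "hom_convolution K W \<phi> m f \<in> ell2 (carrier W)"
    "ell2_norm (carrier W) (hom_convolution K W \<phi> m f)
      \<le> (\<Sum>\<^sub>\<infinity>x\<in>carrier K. cmod (m x)) * ell2_norm (carrier W) f"
    by (rule hom_convolution_mem_norm[OF f])+
  show "hom_convolution K W \<phi> m (\<lambda>x. f x + g x)
      = (\<lambda>x. hom_convolution K W \<phi> m f x + hom_convolution K W \<phi> m g x)"
    by (rule hom_convolution_add[OF m, of f _ g, OF ell2_bounded[OF f] ell2_bounded[OF g]])
  show "hom_convolution K W \<phi> m (\<lambda>x. c * f x) = (\<lambda>x. c * hom_convolution K W \<phi> m f x)" for c
    by (rule hom_convolution_scale)
  have "bij_betw (\<lambda>x. inv\<^bsub>K\<^esub> x) (carrier K) (carrier K)"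
    by (intro bij_betw_byWitness[where f' = "\<lambda>x. inv\<^bsub>K\<^esub> x"]) auto
  note inv = infsum_reindex_bij_betw[OF this]
  have "ell2_inner (carrier W) f (hom_convolution K W \<phi> m g)
      = (\<Sum>\<^sub>\<infinity>x\<in>carrier K. m (inv\<^bsub>K\<^esub> x) * ell2_inner (carrier W) f (translate (inv\<^bsub>K\<^esub> x) g))"
    unfolding inner_hom_convolution[OF g f] by (rule inv[symmetric])
  also have "\<dots> = (\<Sum>\<^sub>\<infinity>x\<in>carrier K. cnj (m x * ell2_inner (carrier W) g (translate x f)))"
    by (intro infsum_cong) (simp add: herm translate_inner[of _ g f])
  also have "\<dots> = cnj (ell2_inner (carrier W) g (hom_convolution K W \<phi> m f))"
    by (simp only: infsum_cnj inner_hom_convolution[OF f g])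
  also have "\<dots> = ell2_inner (carrier W) (hom_convolution K W \<phi> m f) g"
    by (rule ell2_inner_commute[symmetric])
  finally show "ell2_inner (carrier W) (hom_convolution K W \<phi> m f) g
      = ell2_inner (carrier W) f (hom_convolution K W \<phi> m g)" ..
qed

lemma push_forward_convolution_has_sum:
  assumes inj: "inj_on \<phi> (carrier K)" and f: "\<And>w. cmod (f w) \<le> b" and y: "y \<in> carrier W"
  shows "((\<lambda>w. push_forward K \<phi> m w * left_regular W w f y) has_sum hom_convolution K W \<phi> m f y) (carrier W)"
proof -
  have push: "push_forward K \<phi> m (\<phi> x) = m x" if "x \<in> carrier K" for x
  proof -
    have "{x' \<in> carrier K. \<phi> x' = \<phi> x} = {x}" using inj that by (auto dest: inj_onD)
    then show ?thesis by (simp add: push_forward_def)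
  qed
  have "((\<lambda>x. m x * f (inv\<^bsub>W\<^esub> (\<phi> x) \<otimes>\<^bsub>W\<^esub> y)) has_sum hom_convolution K W \<phi> m f y) (carrier K)"
    using y hom_convolution_summable[OF m, of f b, OF f, where \<sigma> = "\<lambda>x. inv\<^bsub>W\<^esub> (\<phi> x) \<otimes>\<^bsub>W\<^esub> y"]
    by (simp add: hom_convolution_def)
  then have "(((\<lambda>w. push_forward K \<phi> m w * left_regular W w f y) \<circ> \<phi>) has_sum hom_convolution K W \<phi> m f y) (carrier K)"
    using y by (subst has_sum_cong[where g = "\<lambda>x. m x * f (inv\<^bsub>W\<^esub> (\<phi> x) \<otimes>\<^bsub>W\<^esub> y)"])
      (simp_all add: push left_regular_def)
  then have "((\<lambda>w. push_forward K \<phi> m w * left_regular W w f y) has_sum hom_convolution K W \<phi> m f y) (\<phi> ` carrier K)"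
    by (subst has_sum_reindex[OF inj])
  moreover have "push_forward K \<phi> m w = 0" if "w \<notin> \<phi> ` carrier K" for w
  proof -
    have "{x \<in> carrier K. \<phi> x = w} = {}" using that by auto
    then show ?thesis by (simp only: push_forward_def infsum_empty)
  qed
  ultimately show ?thesis
    by (subst (asm) has_sum_cong_neutral[where T = "carrier W" and g = "\<lambda>w. push_forward K \<phi> m w * left_regular W w f y"]) auto
qed

end

context group
begin

lemma convolution_delta_one:
  assumes y: "y \<in> carrier G"
  shows "convolution_operator G m (delta \<one>) y = m y"
proof -
  have "convolution_operator G m (delta \<one>) y = (\<Sum>\<^sub>\<infinity>x\<in>{y}. m x)"
    unfolding convolution_operator_def left_regular_def using y
    by (intro infsum_cong_neutral) (auto simp: delta_def inv_solve_left')
  then show ?thesis by simp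
qed

lemma convolution_delta_at_one:
  assumes y: "y \<in> carrier G"
  shows "convolution_operator G m (delta y) \<one> = m (inv y)"
proof -
  have "convolution_operator G m (delta y) \<one> = (\<Sum>\<^sub>\<infinity>x\<in>{inv y}. m x)"
    unfolding convolution_operator_def left_regular_def using y
    by (intro infsum_cong_neutral) (auto simp: delta_def)
  then show ?thesis by simp
qed

text \<open>Both sides are matrix entries of the operator between the point masses at \<open>\<one>\<close> and \<open>x\<close>.\<close>

lemma selfadjoint_convolution_hermitian:
  assumes sa: "selfadjoint_operator (carrier G) (convolution_operator G m)" and x: "x \<in> carrier G"
  shows "m (inv x) = cnj (m x)"
proof -
  have "ell2_inner (carrier G) (convolution_operator G m (delta \<one>)) (delta x)
      = cnj (convolution_operator G m (delta \<one>) x)"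
    by (subst ell2_inner_commute) (simp add: x)
  then show ?thesis
    using selfadjoint_symmetric[OF sa, of "delta \<one>" "delta x"] x
    by (simp add: convolution_delta_one convolution_delta_at_one)
qed

definition right_translate :: "'a \<Rightarrow> ('a \<Rightarrow> complex) \<Rightarrow> 'a \<Rightarrow> complex" where
  "right_translate a f = (\<lambda>y. if y \<in> carrier G then f (y \<otimes> a) else 0)"

lemma convolution_right_translate:
  assumes "a \<in> carrier G"
  shows "convolution_operator G m (right_translate a f) = right_translate a (convolution_operator G m f)"
proof
  fix y
  show "convolution_operator G m (right_translate a f) y = right_translate a (convolution_operator G m f) y"
    unfolding convolution_operator_def left_regular_def right_translate_def
    using assms by (auto intro!: infsum_cong simp: m_assoc)
qed

text \<open>Left convolution commutes with right translation, and right translations permute the point masses.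
  This is why the diagonal moments do not depend on the point.\<close>

lemma convolution_moment_delta:
  assumes x: "x \<in> carrier G"
  shows "(convolution_operator G m ^^ n) (delta x) x = (convolution_operator G m ^^ n) (delta \<one>) \<one>"
proof -
  have d: "delta x = right_translate (inv x) (delta \<one>)"
    using x by (auto simp: fun_eq_iff delta_def right_translate_def inv_solve_right')
  have "(convolution_operator G m ^^ n) (right_translate (inv x) f)
      = right_translate (inv x) ((convolution_operator G m ^^ n) f)" for f
    by (induction n) (simp_all add: x convolution_right_translate)
  then show ?thesis
    by (simp only: d) (simp add: right_translate_def x)
qed

end

section \<open>The walk operator on a wreath product\<close>

context
  fixes \<Lambda> :: "('l, 'x) monoid_scheme" and \<Gamma> :: "('g, 'y) monoid_scheme"
    and m\<^sub>\<Lambda> :: "'l \<Rightarrow> complex" and m\<^sub>\<Gamma> :: "'g \<Rightarrow> complex"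
  assumes \<Lambda>: "group \<Lambda>" and \<Gamma>: "group \<Gamma>"
    and m\<^sub>\<Lambda>: "finite_complex_measure \<Lambda> m\<^sub>\<Lambda>" and m\<^sub>\<Gamma>: "finite_complex_measure \<Gamma> m\<^sub>\<Gamma>"
begin

interpretation L: group \<Lambda> by (rule \<Lambda>)
interpretation G: group \<Gamma> by (rule \<Gamma>)
interpretation W: group "wreath \<Lambda> \<Gamma>" by (rule group_wreath[OF \<Lambda> \<Gamma>])
interpretation lamp: group_hom \<Lambda> "wreath \<Lambda> \<Gamma>" "embed_lamp \<Lambda> \<Gamma>"
  by unfold_locales (rule embed_lamp_hom[OF \<Lambda> \<Gamma>])
interpretation base: group_hom \<Gamma> "wreath \<Lambda> \<Gamma>" "embed_base \<Lambda> \<Gamma>"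
  by unfold_locales (rule embed_base_hom[OF \<Lambda> \<Gamma>])

private abbreviation (input) "W \<equiv> wreath \<Lambda> \<Gamma>"
private abbreviation (input) "A \<equiv> hom_convolution \<Lambda> W (embed_lamp \<Lambda> \<Gamma>) m\<^sub>\<Lambda>"
private abbreviation (input) "B \<equiv> hom_convolution \<Gamma> W (embed_base \<Lambda> \<Gamma>) m\<^sub>\<Gamma>"
private abbreviation (input) "M \<equiv> convolution_operator W (wreath_measure \<Lambda> \<Gamma> m\<^sub>\<Lambda> m\<^sub>\<Gamma>)"
private abbreviation (input) "L \<equiv> convolution_operator \<Lambda> m\<^sub>\<Lambda>"

text \<open>The projection \<open>P\<close> of the introduction: the lamplighter stands at the identity.\<close>

definition home_projector :: "(('g \<Rightarrow> 'l) \<times> 'g) operator" where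
  "home_projector f = (\<lambda>w. if w \<in> {w. snd w = \<one>\<^bsub>\<Gamma>\<^esub>} then f w else 0)"

text \<open>The operator \<open>N\<close> of the introduction: the walk in which the lamp at the lamplighter's position is left
  alone whenever he stands at the identity. It does not see that lamp at all.\<close>

definition frozen_operator :: "(('g \<Rightarrow> 'l) \<times> 'g) operator" where
  "frozen_operator f = (\<lambda>w. A f w - home_projector (A f) w + B f w)"

definition reset_lamp :: "('g \<Rightarrow> 'l) \<times> 'g \<Rightarrow> ('g \<Rightarrow> 'l) \<times> 'g" where
  "reset_lamp w = (\<lambda>h\<in>carrier \<Gamma>. if h = snd w then \<one>\<^bsub>\<Lambda>\<^esub> else fst w h, snd w)"

text \<open>The tensor \<open>\<phi> \<otimes> f\<close> with respect to the splitting of the lamp at the lamplighter's position from all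
  other data; the second factor enters through its values at configurations where that lamp is off.\<close>

definition lamp_tensor :: "('l \<Rightarrow> complex) \<Rightarrow> (('g \<Rightarrow> 'l) \<times> 'g \<Rightarrow> complex) \<Rightarrow> ('g \<Rightarrow> 'l) \<times> 'g \<Rightarrow> complex" where
  "lamp_tensor \<phi> f = (\<lambda>w. if w \<in> carrier W then \<phi> (fst w (snd w)) * f (reset_lamp w) else 0)"

lemma carrier_wreathD:
  assumes "w \<in> carrier W"
  shows "snd w \<in> carrier \<Gamma>" "\<And>h. h \<in> carrier \<Gamma> \<Longrightarrow> fst w h \<in> carrier \<Lambda>"
  using assms by (auto simp: wreath_def)

lemma reset_lamp_mem: "w \<in> carrier W \<Longrightarrow> reset_lamp w \<in> carrier W"
proof -
  assume "w \<in> carrier W"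
  then obtain \<eta> g where w: "w = (\<eta>, g)" "g \<in> carrier \<Gamma>" "\<eta> \<in> carrier \<Gamma> \<rightarrow>\<^sub>E carrier \<Lambda>"
      "finite {h \<in> carrier \<Gamma>. \<eta> h \<noteq> \<one>\<^bsub>\<Lambda>\<^esub>}"
    by (auto simp: wreath_def)
  have "finite {h. h \<noteq> g \<and> h \<in> carrier \<Gamma> \<and> \<eta> h \<noteq> \<one>\<^bsub>\<Lambda>\<^esub>}"
    by (rule finite_subset[OF _ w(4)]) auto
  then show ?thesis
    using w(2,3) by (auto simp: w(1) reset_lamp_def wreath_def cong: conj_cong)
qed

lemma embed_lamp_inv_mult:
  assumes "l \<in> carrier \<Lambda>" "w \<in> carrier W"
  shows "inv\<^bsub>W\<^esub> (embed_lamp \<Lambda> \<Gamma> l) \<otimes>\<^bsub>W\<^esub> w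
    = (\<lambda>h\<in>carrier \<Gamma>. if h = \<one>\<^bsub>\<Gamma>\<^esub> then inv\<^bsub>\<Lambda>\<^esub> l \<otimes>\<^bsub>\<Lambda>\<^esub> fst w h else fst w h, snd w)"
proof -
  have "inv\<^bsub>W\<^esub> (embed_lamp \<Lambda> \<Gamma> l) = embed_lamp \<Lambda> \<Gamma> (inv\<^bsub>\<Lambda>\<^esub> l)"
    using assms by simp
  then show ?thesis
    using assms carrier_wreathD[OF assms(2)]
    by (cases w) (auto simp: embed_lamp_def wreath_def intro!: restrict_ext)
qed

lemma embed_base_inv_mult:
  assumes "x \<in> carrier \<Gamma>" "w \<in> carrier W"
  shows "inv\<^bsub>W\<^esub> (embed_base \<Lambda> \<Gamma> x) \<otimes>\<^bsub>W\<^esub> w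
    = (\<lambda>h\<in>carrier \<Gamma>. fst w (x \<otimes>\<^bsub>\<Gamma>\<^esub> h), inv\<^bsub>\<Gamma>\<^esub> x \<otimes>\<^bsub>\<Gamma>\<^esub> snd w)"
proof -
  have "inv\<^bsub>W\<^esub> (embed_base \<Lambda> \<Gamma> x) = embed_base \<Lambda> \<Gamma> (inv\<^bsub>\<Gamma>\<^esub> x)"
    using assms by simp
  then show ?thesis
    using assms carrier_wreathD[OF assms(2)]
    by (cases w) (auto simp: embed_base_def wreath_def intro!: restrict_ext)
qed

lemma embed_lamp_mult_mem:
  "l \<in> carrier \<Lambda> \<Longrightarrow> w \<in> carrier W \<Longrightarrow> inv\<^bsub>W\<^esub> (embed_lamp \<Lambda> \<Gamma> l) \<otimes>\<^bsub>W\<^esub> w \<in> carrier W"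
  by simp

lemma embed_base_mult_mem:
  "x \<in> carrier \<Gamma> \<Longrightarrow> w \<in> carrier W \<Longrightarrow> inv\<^bsub>W\<^esub> (embed_base \<Lambda> \<Gamma> x) \<otimes>\<^bsub>W\<^esub> w \<in> carrier W"
  by simp

text \<open>Moving the lamplighter by \<open>x\<close> carries the configuration along, so the lamp at his position is the same
  before and after.\<close>

lemma B_lamp_tensor: "B (lamp_tensor \<phi> f) = lamp_tensor \<phi> (B f)"
proof
  fix w
  show "B (lamp_tensor \<phi> f) w = lamp_tensor \<phi> (B f) w"
  proof (cases "w \<in> carrier W")
    case w: True
    have "lamp_tensor \<phi> f (inv\<^bsub>W\<^esub> (embed_base \<Lambda> \<Gamma> x) \<otimes>\<^bsub>W\<^esub> w)
        = \<phi> (fst w (snd w)) * f (inv\<^bsub>W\<^esub> (embed_base \<Lambda> \<Gamma> x) \<otimes>\<^bsub>W\<^esub> reset_lamp w)"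
      if x: "x \<in> carrier \<Gamma>" for x
    proof -
      note g = carrier_wreathD(1)[OF w]
      have "h = inv\<^bsub>\<Gamma>\<^esub> x \<otimes>\<^bsub>\<Gamma>\<^esub> snd w \<longleftrightarrow> x \<otimes>\<^bsub>\<Gamma>\<^esub> h = snd w" if "h \<in> carrier \<Gamma>" for h
        using g x that G.inv_solve_left[of h x "snd w"] by auto
      then have "reset_lamp (inv\<^bsub>W\<^esub> (embed_base \<Lambda> \<Gamma> x) \<otimes>\<^bsub>W\<^esub> w)
          = inv\<^bsub>W\<^esub> (embed_base \<Lambda> \<Gamma> x) \<otimes>\<^bsub>W\<^esub> reset_lamp w"
        unfolding embed_base_inv_mult[OF x w] embed_base_inv_mult[OF x reset_lamp_mem[OF w]]
        using x g by (auto simp: reset_lamp_def intro!: restrict_ext)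
      moreover have "fst (inv\<^bsub>W\<^esub> (embed_base \<Lambda> \<Gamma> x) \<otimes>\<^bsub>W\<^esub> w) (snd (inv\<^bsub>W\<^esub> (embed_base \<Lambda> \<Gamma> x) \<otimes>\<^bsub>W\<^esub> w))
          = fst w (snd w)"
        using x g by (simp add: embed_base_inv_mult[OF x w] G.m_assoc[symmetric])
      ultimately show ?thesis
        unfolding lamp_tensor_def using embed_base_mult_mem[OF x w] by simp
    qed
    then have "B (lamp_tensor \<phi> f) w
        = (\<Sum>\<^sub>\<infinity>x\<in>carrier \<Gamma>. \<phi> (fst w (snd w)) * (m\<^sub>\<Gamma> x * f (inv\<^bsub>W\<^esub> (embed_base \<Lambda> \<Gamma> x) \<otimes>\<^bsub>W\<^esub> reset_lamp w)))"
      unfolding hom_convolution_def using w by (simp cong: infsum_cong) (simp add: mult.left_commute)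
    then show ?thesis
      using w reset_lamp_mem[OF w] by (simp add: lamp_tensor_def infsum_cmult_right' hom_convolution_def)
  qed (simp add: hom_convolution_def lamp_tensor_def)
qed

text \<open>Left multiplication by an element of \<open>\<Lambda>\<close> acts on the lamp at the identity of \<open>\<Gamma>\<close>. This is the
  distinguished lamp if the lamplighter stands there, which gives the term \<open>L \<phi> \<otimes> P f\<close>; otherwise it is a
  different lamp, and \<open>\<phi>\<close> passes through.\<close>

lemma A_lamp_tensor:
  "A (lamp_tensor \<phi> f) = (\<lambda>w. lamp_tensor \<phi> (\<lambda>v. A f v - home_projector (A f) v) w
    + lamp_tensor (L \<phi>) (home_projector f) w)"
proof
  fix w
  show "A (lamp_tensor \<phi> f) w = lamp_tensor \<phi> (\<lambda>v. A f v - home_projector (A f) v) w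
    + lamp_tensor (L \<phi>) (home_projector f) w"
  proof (cases "w \<in> carrier W")
    case w: True
    note g = carrier_wreathD[OF w]
    note rw = reset_lamp_mem[OF w]
    show ?thesis
    proof (cases "snd w = \<one>\<^bsub>\<Gamma>\<^esub>")
      case True
      have "lamp_tensor \<phi> f (inv\<^bsub>W\<^esub> (embed_lamp \<Lambda> \<Gamma> l) \<otimes>\<^bsub>W\<^esub> w)
          = left_regular \<Lambda> l \<phi> (fst w (snd w)) * f (reset_lamp w)" if l: "l \<in> carrier \<Lambda>" for l
      proof -
        have "reset_lamp (inv\<^bsub>W\<^esub> (embed_lamp \<Lambda> \<Gamma> l) \<otimes>\<^bsub>W\<^esub> w) = reset_lamp w"
          using True by (auto simp: embed_lamp_inv_mult[OF l w] reset_lamp_def intro!: restrict_ext)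
        moreover have "fst (inv\<^bsub>W\<^esub> (embed_lamp \<Lambda> \<Gamma> l) \<otimes>\<^bsub>W\<^esub> w) (snd (inv\<^bsub>W\<^esub> (embed_lamp \<Lambda> \<Gamma> l) \<otimes>\<^bsub>W\<^esub> w))
            = inv\<^bsub>\<Lambda>\<^esub> l \<otimes>\<^bsub>\<Lambda>\<^esub> fst w (snd w)"
          using True by (simp add: embed_lamp_inv_mult[OF l w])
        ultimately show ?thesis
          unfolding lamp_tensor_def using embed_lamp_mult_mem[OF l w] g by (simp add: left_regular_def)
      qed
      then have "A (lamp_tensor \<phi> f) w
          = (\<Sum>\<^sub>\<infinity>l\<in>carrier \<Lambda>. (m\<^sub>\<Lambda> l * left_regular \<Lambda> l \<phi> (fst w (snd w))) * f (reset_lamp w))"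
        unfolding hom_convolution_def using w by (simp cong: infsum_cong) (simp add: mult.assoc)
      also have "\<dots> = L \<phi> (fst w (snd w)) * f (reset_lamp w)"
        by (simp only: infsum_cmult_left' convolution_operator_def)
      finally show ?thesis
        using w True by (simp add: lamp_tensor_def home_projector_def reset_lamp_def)
    next
      case False
      have "lamp_tensor \<phi> f (inv\<^bsub>W\<^esub> (embed_lamp \<Lambda> \<Gamma> l) \<otimes>\<^bsub>W\<^esub> w)
          = \<phi> (fst w (snd w)) * f (inv\<^bsub>W\<^esub> (embed_lamp \<Lambda> \<Gamma> l) \<otimes>\<^bsub>W\<^esub> reset_lamp w)"
        if l: "l \<in> carrier \<Lambda>" for l
      proof -
        have "reset_lamp (inv\<^bsub>W\<^esub> (embed_lamp \<Lambda> \<Gamma> l) \<otimes>\<^bsub>W\<^esub> w)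
            = inv\<^bsub>W\<^esub> (embed_lamp \<Lambda> \<Gamma> l) \<otimes>\<^bsub>W\<^esub> reset_lamp w"
          unfolding embed_lamp_inv_mult[OF l w] embed_lamp_inv_mult[OF l rw]
          using False by (auto simp: reset_lamp_def intro!: restrict_ext)
        moreover have "fst (inv\<^bsub>W\<^esub> (embed_lamp \<Lambda> \<Gamma> l) \<otimes>\<^bsub>W\<^esub> w) (snd (inv\<^bsub>W\<^esub> (embed_lamp \<Lambda> \<Gamma> l) \<otimes>\<^bsub>W\<^esub> w))
            = fst w (snd w)"
          using False g by (simp add: embed_lamp_inv_mult[OF l w])
        ultimately show ?thesis
          unfolding lamp_tensor_def using embed_lamp_mult_mem[OF l w] by simp
      qed
      then have "A (lamp_tensor \<phi> f) w
          = (\<Sum>\<^sub>\<infinity>l\<in>carrier \<Lambda>. \<phi> (fst w (snd w)) * (m\<^sub>\<Lambda> l * f (inv\<^bsub>W\<^esub> (embed_lamp \<Lambda> \<Gamma> l) \<otimes>\<^bsub>W\<^esub> reset_lamp w)))"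
        unfolding hom_convolution_def using w by (simp cong: infsum_cong) (simp add: mult.left_commute)
      also have "\<dots> = \<phi> (fst w (snd w)) * A f (reset_lamp w)"
        using rw by (simp add: infsum_cmult_right' hom_convolution_def)
      finally show ?thesis
        using w False by (simp add: lamp_tensor_def home_projector_def reset_lamp_def)
    qed
  qed (simp add: hom_convolution_def lamp_tensor_def)
qed

lemma wreath_convolution_eq:
  assumes "\<And>w. cmod (f w) \<le> b"
  shows "M f = (\<lambda>w. A f w + B f w)"
proof
  fix w
  show "M f w = A f w + B f w"
  proof (cases "w \<in> carrier W")
    case w: True
    have "inj_on (embed_lamp \<Lambda> \<Gamma>) (carrier \<Lambda>)"
      by (rule inj_onI) (auto simp: embed_lamp_def fun_eq_iff restrict_def dest!: spec[of _ "\<one>\<^bsub>\<Gamma>\<^esub>"])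
    note 1 = push_forward_convolution_has_sum[OF \<Lambda> W.group_axioms embed_lamp_hom[OF \<Lambda> \<Gamma>] m\<^sub>\<Lambda> this,
      of f b, OF assms w]
    have "inj_on (embed_base \<Lambda> \<Gamma>) (carrier \<Gamma>)"
      by (rule inj_onI) (simp add: embed_base_def)
    note 2 = push_forward_convolution_has_sum[OF \<Gamma> W.group_axioms embed_base_hom[OF \<Lambda> \<Gamma>] m\<^sub>\<Gamma> this,
      of f b, OF assms w]
    show ?thesis
      using infsumI[OF has_sum_add[OF 1 2]]
      by (simp add: convolution_operator_def wreath_measure_def distrib_right)
  qed (simp add: convolution_operator_def left_regular_def hom_convolution_def)
qed

text \<open>The decomposition \<open>M = 1 \<otimes> N + L \<otimes> P\<close>.\<close>

lemma wreath_convolution_lamp_tensor: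
  assumes \<phi>: "\<phi> \<in> ell2 (carrier \<Lambda>)" and f: "f \<in> ell2 (carrier W)"
  shows "M (lamp_tensor \<phi> f) = (\<lambda>w. lamp_tensor \<phi> (frozen_operator f) w
    + lamp_tensor (L \<phi>) (home_projector f) w)"
proof -
  have "cmod (lamp_tensor \<phi> f w) \<le> ell2_norm (carrier \<Lambda>) \<phi> * ell2_norm (carrier W) f" for w
    by (auto simp: lamp_tensor_def norm_mult intro!: mult_mono ell2_bounded \<phi> f)
  from wreath_convolution_eq[of "lamp_tensor \<phi> f", OF this] show ?thesis
    by (simp add: A_lamp_tensor B_lamp_tensor) (simp add: lamp_tensor_def frozen_operator_def
      distrib_left fun_eq_iff)
qed

lemma home_projector_orthogonal: "orthogonal_projector (carrier W) home_projector"
  unfolding home_projector_def[abs_def] by (rule orthogonal_projector_restrict)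

lemma home_projector_commutes: "A (home_projector f) = home_projector (A f)"
proof
  fix w
  show "A (home_projector f) w = home_projector (A f) w"
  proof (cases "w \<in> carrier W")
    case w: True
    have "snd (inv\<^bsub>W\<^esub> (embed_lamp \<Lambda> \<Gamma> l) \<otimes>\<^bsub>W\<^esub> w) = snd w" if "l \<in> carrier \<Lambda>" for l
      by (simp add: embed_lamp_inv_mult[OF that w])
    then show ?thesis
      using w by (simp add: hom_convolution_def home_projector_def cong: infsum_cong)
  qed (simp add: hom_convolution_def home_projector_def)
qed

lemma wreath_convolution_sum:
  assumes "finite I" "\<And>i. i \<in> I \<Longrightarrow> \<exists>b. \<forall>w. cmod (f i w) \<le> b"
  shows "M (\<lambda>w. \<Sum>i\<in>I. f i w) = (\<lambda>w. \<Sum>i\<in>I. M (f i) w) \<and> (\<exists>b. \<forall>w. cmod (\<Sum>i\<in>I. f i w) \<le> b)"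
  using assms
proof (induction I)
  case empty
  have "M (\<lambda>w. 0) = (\<lambda>w. 0)"
    by (simp add: convolution_operator_def left_regular_def fun_eq_iff cong: if_cong)
  then show ?case by auto
next
  case (insert i I)
  then have IH: "M (\<lambda>w. \<Sum>i\<in>I. f i w) = (\<lambda>w. \<Sum>i\<in>I. M (f i) w)"
    and "\<exists>c. \<forall>w. cmod (\<Sum>i\<in>I. f i w) \<le> c" "\<exists>b. \<forall>w. cmod (f i w) \<le> b"
    by simp_all
  then obtain b c where b: "\<And>w. cmod (f i w) \<le> b" and c: "\<And>w. cmod (\<Sum>i\<in>I. f i w) \<le> c"
    by blast
  have bc: "cmod (f i w + (\<Sum>i\<in>I. f i w)) \<le> b + c" for w
    using norm_triangle_ineq[of "f i w" "\<Sum>i\<in>I. f i w"] b[of w] c[of w] by linarith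
  have "M (\<lambda>w. f i w + (\<Sum>i\<in>I. f i w)) = (\<lambda>w. M (f i) w + M (\<lambda>w. \<Sum>i\<in>I. f i w) w)"
    unfolding wreath_convolution_eq[OF bc] wreath_convolution_eq[of "f i", OF b]
      wreath_convolution_eq[of "\<lambda>w. \<Sum>i\<in>I. f i w", OF c]
      hom_convolution_add[OF m\<^sub>\<Lambda>, of "f i" b "\<lambda>w. \<Sum>i\<in>I. f i w", OF b c]
      hom_convolution_add[OF m\<^sub>\<Gamma>, of "f i" b "\<lambda>w. \<Sum>i\<in>I. f i w", OF b c]
    by (simp add: ac_simps)
  then show ?case
    using insert.hyps bc IH by auto
qed

lemma delta_one_lamp_tensor: "delta \<one>\<^bsub>W\<^esub> = lamp_tensor (delta \<one>\<^bsub>\<Lambda>\<^esub>) (delta \<one>\<^bsub>W\<^esub>)"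
proof
  fix w
  have "w = \<one>\<^bsub>W\<^esub> \<longleftrightarrow> fst w (snd w) = \<one>\<^bsub>\<Lambda>\<^esub> \<and> reset_lamp w = \<one>\<^bsub>W\<^esub>" if w: "w \<in> carrier W"
  proof
    assume "w = \<one>\<^bsub>W\<^esub>"
    then show "fst w (snd w) = \<one>\<^bsub>\<Lambda>\<^esub> \<and> reset_lamp w = \<one>\<^bsub>W\<^esub>"
      by (auto simp: wreath_def reset_lamp_def intro!: restrict_ext)
  next
    assume *: "fst w (snd w) = \<one>\<^bsub>\<Lambda>\<^esub> \<and> reset_lamp w = \<one>\<^bsub>W\<^esub>"
    obtain \<eta> g where wg: "w = (\<eta>, g)" by (cases w)
    have ext: "\<eta> \<in> extensional (carrier \<Gamma>)"
      using w by (auto simp: wg wreath_def PiE_def)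
    have g: "g = \<one>\<^bsub>\<Gamma>\<^esub>" and r: "(\<lambda>h\<in>carrier \<Gamma>. if h = g then \<one>\<^bsub>\<Lambda>\<^esub> else \<eta> h) = (\<lambda>h\<in>carrier \<Gamma>. \<one>\<^bsub>\<Lambda>\<^esub>)"
      using * unfolding wg wreath_def reset_lamp_def fst_conv snd_conv by auto
    have "\<eta> h = \<one>\<^bsub>\<Lambda>\<^esub>" if "h \<in> carrier \<Gamma>" for h
      using fun_cong[OF r, of h] that * by (auto simp: wg split: if_splits)
    then have "\<eta> = (\<lambda>h\<in>carrier \<Gamma>. \<one>\<^bsub>\<Lambda>\<^esub>)"
      by (intro extensionalityI[OF ext restrict_extensional]) simp
    then show "w = \<one>\<^bsub>W\<^esub>" by (simp add: wg g wreath_def)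
  qed
  then show "delta \<one>\<^bsub>W\<^esub> w = lamp_tensor (delta \<one>\<^bsub>\<Lambda>\<^esub>) (delta \<one>\<^bsub>W\<^esub>) w"
    by (auto simp: delta_def lamp_tensor_def)
qed

lemma lamp_tensor_at_one: "lamp_tensor \<phi> f \<one>\<^bsub>W\<^esub> = \<phi> \<one>\<^bsub>\<Lambda>\<^esub> * f \<one>\<^bsub>W\<^esub>"
proof -
  have "reset_lamp \<one>\<^bsub>W\<^esub> = \<one>\<^bsub>W\<^esub>" "fst \<one>\<^bsub>W\<^esub> (snd \<one>\<^bsub>W\<^esub>) = \<one>\<^bsub>\<Lambda>\<^esub>"
    by (auto simp: wreath_def reset_lamp_def intro!: restrict_ext)
  then show ?thesis by (simp add: lamp_tensor_def)
qed

context
  assumes L_selfadjoint: "selfadjoint_operator (carrier \<Lambda>) L"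
    and B_selfadjoint: "selfadjoint_operator (carrier \<Gamma>) (convolution_operator \<Gamma> m\<^sub>\<Gamma>)"
begin

lemma lamp_operator_selfadjoint: "selfadjoint_operator (carrier W) A"
  by (rule hom_convolution_selfadjoint[OF \<Lambda> W.group_axioms embed_lamp_hom[OF \<Lambda> \<Gamma>] m\<^sub>\<Lambda>])
    (rule L.selfadjoint_convolution_hermitian[OF L_selfadjoint])

lemma base_operator_selfadjoint: "selfadjoint_operator (carrier W) B"
  by (rule hom_convolution_selfadjoint[OF \<Gamma> W.group_axioms embed_base_hom[OF \<Lambda> \<Gamma>] m\<^sub>\<Gamma>])
    (rule G.selfadjoint_convolution_hermitian[OF B_selfadjoint])

lemma frozen_operator_selfadjoint: "selfadjoint_operator (carrier W) frozen_operator"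
  unfolding frozen_operator_def[abs_def]
  by (rule selfadjoint_compressed_sum[OF lamp_operator_selfadjoint base_operator_selfadjoint
    home_projector_orthogonal home_projector_commutes])

lemma wreath_convolution_linear_symmetric:
  shows "linear_operator (carrier W) M"
    and "\<And>f g. f \<in> ell2 (carrier W) \<Longrightarrow> g \<in> ell2 (carrier W) \<Longrightarrow>
      ell2_inner (carrier W) (M f) g = ell2_inner (carrier W) f (M g)"
proof -
  note sa = lamp_operator_selfadjoint base_operator_selfadjoint
  note lin = sa[THEN selfadjoint_imp_linear]
  note mem = lin[THEN linear_operator_mem]
  have M: "M f = (\<lambda>w. A f w + B f w)" if "f \<in> ell2 (carrier W)" for f
    by (rule wreath_convolution_eq[of f, OF ell2_bounded[OF that]])
  show "linear_operator (carrier W) M"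
    unfolding linear_operator_def
    by (simp add: M mem linear_operator_add[OF lin(1)] linear_operator_add[OF lin(2)]
      linear_operator_scale[OF lin(1)] linear_operator_scale[OF lin(2)] algebra_simps)
  show "ell2_inner (carrier W) (M f) g = ell2_inner (carrier W) f (M g)"
    if "f \<in> ell2 (carrier W)" "g \<in> ell2 (carrier W)" for f g
    using that by (simp add: M mem ell2_inner_simps selfadjoint_symmetric[OF sa(1)]
      selfadjoint_symmetric[OF sa(2)])
qed

text \<open>Iterating \<open>M = 1 \<otimes> N + L \<otimes> P\<close> on \<open>\<delta> \<otimes> \<delta>\<close>: the coefficients are those of the pencil with \<open>\<zeta>\<close> replaced by
  \<open>L\<close> acting on the other tensor factor.\<close>

lemma wreath_convolution_funpow:
  "(M ^^ j) (delta \<one>\<^bsub>W\<^esub>) = (\<lambda>w. \<Sum>i\<le>j. lamp_tensor ((L ^^ i) (delta \<one>\<^bsub>\<Lambda>\<^esub>))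
    (pencil_coeff frozen_operator home_projector (delta \<one>\<^bsub>W\<^esub>) j i) w)"
proof (induction j)
  case 0
  then show ?case by (simp flip: delta_one_lamp_tensor)
next
  case (Suc j)
  let ?l = "\<lambda>i. (L ^^ i) (delta \<one>\<^bsub>\<Lambda>\<^esub>)"
  let ?w = "pencil_coeff frozen_operator home_projector (delta \<one>\<^bsub>W\<^esub>) j"
  note linN = selfadjoint_imp_linear[OF frozen_operator_selfadjoint]
    and linP = selfadjoint_imp_linear[OF projector_imp_selfadjoint[OF home_projector_orthogonal]]
  have l: "?l i \<in> ell2 (carrier \<Lambda>)" for i
    by (simp add: selfadjoint_imp_linear[OF L_selfadjoint])
  have w: "?w i \<in> ell2 (carrier W)" for i
    by (rule pencil_coeff_mem[OF linN linP]) simp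
  have "cmod (lamp_tensor (?l i) (?w i) v) \<le> ell2_norm (carrier \<Lambda>) (?l i) * ell2_norm (carrier W) (?w i)" for i v
    by (auto simp: lamp_tensor_def norm_mult intro!: mult_mono ell2_bounded l w)
  then have sum: "M (\<lambda>v. \<Sum>i\<le>j. lamp_tensor (?l i) (?w i) v) = (\<lambda>v. \<Sum>i\<le>j. M (lamp_tensor (?l i) (?w i)) v)"
    using wreath_convolution_sum[of "{..j}" "\<lambda>i. lamp_tensor (?l i) (?w i)"] by blast
  have N0: "lamp_tensor \<phi> (frozen_operator (?w (Suc j))) = (\<lambda>v. 0)" for \<phi>
    by (simp only: pencil_coeff_eq_0[OF linN linP lessI] linear_operator_zero[OF linN]
      lamp_tensor_def mult_zero_right if_cancel)
  have "(M ^^ Suc j) (delta \<one>\<^bsub>W\<^esub>)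
      = (\<lambda>v. (\<Sum>i\<le>j. lamp_tensor (?l i) (frozen_operator (?w i)) v)
           + (\<Sum>i\<le>j. lamp_tensor (?l (Suc i)) (home_projector (?w i)) v))"
    by (simp add: Suc sum wreath_convolution_lamp_tensor[OF l w] sum.distrib)
  also have "\<dots> = (\<lambda>v. (\<Sum>i\<le>Suc j. lamp_tensor (?l i) (frozen_operator (?w i)) v)
           + (\<Sum>i\<le>j. lamp_tensor (?l (Suc i)) (home_projector (?w i)) v))"
    by (simp add: N0)
  also have "\<dots> = (\<lambda>v. \<Sum>i\<le>Suc j. lamp_tensor (?l i)
      (pencil_coeff frozen_operator home_projector (delta \<one>\<^bsub>W\<^esub>) (Suc j) i) v)"
    by (auto simp: lamp_tensor_def distrib_left sum.distrib sum.atMost_Suc_shift[of _ j] fun_eq_iff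
      simp del: sum.atMost_Suc funpow.simps)
  finally show ?case .
qed

lemma wreath_convolution_moment:
  assumes "x \<in> carrier W"
  shows "ell2_inner (carrier W) (delta x) ((M ^^ n) (delta x))
    = (\<Sum>i\<le>n. ell2_inner (carrier \<Lambda>) (delta \<one>\<^bsub>\<Lambda>\<^esub>) ((L ^^ i) (delta \<one>\<^bsub>\<Lambda>\<^esub>))
        * ell2_inner (carrier W) (delta \<one>\<^bsub>W\<^esub>)
            (pencil_coeff frozen_operator home_projector (delta \<one>\<^bsub>W\<^esub>) n i))"
  using assms
  by (simp add: W.convolution_moment_delta wreath_convolution_funpow lamp_tensor_at_one)

end

end

text \<open>The moments of \<open>L\<close> at the identity are those of \<open>\<rho>(t) dt\<close> restricted to a bounded interval, so the moments
  of \<open>M\<close> satisfy the hypothesis of \<open>averaged_Poisson_bound\<close> with \<open>d = \<delta>\<close>.\<close>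

lemma wreath_spectral_measure_bound:
  fixes \<Gamma> :: "('g, 'y) monoid_scheme" and \<Lambda> :: "('l, 'x) monoid_scheme"
    and m\<^sub>\<Gamma> :: "'g \<Rightarrow> complex" and m\<^sub>\<Lambda> :: "'l \<Rightarrow> complex"
  assumes \<Gamma>: "group \<Gamma>" and \<Lambda>: "group \<Lambda>"
    and m\<^sub>\<Gamma>: "finite_complex_measure \<Gamma> m\<^sub>\<Gamma>" and m\<^sub>\<Lambda>: "finite_complex_measure \<Lambda> m\<^sub>\<Lambda>"
    and sa\<Gamma>: "selfadjoint_operator (carrier \<Gamma>) (convolution_operator \<Gamma> m\<^sub>\<Gamma>)"
    and sa\<Lambda>: "selfadjoint_operator (carrier \<Lambda>) (convolution_operator \<Lambda> m\<^sub>\<Lambda>)"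
    and E\<^sub>\<Lambda>: "spectral_resolution (carrier \<Lambda>) (convolution_operator \<Lambda> m\<^sub>\<Lambda>) E\<^sub>\<Lambda>"
    and E\<^sub>M: "spectral_resolution (carrier (wreath \<Lambda> \<Gamma>))
           (convolution_operator (wreath \<Lambda> \<Gamma>) (wreath_measure \<Lambda> \<Gamma> m\<^sub>\<Lambda> m\<^sub>\<Gamma>)) E\<^sub>M"
    and C: "has_density_bounded_by (plancherel_measure \<Lambda> E\<^sub>\<Lambda>) C"
    and x: "x \<in> carrier (wreath \<Lambda> \<Gamma>)"
  shows "has_density_bounded_by (spectral_measure (carrier (wreath \<Lambda> \<Gamma>)) E\<^sub>M (delta x)) C"
proof -
  interpret L: group \<Lambda> by fact
  interpret W: group "wreath \<Lambda> \<Gamma>" by (rule group_wreath[OF \<Lambda> \<Gamma>])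
  let ?M = "convolution_operator (wreath \<Lambda> \<Gamma>) (wreath_measure \<Lambda> \<Gamma> m\<^sub>\<Lambda> m\<^sub>\<Gamma>)"
  let ?W = "carrier (wreath \<Lambda> \<Gamma>)" and ?L = "convolution_operator \<Lambda> m\<^sub>\<Lambda>"
  let ?\<nu> = "spectral_measure (carrier \<Lambda>) E\<^sub>\<Lambda> (delta \<one>\<^bsub>\<Lambda>\<^esub>)"
  let ?\<mu> = "spectral_measure ?W E\<^sub>M (delta x)"
  let ?N = "frozen_operator \<Lambda> \<Gamma> m\<^sub>\<Lambda> m\<^sub>\<Gamma>" and ?P = "home_projector \<Gamma> :: (('g \<Rightarrow> 'l) \<times> 'g) operator"
  let ?d = "delta \<one>\<^bsub>wreath \<Lambda> \<Gamma>\<^esub>"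
  obtain \<rho> where \<rho>: "\<rho> \<in> borel_measurable borel" "\<And>t. 0 \<le> \<rho> t" "\<And>t. \<rho> t \<le> C"
    and \<nu>: "?\<nu> = density lborel (\<lambda>t. ennreal (\<rho> t))"
    using C by (auto simp: has_density_bounded_by_def plancherel_measure_def)
  have C0: "0 \<le> C" using \<rho>(2,3) order_trans by blast
  obtain R where resL: "resolution_of_identity (carrier \<Lambda>) E\<^sub>\<Lambda>"
    and R: "\<And>f. f \<in> ell2 (carrier \<Lambda>) \<Longrightarrow> E\<^sub>\<Lambda> {-R..R} f = f"
    using E\<^sub>\<Lambda> by (auto simp: spectral_resolution_def)
  obtain r where resM: "resolution_of_identity ?W E\<^sub>M"
    and r: "\<And>f. f \<in> ell2 ?W \<Longrightarrow> E\<^sub>M {-r..r} f = f"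
    using E\<^sub>M by (auto simp: spectral_resolution_def)
  have dL: "delta \<one>\<^bsub>\<Lambda>\<^esub> \<in> ell2 (carrier \<Lambda>)" by simp
  have lamp_moment: "ell2_inner (carrier \<Lambda>) (delta \<one>\<^bsub>\<Lambda>\<^esub>) ((?L ^^ i) (delta \<one>\<^bsub>\<Lambda>\<^esub>))
      = complex_of_real (\<integral>t. indicator {-R..R} t * \<rho> t * t ^ i \<partial>lborel)" for i
  proof -
    have AE: "AE t in ?\<nu>. t \<in> {-R..R}"
      by (rule AE_spectral_measure_support[OF resL dL R[OF dL]])
    have "(\<integral>t. t ^ i \<partial>?\<nu>) = (\<integral>t. indicator {-R..R} t * t ^ i \<partial>?\<nu>)"
      by (rule integral_cong_AE) (use AE in \<open>auto simp: measurable_cong_sets[OF sets_spectral_measure refl]\<close>)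
    also have "\<dots> = (\<integral>t. \<rho> t *\<^sub>R (indicator {-R..R} t * t ^ i) \<partial>lborel)"
      unfolding \<nu> by (rule integral_density) (use \<rho> in auto)
    also have "\<dots> = (\<integral>t. indicator {-R..R} t * \<rho> t * t ^ i \<partial>lborel)"
      by (simp add: mult_ac)
    finally have "(\<integral>t. t ^ i \<partial>?\<nu>) = (\<integral>t. indicator {-R..R} t * \<rho> t * t ^ i \<partial>lborel)" .
    moreover have "ell2_inner (carrier \<Lambda>) (delta \<one>\<^bsub>\<Lambda>\<^esub>) ((?L ^^ i) (delta \<one>\<^bsub>\<Lambda>\<^esub>))
        = complex_of_real (\<integral>t. t ^ i \<partial>?\<nu>)"
      by (rule spectral_moments[OF E\<^sub>\<Lambda> selfadjoint_imp_linear[OF sa\<Lambda>] _ dL])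
        (rule selfadjoint_symmetric[OF sa\<Lambda>])
    ultimately show ?thesis by (simp only:)
  qed
  have dx: "delta x \<in> ell2 ?W" using x by simp
  have "ell2_inner ?W (delta x) ((?M ^^ n) (delta x)) = complex_of_real (\<integral>t. t ^ n \<partial>?\<mu>)" for n
    by (rule spectral_moments[OF E\<^sub>M wreath_convolution_linear_symmetric(1)[OF \<Lambda> \<Gamma> m\<^sub>\<Lambda> m\<^sub>\<Gamma> sa\<Lambda> sa\<Gamma>] _ dx])
      (rule wreath_convolution_linear_symmetric(2)[OF \<Lambda> \<Gamma> m\<^sub>\<Lambda> m\<^sub>\<Gamma> sa\<Lambda> sa\<Gamma>])
  then have moments: "complex_of_real (\<integral>t. t ^ n \<partial>?\<mu>) =
      (\<Sum>i\<le>n. of_real (\<integral>t. indicator {-R..R} t * \<rho> t * t ^ i \<partial>lborel)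
         * ell2_inner ?W ?d (pencil_coeff ?N ?P ?d n i))" for n
    using wreath_convolution_moment[OF \<Lambda> \<Gamma> m\<^sub>\<Lambda> m\<^sub>\<Gamma> sa\<Lambda> sa\<Gamma> x, of n] by (simp only: lamp_moment)
  have Pd: "?P ?d = ?d"
    by (auto simp: home_projector_def[OF \<Lambda> \<Gamma> m\<^sub>\<Lambda> m\<^sub>\<Gamma>] delta_def wreath_def fun_eq_iff)
  have fin: "finite_measure ?\<mu>" by (rule finite_spectral_measure[OF resM dx])
  have supp: "AE t in ?\<mu>. t \<in> {-r..r}" by (rule AE_spectral_measure_support[OF resM dx r[OF dx]])
  have Poisson: "(\<integral>\<^sup>+t. ennreal (y / ((t - s)\<^sup>2 + y\<^sup>2)) \<partial>?\<mu>) \<le> ennreal (pi * C)" if "0 < y" for s y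
    by (rule averaged_Poisson_bound[OF frozen_operator_selfadjoint[OF \<Lambda> \<Gamma> m\<^sub>\<Lambda> m\<^sub>\<Gamma> sa\<Lambda> sa\<Gamma>]
      home_projector_orthogonal[OF \<Lambda> \<Gamma> m\<^sub>\<Lambda> m\<^sub>\<Gamma>] ell2_delta ell2_norm_delta Pd fin sets_spectral_measure supp
      \<rho> moments that]) simp_all
  have "emeasure ?\<mu> U \<le> ennreal C * emeasure lborel U" if "open U" for U
    by (rule open_measure_le_if_Poisson_bounded[OF fin sets_spectral_measure C0 Poisson that])
  then have "emeasure ?\<mu> S \<le> ennreal C * emeasure lborel S" if "S \<in> sets borel" for S
    by (rule borel_measure_le_if_open_measure_le[OF sets_spectral_measure C0 _ that])
  then show ?thesis
    by (rule has_density_bounded_byI[OF sets_spectral_measure C0])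
qed

section \<open>Absolute continuity of the spectrum\<close>

theorem theorem2p1:
  fixes \<Gamma> :: "('g, 'y) monoid_scheme" and \<Lambda> :: "('l, 'x) monoid_scheme"
    and m\<^sub>\<Gamma> :: "'g \<Rightarrow> complex" and m\<^sub>\<Lambda> :: "'l \<Rightarrow> complex"
    and E\<^sub>\<Lambda> :: "real set \<Rightarrow> 'l operator"
    and E\<^sub>M :: "real set \<Rightarrow> (('g \<Rightarrow> 'l) \<times> 'g) operator"
    and C :: real
  assumes "group \<Gamma>" and "countable (carrier \<Gamma>)"
    and "group \<Lambda>" and "countable (carrier \<Lambda>)"
    and "finite_complex_measure \<Gamma> m\<^sub>\<Gamma>" and "finite_complex_measure \<Lambda> m\<^sub>\<Lambda>"
    and "selfadjoint_operator (carrier \<Gamma>) (convolution_operator \<Gamma> m\<^sub>\<Gamma>)"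
    and "selfadjoint_operator (carrier \<Lambda>) (convolution_operator \<Lambda> m\<^sub>\<Lambda>)"
    and "spectral_resolution (carrier \<Lambda>) (convolution_operator \<Lambda> m\<^sub>\<Lambda>) E\<^sub>\<Lambda>"
    and "spectral_resolution (carrier (wreath \<Lambda> \<Gamma>))
           (convolution_operator (wreath \<Lambda> \<Gamma>) (wreath_measure \<Lambda> \<Gamma> m\<^sub>\<Lambda> m\<^sub>\<Gamma>)) E\<^sub>M"
    and "has_density_bounded_by (plancherel_measure \<Lambda> E\<^sub>\<Lambda>) C"
  shows "has_density_bounded_by (plancherel_measure (wreath \<Lambda> \<Gamma>) E\<^sub>M) C
       \<and> purely_absolutely_continuous (carrier (wreath \<Lambda> \<Gamma>)) E\<^sub>M"
proof
  let ?W = "carrier (wreath \<Lambda> \<Gamma>)"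
  interpret W: group "wreath \<Lambda> \<Gamma>" by (rule group_wreath[OF assms(3,1)])
  note dens = wreath_spectral_measure_bound[OF assms(1,3,5-11)]
  show "has_density_bounded_by (plancherel_measure (wreath \<Lambda> \<Gamma>) E\<^sub>M) C"
    unfolding plancherel_measure_def by (rule dens) simp
  have E: "resolution_of_identity ?W E\<^sub>M"
    using assms(10) by (simp add: spectral_resolution_def)
  show "purely_absolutely_continuous ?W E\<^sub>M"
    unfolding purely_absolutely_continuous_def absolutely_continuous_def
  proof (intro ballI subsetI)
    \<comment> \<open>\<open>E\<^sub>M Z\<close> kills every point mass, hence all matrix entries of \<open>E\<^sub>M Z\<close> vanish.\<close>
    fix f and Z :: "real set" assume f: "f \<in> ell2 ?W" and Z: "Z \<in> null_sets lborel"
    then have Zb: "Z \<in> sets borel" by auto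
    have "E\<^sub>M Z f x = 0" if x: "x \<in> ?W" for x
    proof -
      have dx: "delta x \<in> ell2 ?W" using x by simp
      from dens[OF x] obtain \<rho> where "\<rho> \<in> borel_measurable borel"
        and "spectral_measure ?W E\<^sub>M (delta x) = density lborel (\<lambda>t. ennreal (\<rho> t))"
        by (auto simp: has_density_bounded_by_def)
      then have "Z \<in> null_sets (spectral_measure ?W E\<^sub>M (delta x))"
        using absolutely_continuousI_density[of "\<lambda>t. ennreal (\<rho> t)" lborel] Z
        by (auto simp: absolutely_continuous_def)
      then have "measure (spectral_measure ?W E\<^sub>M (delta x)) Z = 0"
        by (simp add: measure_eq_0_null_sets)
      then have "ell2_norm ?W (E\<^sub>M Z (delta x)) = 0"
        using measure_spectral_measure[OF E dx Zb] resolution_inner_self[OF E Zb dx] by simp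
      then have "E\<^sub>M Z (delta x) = (\<lambda>y. 0)"
        using ell2_norm_eq_0D[OF resolution_mem[OF E Zb dx]] by blast
      then have "ell2_inner ?W (delta x) (E\<^sub>M Z f) = 0"
        using resolution_symmetric[OF E Zb dx f] by (simp add: ell2_inner_def)
      then show ?thesis using x by simp
    qed
    then have "ell2_inner ?W f (E\<^sub>M Z f) = 0"
      by (simp add: ell2_inner_def cong: infsum_cong)
    then show "Z \<in> null_sets (spectral_measure ?W E\<^sub>M f)"
      using Zb by (simp add: null_sets_def emeasure_spectral_measure[OF E f])
  qed
qed

end
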